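(* Consider the Euler-Lagrange system $$M(q)\ddot q+C(q,\dot q)\dot q+N(q,\dot q)=u,\qquad q,u\in\mathbb{R}^n,$$ satisfying the Euler-Lagrange assumption of the context with constants $\mu_{m1},\mu_{m2}>0$. Let the velocity command $v_c:\mathbb{R}_+\to\mathbb{R}^n$ satisfy $|v_c(t)|\le\bar v_c$, $|\dot v_c(t)|\le v_c^d$ for all $t\ge0$ with positive constants $\bar v_c,v_c^d$. Let $N\ge1$ obstacles be given by $q_{oi}\in\mathbb{R}^n$, $d_{si}>0$, $i=1,\ldots,N$, satisfying the obstacle distance assumption of the context with constants $d_a,d_b,d_h$, and let $\bar v>0$, $d_r>0$. Consider the closed-loop system composed of the Euler-Lagrange system, the outer-loop law $v^*=\varphi(q,v_c)$ given by the solution of the quadratic program (QP) of the context, and the inner-loop law $$u=N(q,\dot q)+C(q,\dot q)v^*-k_D(\dot q-v^* ),\qquad k_D>0 .$$ Put $\underline d_s=\min_i d_{si}$, $\bar d_s=\max_i d_{si}$, and suppose $$\sqrt2\,\underline d_s>d_a,\qquad \bar v>2d_r,\qquad \frac{2\underline d_s^2-d_a^2}{2(\bar d_s+d_b/2)^2}>1-\frac{(\bar v-2d_r)^2}{2(\bar v-d_r)^2}.$$ Let $$c^*=\frac{(2\bar d_s+d_b)^2-4\underline d_s^2+2d_a^2}{2(2\bar d_s+d_b)^2},\qquad \kappa=\sqrt{c^*+\frac{d_r}{\bar v-d_r}}-\sqrt{c^*}.$$ (1) There exist a Lipschitz (nonnegative, non-increasing) function $\phi:[-1,1]\to\mathbb{R}_+$,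 a constant $0<c_0<1$ and a Lipschitz $\alpha_c\in\mathcal{K}^e$ whose inverse function is also Lipschitz satisfying $$c_0>\sqrt{c^*}+\sqrt{c^*+\frac{d_r}{\bar v-d_r}},$$ $$c_0(\bar v-d_r)\ \ge\ c_0\alpha_c\!\left(\frac{d_b}{2}\right)-d_r\ >\ \frac{d_r-c_0\alpha_c(-d_h)}{\kappa},$$ $$\phi(s)>\max_{p\in[0,d_h]}\left\{\max_{K\in\left\{c_0(\bar v-d_r),\ \frac{d_r-c_0\alpha_c(-p)}{\kappa}\right\}}\left\{\alpha_c^{-1}\!\left(\frac{-K(s-c_0)}{c_0}+\frac{-K\kappa+d_r}{c_0}\right)\right\}+p\right\},\quad s\in[-1,c_0),$$ $$\phi(s)=0,\quad s\in[c_0,1],$$ and the map $v^*=\varphi(q,v_c)$ representing the solution of (QP) satisfies, with positive constants $\Delta_h$ and $L$, $$\min\{h_i(q_1),h_i(q_2)\}\ge-\Delta_h,\ i=1,\ldots,N,\ q_1,q_2\in\mathbb{R}^n\ \Longrightarrow\ |\varphi(q_1,v_{c1})-\varphi(q_2,v_{c2})|\le L(|q_1-q_2|+|v_{c1}-v_{c2}|)$$ for all $v_{c1},v_{c2}\in\mathbb{R}^n$. (2) In addition, with $k_D$ chosen such that $$k_D>2nL\,\frac{\mu_{m2}^3(v_c^d+\bar v)}{\mu_{m1}^2d_r},$$ there exist a Lipschitz $\mathcal{K}^e$ function $\alpha_w$ and a positive constant $d_w$ such that $$W(q,\dot q,v_c)\le d_w\ \Longrightarrow\ \delta^T[\dot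 q;\ddot q;\dot v_c]\le-\alpha_w(W(q,\dot q,v_c)),\quad\forall\,\delta\in\partial W(q,\dot q,v_c),$$ holds for all $q,\dot q,v_c\in\mathbb{R}^n$, where $\ddot q$ is given by the closed-loop dynamics and $|v_c|\le\bar v_c$, $|\dot v_c|\le v_c^d$, and where $$W(q,\dot q,v_c)=\max\{W_1(q,\dot q,v_c),\ldots,W_{N+1}(q,\dot q,v_c)\},$$ $$W_i(q,\dot q,v_c)=-h_i(q),\quad i=1,\ldots,N,$$ $$W_{N+1}(q,\dot q,v_c)=-\frac{nL\mu_{m1}\mu_{m2}^2(v_c^d+\bar v-d_r)d_r}{\mu_{m1}k_D-2nL\mu_{m2}^2}+\frac12(\dot q-\varphi(q,v_c))^TM(q)(\dot q-\varphi(q,v_c)).$$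
   Context: $|\cdot|$ is the Euclidean norm; $\mathbb{R}_+=[0,\infty)$; $[a;b;c]$ denotes stacking of column vectors. A continuous function $\alpha:\mathbb{R}\to\mathbb{R}$ is of class $\mathcal{K}^e$ if it is strictly increasing and $\alpha(0)=0$. The symbol $N$ without arguments is the number of obstacles; $N(q,\dot q)$ is the vector of resistance and gravity terms. Euler-Lagrange assumption: $M(q)\in\mathbb{R}^{n\times n}$ (continuously differentiable in $q$), $C(q,\dot q)\in\mathbb{R}^{n\times n}$, $N(q,\dot q)\in\mathbb{R}^n$; along trajectories of the system, $(\dot M-2C)+(\dot M-2C)^T=0$, where $\dot M=\sum_j\frac{\partial M}{\partial q_j}(q)\dot q_j$; $M(q)$ is invertible and symmetric for every $q\in\mathbb{R}^n$, and there are positive constants $\mu_{m1},\mu_{m2}$ with $\mu_{m1}I_{n\times n}<M(q)<\mu_{m2}I_{n\times n}$ for all $q$ ($A<B$ means $B-A$ is positive definite). Obstacle functions: $h_i(q)=|q_{oi}-q|-d_{si}$, $i=1,\ldots,N$. Obstacle distance assumption: there exist constants $d_a,d_b,d_h>0$ with $d_a<\min_i d_{si}$ and $d_h<\min_i d_{si}$ such that for any $q\in\mathbb{R}^n$ with $h_i(q)\ge-d_h$ for all $i$, if $h_j(q)\le d_b/2$ and $h_k(q)\le d_b/2$ for some $j,k\in\{1,\ldots,N\}$, then $|q_{oj}-q_{ok}|\le d_a$. Positive basis: for the given $c_0\in(0,1)$, $\mathcal{L}=\{l_1,\ldots,l_m\}\subset\mathbb{R}^n$ is a fixed finite set of unit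 vectors such that any unit vector $l_o\in\mathbb{R}^n$ is a positive combination of the elements of $\{l_p:l_p^Tl_o\ge c_0,\ p=1,\ldots,m\}$, and this set has cardinality not less than $n$. For $q\ne q_{o1},\ldots,q_{oN}$ let $l_{oi}(q)=\dfrac{q_{oi}-q}{|q_{oi}-q|}$ and $$r(q,l_k)=\min_{i=1,\ldots,N}\{|q_{oi}-q|-d_{si}+\phi(l_{oi}^T(q)l_k)\}.$$ (QP): $v^*=\operatorname{argmin}_{v^*\in\mathbb{R}^n}|v^*-v_c|^2$ subject to $$l_k^Tv^*\le c_0\alpha_c(r(q,l_k))-d_r,\qquad l_k^Tv^*\le c_0(\bar v-d_r),\qquad k=1,\ldots,m.$$ When (QP) has a unique solution, $\varphi(q,v_c)$ denotes that solution; $W$ is considered at points where $\varphi$ is defined. For a locally Lipschitz $f:\mathbb{R}^k\to\mathbb{R}$, $f^\circ(x,v)=\limsup_{y\to x,\lambda\downarrow0}\frac{f(y+\lambda v)-f(y)}{\lambda}$ and the (Clarke) generalized gradient is $\partial f(x)=\{\epsilon\in\mathbb{R}^k:f^\circ(x,v)\ge\epsilon^Tv\ \ \forall v\in\mathbb{R}^k\}$. $\partial W$ is taken with respect to $(q,\dot q,v_c)\in\mathbb{R}^{3n}$. *)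

theory Defs
  imports "HOL-Analysis.Analysis"
begin

section \<open>Comparison functions and Clarke's generalized gradient\<close>

definition class_Ke :: "(real \<Rightarrow> real) \<Rightarrow> bool" where
  "class_Ke \<alpha> \<longleftrightarrow> continuous_on UNIV \<alpha> \<and> strict_mono \<alpha> \<and> \<alpha> 0 = 0"

definition lipschitz_fun_on :: "'a::metric_space set \<Rightarrow> ('a \<Rightarrow> 'b::metric_space) \<Rightarrow> bool" where
  "lipschitz_fun_on S f \<longleftrightarrow> (\<exists>B. B-lipschitz_on S f)"

text \<open>The base point \<open>y\<close> ranges over full neighbourhoods of \<open>x\<close> (\<open>y = x\<close> included). The upper
  limit is taken in the extended reals; it is finite when \<open>f\<close> is Lipschitz near \<open>x\<close>.\<close>

definition clarke_dd :: "('a::euclidean_space \<Rightarrow> real) \<Rightarrow> 'a \<Rightarrow> 'a \<Rightarrow> ereal" where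
  "clarke_dd f x v =
     Limsup (nhds x \<times>\<^sub>F at_right 0) (\<lambda>(y, t). ereal ((f (y + t *\<^sub>R v) - f y) / t))"

definition clarke_gradient :: "('a::euclidean_space \<Rightarrow> real) \<Rightarrow> 'a \<Rightarrow> 'a set" where
  "clarke_gradient f x = {\<epsilon>. \<forall>v. clarke_dd f x v \<ge> ereal (\<epsilon> \<bullet> v)}"


section \<open>Euler-Lagrange systems\<close>

definition pos_definite :: "real^'n^'n \<Rightarrow> bool" where
  "pos_definite A \<longleftrightarrow> transpose A = A \<and> (\<forall>x. x \<noteq> 0 \<longrightarrow> x \<bullet> (A *v x) > 0)"

definition continuously_differentiable :: "('a::real_normed_vector \<Rightarrow> 'b::real_normed_vector) \<Rightarrow> bool" where
  "continuously_differentiable f \<longleftrightarrow>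
     (\<exists>f'. (\<forall>x. (f has_derivative blinfun_apply (f' x)) (at x)) \<and> continuous_on UNIV f')"

definition partial_deriv :: "(real^'n \<Rightarrow> 'b::real_normed_vector) \<Rightarrow> 'n \<Rightarrow> real^'n \<Rightarrow> 'b" where
  "partial_deriv f j q = vector_derivative (\<lambda>s. f (q + s *\<^sub>R axis j 1)) (at 0)"

definition M_dot :: "(real^'n \<Rightarrow> real^'n^'n) \<Rightarrow> real^'n \<Rightarrow> real^'n \<Rightarrow> real^'n^'n" where
  "M_dot M q qd = (\<Sum>j\<in>UNIV. (qd $ j) *\<^sub>R partial_deriv M j q)"

definition el_dynamics ::
  "(real^'n \<Rightarrow> real^'n^'n) \<Rightarrow> (real^'n \<Rightarrow> real^'n \<Rightarrow> real^'n^'n) \<Rightarrow> (real^'n \<Rightarrow> real^'n \<Rightarrow> real^'n)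
   \<Rightarrow> real^'n \<Rightarrow> real^'n \<Rightarrow> real^'n \<Rightarrow> real^'n \<Rightarrow> bool" where
  "el_dynamics M C Nv q qd qdd u \<longleftrightarrow> M q *v qdd + C q qd *v qd + Nv q qd = u"

definition el_trajectory ::
  "(real^'n \<Rightarrow> real^'n^'n) \<Rightarrow> (real^'n \<Rightarrow> real^'n \<Rightarrow> real^'n^'n) \<Rightarrow> (real^'n \<Rightarrow> real^'n \<Rightarrow> real^'n)
   \<Rightarrow> (real \<Rightarrow> real^'n) \<Rightarrow> (real \<Rightarrow> real^'n) \<Rightarrow> (real \<Rightarrow> real^'n) \<Rightarrow> (real \<Rightarrow> real^'n) \<Rightarrow> bool" where
  "el_trajectory M C Nv q qd qdd u \<longleftrightarrow>
     (\<forall>t\<ge>0. (q has_vector_derivative qd t) (at t within {0..}) \<and>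
            (qd has_vector_derivative qdd t) (at t within {0..}) \<and>
            el_dynamics M C Nv (q t) (qd t) (qdd t) (u t))"

text \<open>The input \<open>u\<close> of the open-loop system is arbitrary, so that the skew-symmetry condition
  concerns every state \<open>(q, qd)\<close>.\<close>

definition el_assumption ::
  "(real^'n \<Rightarrow> real^'n^'n) \<Rightarrow> (real^'n \<Rightarrow> real^'n \<Rightarrow> real^'n^'n) \<Rightarrow> (real^'n \<Rightarrow> real^'n \<Rightarrow> real^'n)
   \<Rightarrow> real \<Rightarrow> real \<Rightarrow> bool" where
  "el_assumption M C Nv \<mu>1 \<mu>2 \<longleftrightarrow>
     continuously_differentiable M \<and>
     (\<forall>q qd qdd u. el_trajectory M C Nv q qd qdd u \<longrightarrow>
        (\<forall>t\<ge>0. let S = M_dot M (q t) (qd t) - 2 *\<^sub>R C (q t) (qd t) in S + transpose S = 0)) \<and>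
     (\<forall>q. invertible (M q) \<and> transpose (M q) = M q) \<and>
     \<mu>1 > 0 \<and> \<mu>2 > 0 \<and>
     (\<forall>q. pos_definite (M q - mat \<mu>1) \<and> pos_definite (mat \<mu>2 - M q))"


section \<open>Obstacles\<close>

text \<open>Obstacles are indexed by \<open>{1..N}\<close>, with centres \<open>qo i\<close> and safe distances \<open>ds i\<close>.\<close>

definition obs_h :: "(nat \<Rightarrow> real^'n) \<Rightarrow> (nat \<Rightarrow> real) \<Rightarrow> nat \<Rightarrow> real^'n \<Rightarrow> real" where
  "obs_h qo ds i q = norm (qo i - q) - ds i"

definition obs_dir :: "(nat \<Rightarrow> real^'n) \<Rightarrow> nat \<Rightarrow> real^'n \<Rightarrow> real^'n" where
  "obs_dir qo i q = (qo i - q) /\<^sub>R norm (qo i - q)"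

definition ds_min :: "nat \<Rightarrow> (nat \<Rightarrow> real) \<Rightarrow> real" where
  "ds_min N ds = Min (ds ` {1..N})"

definition ds_max :: "nat \<Rightarrow> (nat \<Rightarrow> real) \<Rightarrow> real" where
  "ds_max N ds = Max (ds ` {1..N})"

definition obs_distance_assumption ::
  "nat \<Rightarrow> (nat \<Rightarrow> real^'n) \<Rightarrow> (nat \<Rightarrow> real) \<Rightarrow> real \<Rightarrow> real \<Rightarrow> real \<Rightarrow> bool" where
  "obs_distance_assumption N qo ds da db dh \<longleftrightarrow>
     da > 0 \<and> db > 0 \<and> dh > 0 \<and> da < ds_min N ds \<and> dh < ds_min N ds \<and>
     (\<forall>q. (\<forall>i\<in>{1..N}. obs_h qo ds i q \<ge> - dh) \<longrightarrow>
        (\<forall>j\<in>{1..N}. \<forall>k\<in>{1..N}. obs_h qo ds j q \<le> db / 2 \<and> obs_h qo ds k q \<le> db / 2 \<longrightarrow>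
           norm (qo j - qo k) \<le> da))"

definition c_star :: "real \<Rightarrow> real \<Rightarrow> real \<Rightarrow> real \<Rightarrow> real" where
  "c_star dsmin dsmax da db =
     ((2 * dsmax + db)\<^sup>2 - 4 * dsmin\<^sup>2 + 2 * da\<^sup>2) / (2 * (2 * dsmax + db)\<^sup>2)"

definition kappa :: "real \<Rightarrow> real \<Rightarrow> real \<Rightarrow> real" where
  "kappa cs dr vbar = sqrt (cs + dr / (vbar - dr)) - sqrt cs"


section \<open>The quadratic program\<close>

text \<open>A positive combination is, as usual for positive bases, a linear combination with
  nonnegative coefficients.\<close>

definition positive_combination :: "('a::real_vector) set \<Rightarrow> 'a \<Rightarrow> bool" where
  "positive_combination S x \<longleftrightarrow> (\<exists>a. (\<forall>l\<in>S. a l \<ge> (0::real)) \<and> x = (\<Sum>l\<in>S. a l *\<^sub>R l))"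

definition positive_basis :: "real \<Rightarrow> (real^'n) set \<Rightarrow> bool" where
  "positive_basis c0 \<L> \<longleftrightarrow>
     finite \<L> \<and> (\<forall>l\<in>\<L>. norm l = 1) \<and>
     (\<forall>lo. norm lo = 1 \<longrightarrow>
        positive_combination {l\<in>\<L>. l \<bullet> lo \<ge> c0} lo \<and> card {l\<in>\<L>. l \<bullet> lo \<ge> c0} \<ge> CARD('n))"

definition r_fun ::
  "nat \<Rightarrow> (nat \<Rightarrow> real^'n) \<Rightarrow> (nat \<Rightarrow> real) \<Rightarrow> (real \<Rightarrow> real) \<Rightarrow> real^'n \<Rightarrow> real^'n \<Rightarrow> real" where
  "r_fun N qo ds \<phi> q l = Min ((\<lambda>i. norm (qo i - q) - ds i + \<phi> (obs_dir qo i q \<bullet> l)) ` {1..N})"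

definition qp_feasible ::
  "(real \<Rightarrow> real) \<Rightarrow> real \<Rightarrow> real \<Rightarrow> real \<Rightarrow> (real^'n) set \<Rightarrow> (real^'n \<Rightarrow> real) \<Rightarrow> (real^'n) set" where
  "qp_feasible \<alpha>c c0 dr vbar \<L> r =
     {v. \<forall>l\<in>\<L>. l \<bullet> v \<le> c0 * \<alpha>c (r l) - dr \<and> l \<bullet> v \<le> c0 * (vbar - dr)}"

definition qp_solution ::
  "nat \<Rightarrow> (nat \<Rightarrow> real^'n) \<Rightarrow> (nat \<Rightarrow> real) \<Rightarrow> (real \<Rightarrow> real) \<Rightarrow> (real \<Rightarrow> real) \<Rightarrow> real \<Rightarrow> real \<Rightarrow> real
   \<Rightarrow> (real^'n) set \<Rightarrow> real^'n \<Rightarrow> real^'n \<Rightarrow> real^'n \<Rightarrow> bool" where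
  "qp_solution N qo ds \<phi> \<alpha>c c0 dr vbar \<L> q vc =
     is_arg_min (\<lambda>v. (norm (v - vc))\<^sup>2)
       (\<lambda>v. v \<in> qp_feasible \<alpha>c c0 dr vbar \<L> (r_fun N qo ds \<phi> q))"

text \<open>\<open>varphi\<close> is meaningful only where \<open>varphi_defined\<close> holds.\<close>

definition varphi_defined ::
  "nat \<Rightarrow> (nat \<Rightarrow> real^'n) \<Rightarrow> (nat \<Rightarrow> real) \<Rightarrow> (real \<Rightarrow> real) \<Rightarrow> (real \<Rightarrow> real) \<Rightarrow> real \<Rightarrow> real \<Rightarrow> real
   \<Rightarrow> (real^'n) set \<Rightarrow> real^'n \<Rightarrow> real^'n \<Rightarrow> bool" where
  "varphi_defined N qo ds \<phi> \<alpha>c c0 dr vbar \<L> q vc \<longleftrightarrow>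
     (\<forall>i\<in>{1..N}. q \<noteq> qo i) \<and> (\<exists>!v. qp_solution N qo ds \<phi> \<alpha>c c0 dr vbar \<L> q vc v)"

definition varphi ::
  "nat \<Rightarrow> (nat \<Rightarrow> real^'n) \<Rightarrow> (nat \<Rightarrow> real) \<Rightarrow> (real \<Rightarrow> real) \<Rightarrow> (real \<Rightarrow> real) \<Rightarrow> real \<Rightarrow> real \<Rightarrow> real
   \<Rightarrow> (real^'n) set \<Rightarrow> real^'n \<Rightarrow> real^'n \<Rightarrow> real^'n" where
  "varphi N qo ds \<phi> \<alpha>c c0 dr vbar \<L> q vc = (THE v. qp_solution N qo ds \<phi> \<alpha>c c0 dr vbar \<L> q vc v)"

text \<open>The supremum over the compact interval \<open>{0..dh}\<close> is a maximum, since the expression is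
  continuous in \<open>p\<close> for a homeomorphism \<open>\<alpha>c\<close> of the real line.\<close>

definition phi_lower_bound ::
  "(real \<Rightarrow> real) \<Rightarrow> real \<Rightarrow> real \<Rightarrow> real \<Rightarrow> real \<Rightarrow> real \<Rightarrow> real \<Rightarrow> real" where
  "phi_lower_bound \<alpha>c c0 \<kappa> vbar dr dh s =
     (SUP p\<in>{0..dh}.
        Max ((\<lambda>K. inv \<alpha>c (- K * (s - c0) / c0 + (- K * \<kappa> + dr) / c0)) `
             {c0 * (vbar - dr), (dr - c0 * \<alpha>c (- p)) / \<kappa>}) + p)"


section \<open>Closed loop and the function W\<close>

text \<open>Below, \<open>vp\<close> is the outer-loop map \<open>(q, vc) \<mapsto> v*\<close>, \<open>vcd\<close> the bound on the derivative of the
  velocity command, and \<open>L\<close> the Lipschitz constant of \<open>vp\<close>.\<close>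

definition inner_loop ::
  "(real^'n \<Rightarrow> real^'n \<Rightarrow> real^'n^'n) \<Rightarrow> (real^'n \<Rightarrow> real^'n \<Rightarrow> real^'n) \<Rightarrow> real
   \<Rightarrow> real^'n \<Rightarrow> real^'n \<Rightarrow> real^'n \<Rightarrow> real^'n" where
  "inner_loop C Nv kD q qd vstar = Nv q qd + C q qd *v vstar - kD *\<^sub>R (qd - vstar)"

definition W_comp ::
  "nat \<Rightarrow> (nat \<Rightarrow> real^'n) \<Rightarrow> (nat \<Rightarrow> real) \<Rightarrow> (real^'n \<Rightarrow> real^'n^'n) \<Rightarrow> real \<Rightarrow> real \<Rightarrow> real \<Rightarrow> real
   \<Rightarrow> real \<Rightarrow> real \<Rightarrow> real \<Rightarrow> (real^'n \<Rightarrow> real^'n \<Rightarrow> real^'n)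
   \<Rightarrow> nat \<Rightarrow> (real^'n) \<times> (real^'n) \<times> (real^'n) \<Rightarrow> real" where
  "W_comp N qo ds M \<mu>1 \<mu>2 vcd vbar dr kD L vp i = (\<lambda>(q, qd, vc).
     if i \<le> N then - obs_h qo ds i q
     else - (real CARD('n) * L * \<mu>1 * \<mu>2\<^sup>2 * (vcd + vbar - dr) * dr)
              / (\<mu>1 * kD - 2 * real CARD('n) * L * \<mu>2\<^sup>2)
          + 1 / 2 * ((qd - vp q vc) \<bullet> (M q *v (qd - vp q vc))))"

definition W_fun ::
  "nat \<Rightarrow> (nat \<Rightarrow> real^'n) \<Rightarrow> (nat \<Rightarrow> real) \<Rightarrow> (real^'n \<Rightarrow> real^'n^'n) \<Rightarrow> real \<Rightarrow> real \<Rightarrow> real \<Rightarrow> real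
   \<Rightarrow> real \<Rightarrow> real \<Rightarrow> real \<Rightarrow> (real^'n \<Rightarrow> real^'n \<Rightarrow> real^'n)
   \<Rightarrow> (real^'n) \<times> (real^'n) \<times> (real^'n) \<Rightarrow> real" where
  "W_fun N qo ds M \<mu>1 \<mu>2 vcd vbar dr kD L vp x =
     Max ((\<lambda>i. W_comp N qo ds M \<mu>1 \<mu>2 vcd vbar dr kD L vp i x) ` {1..N+1})"

end

theory Submission
  imports Defs
begin

text \<open>Near the obstacles the quadratic program is feasible because all obstacles within distance
  \<open>db / 2\<close> are seen from \<open>q\<close> in nearly the same direction: the chord between two such directions
  barely exceeds \<open>2 * sqrt cs < c0 - \<kappa>\<close> and stays below \<open>c0 - \<kappa>\<close>, so that retreating from any one of them satisfies every
  constraint. Its solution is the projection of \<open>vc\<close> onto a polyhedron whose face normals are fixed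
  and whose offsets are Lipschitz in \<open>q\<close>. Where the set of active faces is constant the projection
  is affine in the offsets, and along a segment of offsets finitely many such pieces, glued by
  continuity, give a global Lipschitz bound.

  For the decrease of \<open>W\<close>, a difference quotient of a maximum is bounded by that of an active
  component. If an obstacle function is active, its gradient is a positive combination of basis
  vectors whose constraints force the velocity command away from the obstacle with margin \<open>dr\<close>, and
  the bound on \<open>W\<close> keeps the velocity error below \<open>dr\<close>. If the energy is active, skew symmetry leaves
  \<open>- kD |e|\<^sup>2\<close> against the Lipschitz drift of the command, and the choice of \<open>kD\<close> makes the
  former dominate on the level set \<open>W = 0\<close>. Both estimates persist for \<open>W\<close> slightly
  positive, while for negative \<open>W\<close> a steep branch of \<open>\<alpha>w\<close> absorbs the remaining terms.\<close>

section \<open>Projection onto a polyhedron with moving faces\<close>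

text \<open>The threshold \<open>T = sqrt cs + sqrt (cs + dr / (vbar - dr))\<close> for
  \<open>c0\<close> serves two demands at once, and \<open>\<kappa>\<close> is the number for which
  they meet: \<open>T - \<kappa> = 2 * sqrt cs\<close> and
  \<open>T * \<kappa> = dr / (vbar - dr)\<close>. So \<open>c0 > T\<close> gives both
  \<open>2 * sqrt cs < c0 - \<kappa>\<close> and \<open>dr < c0 * (vbar - dr) * \<kappa>\<close>;
  the latter leaves room for a retreat speed \<open>(dr - c0 * \<alpha>c (- dh)) / \<kappa>\<close>
  below the cap \<open>c0 * (vbar - dr)\<close> once \<open>\<alpha>c\<close> is flat enough on the
  negative axis.

  The quantifiers shape the rest. \<open>\<phi>\<close>, \<open>c0\<close> and
  \<open>\<alpha>c\<close> precede the basis, so their choice uses only the scalar data;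
  \<open>L\<close> depends on the basis, and \<open>kD\<close> on \<open>L\<close>. The solution map
  is merely Lipschitz, and the Clarke derivative compares states on a full neighbourhood. Hence a
  violation of the obstacle constraints by some \<open>\<Delta> > 0\<close> must be tolerated,
  feasibility must survive it, and \<open>dw < \<Delta>\<close> keeps the relevant states inside the
  open set where the Lipschitz bound applies.\<close>

definition face_polyhedron :: "'a::euclidean_space set \<Rightarrow> ('a \<Rightarrow> real) \<Rightarrow> 'a set" where
  "face_polyhedron S b = {v. \<forall>l\<in>S. l \<bullet> v \<le> b l}"

lemma face_polyhedron_eq_Inter: "face_polyhedron S b = (\<Inter>l\<in>S. {v. l \<bullet> v \<le> b l})"
  by (auto simp: face_polyhedron_def)

lemma closed_face_polyhedron: "closed (face_polyhedron S b)"
  unfolding face_polyhedron_eq_Inter by (intro closed_INT ballI closed_halfspace_le)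

lemma convex_face_polyhedron: "convex (face_polyhedron S b)"
  unfolding face_polyhedron_eq_Inter by (intro convex_INT convex_halfspace_le)

text \<open>Split the residual into a part in the span of the active normals and an orthogonal part
  \<open>z\<close>. A small step along \<open>z\<close> leaves the active constraints unchanged and
  cannot break the slack ones, so it stays in the polyhedron; optimality of \<open>p\<close> then
  forces \<open>z = 0\<close>.\<close>

lemma closest_point_residual_in_span:
  fixes S :: "'a::euclidean_space set" and c :: 'a
  assumes fin: "finite S" and ne: "face_polyhedron S b \<noteq> {}"
  defines "p \<equiv> closest_point (face_polyhedron S b) c"
  shows "c - p \<in> span {l\<in>S. l \<bullet> p = b l}"
proof -
  let ?A = "{l\<in>S. l \<bullet> p = b l}"
  have p: "p \<in> face_polyhedron S b"
    unfolding p_def by (intro closest_point_in_set closed_face_polyhedron ne)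
  obtain y z where y: "y \<in> span ?A" and z: "\<And>w. w \<in> span ?A \<Longrightarrow> orthogonal z w"
    and yz: "c - p = y + z"
    by (rule orthogonal_subspace_decomp_exists[of ?A "c - p"]) blast
  have "eventually (\<lambda>e. \<forall>l\<in>S. l \<bullet> (p + e *\<^sub>R z) \<le> b l) (at_right (0::real))"
  proof (intro eventually_ball_finite fin ballI)
    fix l assume l: "l \<in> S"
    show "eventually (\<lambda>e. l \<bullet> (p + e *\<^sub>R z) \<le> b l) (at_right (0::real))"
    proof (cases "l \<bullet> p = b l")
      case True
      then have "l \<bullet> z = 0"
        using z[of l] l by (auto simp: orthogonal_def inner_commute intro: span_base)
      with True show ?thesis by (simp add: inner_add_right)
    next
      case False
      with p l have "l \<bullet> p < b l" by (force simp: face_polyhedron_def)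
      moreover have "((\<lambda>e. l \<bullet> (p + e *\<^sub>R z)) \<longlongrightarrow> l \<bullet> (p + 0 *\<^sub>R z)) (at_right 0)"
        by (intro tendsto_intros)
      ultimately have "eventually (\<lambda>e. l \<bullet> (p + e *\<^sub>R z) < b l) (at_right (0::real))"
        by (intro order_tendstoD) auto
      then show ?thesis by eventually_elim simp
    qed
  qed
  moreover have "eventually (\<lambda>e. e > 0) (at_right (0::real))"
    by (simp add: eventually_at_right_less)
  ultimately have "eventually (\<lambda>e. 0 < e \<and> (\<forall>l\<in>S. l \<bullet> (p + e *\<^sub>R z) \<le> b l)) (at_right (0::real))"
    by eventually_elim simp
  from eventually_happens'[OF trivial_limit_at_right_real this]
  obtain e where e: "e > 0" "p + e *\<^sub>R z \<in> face_polyhedron S b"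
    by (auto simp: face_polyhedron_def)
  have "(c - p) \<bullet> (p + e *\<^sub>R z - p) \<le> 0"
    unfolding p_def by (rule closest_point_dot[OF convex_face_polyhedron closed_face_polyhedron])
      (use e in \<open>simp add: p_def\<close>)
  moreover have "y \<bullet> z = 0" using z[OF y] by (simp add: orthogonal_def inner_commute)
  ultimately have "e * (z \<bullet> z) \<le> 0" by (simp add: yz inner_add_left)
  with e(1) have "z \<bullet> z \<le> 0" by (simp add: mult_le_0_iff)
  then have "z = 0" by (metis inner_ge_zero inner_eq_zero_iff antisym)
  with y yz show ?thesis by simp
qed

text \<open>The map sending \<open>x\<close> to the sum of
  \<open>(l \<bullet> x) *\<^sub>R l\<close> is injective on \<open>span A\<close>, since its inner
  product with \<open>x\<close> is the sum of the squares \<open>(l \<bullet> x)\<^sup>2\<close>; in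
  finite dimension it is then bounded below. The constant depends on \<open>A\<close> alone and so
  serves all offsets with active set \<open>A\<close>.\<close>

lemma norm_le_of_inner_bound_span:
  fixes A :: "'a::euclidean_space set"
  assumes fin: "finite A"
  shows "\<exists>K\<ge>0. \<forall>x\<in>span A. \<forall>r. (\<forall>l\<in>A. \<bar>l \<bullet> x\<bar> \<le> r) \<longrightarrow> norm x \<le> K * r"
proof -
  define f where "f x = (\<Sum>l\<in>A. (l \<bullet> x) *\<^sub>R l)" for x
  have f: "bounded_linear f"
    unfolding f_def
    by (intro bounded_linear_sum bounded_linear_scaleR_left[THEN bounded_linear_compose]
        bounded_linear_inner_right)
  have inj: "\<forall>x\<in>span A. f x = 0 \<longrightarrow> x = 0"
  proof (intro ballI impI)
    fix x assume x: "x \<in> span A" and "f x = 0"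
    then have "0 = x \<bullet> f x" by simp
    also have "\<dots> = (\<Sum>l\<in>A. (l \<bullet> x)\<^sup>2)"
      by (simp add: f_def inner_sum_right inner_commute power2_eq_square)
    finally have "\<forall>l\<in>A. l \<bullet> x = 0"
      using fin by (subst (asm) eq_commute) (simp add: sum_nonneg_eq_0_iff)
    then have "orthogonal x x"
      by (intro orthogonal_to_span[OF x]) (simp add: orthogonal_def inner_commute)
    then show "x = 0" by (simp add: orthogonal_self)
  qed
  obtain e where e: "e > 0" "\<forall>x\<in>span A. e * norm x \<le> norm (f x)"
    using injective_imp_isometric[OF closed_subspace[OF subspace_span] subspace_span f inj] by auto
  show ?thesis
  proof (intro exI[of _ "(\<Sum>l\<in>A. norm l) / e"] conjI ballI allI impI)
    show "0 \<le> (\<Sum>l\<in>A. norm l) / e" using e by (simp add: sum_nonneg)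
    fix x r assume x: "x \<in> span A" and r: "\<forall>l\<in>A. \<bar>l \<bullet> x\<bar> \<le> r"
    have "e * norm x \<le> norm (f x)" using e x by blast
    also have "\<dots> \<le> (\<Sum>l\<in>A. norm ((l \<bullet> x) *\<^sub>R l))" unfolding f_def by (rule norm_sum)
    also have "\<dots> \<le> (\<Sum>l\<in>A. r * norm l)" using r by (intro sum_mono) (simp add: mult_right_mono)
    finally show "norm x \<le> (\<Sum>l\<in>A. norm l) / e * r"
      using e by (simp add: field_simps sum_distrib_left)
  qed
qed

text \<open>Two projections with the same active set \<open>A\<close> have residuals in \<open>span A\<close>, so that their
  difference lies in that span, where it is controlled by its inner products with \<open>A\<close>.\<close>

lemma closest_point_same_active_set:
  fixes S :: "'a::euclidean_space set" and c :: 'a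
  assumes fin: "finite S" and ne: "face_polyhedron S b1 \<noteq> {}" "face_polyhedron S b2 \<noteq> {}"
  defines "p1 \<equiv> closest_point (face_polyhedron S b1) c"
    and "p2 \<equiv> closest_point (face_polyhedron S b2) c"
  assumes A: "{l\<in>S. l \<bullet> p1 = b1 l} = A" "{l\<in>S. l \<bullet> p2 = b2 l} = A"
    and K: "\<forall>x\<in>span A. \<forall>r. (\<forall>l\<in>A. \<bar>l \<bullet> x\<bar> \<le> r) \<longrightarrow> norm x \<le> K * r"
    and r: "\<And>l. l \<in> S \<Longrightarrow> \<bar>b1 l - b2 l\<bar> \<le> r"
  shows "norm (p1 - p2) \<le> K * r"
proof -
  have "c - p1 \<in> span A" "c - p2 \<in> span A"
    using closest_point_residual_in_span[OF fin ne(1), of c]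
      closest_point_residual_in_span[OF fin ne(2), of c] A
    by (simp_all add: p1_def p2_def)
  then have "(c - p2) - (c - p1) \<in> span A" by (metis span_diff)
  then have "p1 - p2 \<in> span A" by simp
  moreover have "\<bar>l \<bullet> (p1 - p2)\<bar> \<le> r" if "l \<in> A" for l
  proof -
    have "l \<in> S" "l \<bullet> p1 = b1 l" "l \<bullet> p2 = b2 l" using A that by auto
    with r[of l] show ?thesis by (simp add: inner_diff_right)
  qed
  ultimately show ?thesis using K by blast
qed

text \<open>Continuity along a segment of right-hand sides follows from the closed graph theorem.\<close>

lemma continuous_on_closest_point_segment:
  fixes S :: "'a::euclidean_space set" and c :: 'a
  assumes ne: "face_polyhedron S b1 \<noteq> {}" "face_polyhedron S b2 \<noteq> {}"
  defines "P \<equiv> \<lambda>t. face_polyhedron S (\<lambda>l. (1 - t) * b1 l + t * b2 l)"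
  shows "continuous_on {0..1} (\<lambda>t. closest_point (P t) c)"
proof -
  let ?p = "\<lambda>t. closest_point (P t) c"
  have cl: "closed (P t)" and cvx: "convex (P t)" for t
    unfolding P_def by (auto intro: closed_face_polyhedron convex_face_polyhedron)
  \<comment> \<open>The graph of \<open>t \<mapsto> P t\<close> is convex. This supplies points of
    \<open>P t\<close> inside the segment and the competitors \<open>q n\<close> below.\<close>
  have comb: "(1 - s) *\<^sub>R v + s *\<^sub>R w \<in> P ((1 - s) * t + s * u)"
    if "v \<in> P t" "w \<in> P u" "0 \<le> s" "s \<le> 1" for s t u v w
    unfolding P_def face_polyhedron_def
  proof safe
    fix l assume l: "l \<in> S"
    have "(1 - s) * (l \<bullet> v) + s * (l \<bullet> w) \<le>
        (1 - s) * ((1 - t) * b1 l + t * b2 l) + s * ((1 - u) * b1 l + u * b2 l)"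
      using that l by (intro add_mono mult_left_mono) (auto simp: P_def face_polyhedron_def)
    then show "l \<bullet> ((1 - s) *\<^sub>R v + s *\<^sub>R w) \<le>
        (1 - ((1 - s) * t + s * u)) * b1 l + ((1 - s) * t + s * u) * b2 l"
      by (simp add: inner_add_right algebra_simps)
  qed
  obtain w0 w1 where w: "w0 \<in> P 0" "w1 \<in> P 1" using ne by (auto simp: P_def)
  have inP: "?p t \<in> P t" if "t \<in> {0..1}" for t
    using comb[OF w, of t] that by (intro closest_point_in_set cl) auto
  have le: "norm (c - ?p t) \<le> norm (c - v)" if "v \<in> P t" for t v
    using closest_point_le[OF cl that, of c] by (simp add: dist_norm)
  \<comment> \<open>The closed graph criterion asks for a compact target; the combinations of
    \<open>w0\<close> and \<open>w1\<close> confine all projections to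
    \<open>cball c R\<close>.\<close>
  define R where "R = norm (c - w0) + norm (c - w1)"
  have bd: "?p t \<in> cball c R" if t: "t \<in> {0..1}" for t
  proof -
    have "(1 - t) *\<^sub>R w0 + t *\<^sub>R w1 \<in> P t" using comb[OF w, of t] t by simp
    then have "norm (c - ?p t) \<le> norm (c - ((1 - t) *\<^sub>R w0 + t *\<^sub>R w1))" by (rule le)
    also have "c - ((1 - t) *\<^sub>R w0 + t *\<^sub>R w1) = (1 - t) *\<^sub>R (c - w0) + t *\<^sub>R (c - w1)"
      by (simp add: algebra_simps)
    also have "norm \<dots> \<le> (1 - t) * norm (c - w0) + t * norm (c - w1)"
      using t by (intro norm_triangle_le) simp
    also have "\<dots> \<le> R"
      unfolding R_def using t by (intro add_mono mult_left_le_one_le) auto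
    finally show ?thesis by (simp add: dist_norm)
  qed
  have "closed ((\<lambda>t. Pair t (?p t)) ` {0..1})"
    unfolding closed_sequential_limits
  proof safe
    fix X :: "nat \<Rightarrow> real \<times> 'a" and t v
    assume X: "\<forall>n. X n \<in> (\<lambda>t. (t, ?p t)) ` {0..1}" and lim: "X \<longlonglongrightarrow> (t, v)"
    define \<tau> where "\<tau> n = fst (X n)" for n
    have \<tau>: "\<tau> n \<in> {0..1}" and pt: "?p (\<tau> n) = snd (X n)" for n
      using X[rule_format, of n] by (auto simp: \<tau>_def)
    have lt: "\<tau> \<longlonglongrightarrow> t" and lv: "(\<lambda>n. ?p (\<tau> n)) \<longlonglongrightarrow> v"
      using tendsto_fst[OF lim] tendsto_snd[OF lim] unfolding pt by (auto simp: \<tau>_def[abs_def])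
    have t: "t \<in> {0..1}" by (rule closed_sequentially[OF closed_atLeastAtMost _ lt]) (use \<tau> in auto)
    have v: "v \<in> P t"
      unfolding P_def face_polyhedron_def
    proof safe
      fix l assume "l \<in> S"
      then have "l \<bullet> ?p (\<tau> n) \<le> (1 - \<tau> n) * b1 l + \<tau> n * b2 l" for n
        using inP[OF \<tau>, of n] by (auto simp: P_def face_polyhedron_def)
      moreover have "(\<lambda>n. l \<bullet> ?p (\<tau> n)) \<longlonglongrightarrow> l \<bullet> v"
        "(\<lambda>n. (1 - \<tau> n) * b1 l + \<tau> n * b2 l) \<longlonglongrightarrow> (1 - t) * b1 l + t * b2 l"
        by (intro tendsto_intros lt lv)+
      ultimately show "l \<bullet> v \<le> (1 - t) * b1 l + t * b2 l"
        by (intro LIMSEQ_le[of _ "l \<bullet> v"]) auto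
    qed
    text \<open>A point of \<open>P (\<tau> n)\<close> converging to \<open>?p t\<close>, obtained by moving towards whichever end of the
      interval lies beyond \<open>\<tau> n\<close>.\<close>
    define q where "q n = (if \<tau> n \<le> t then (if t = 0 then ?p t else
        (1 - (t - \<tau> n) / t) *\<^sub>R ?p t + ((t - \<tau> n) / t) *\<^sub>R w0)
      else (1 - (\<tau> n - t) / (1 - t)) *\<^sub>R ?p t + ((\<tau> n - t) / (1 - t)) *\<^sub>R w1)" for n
    have q: "q n \<in> P (\<tau> n)" for n
    proof -
      consider "\<tau> n \<le> t" "t = 0" | "\<tau> n \<le> t" "t > 0" | "\<tau> n > t" "t < 1"
        using t \<tau>[of n] by force
      then show ?thesis
      proof cases
        case 1 with inP[OF t] \<tau>[of n] show ?thesis by (simp add: q_def)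
      next
        case 2
        have "(1 - (t - \<tau> n) / t) *\<^sub>R ?p t + ((t - \<tau> n) / t) *\<^sub>R w0 \<in>
            P ((1 - (t - \<tau> n) / t) * t + ((t - \<tau> n) / t) * 0)"
          using 2 \<tau>[of n] by (intro comb inP[OF t] w) (auto simp: field_simps)
        with 2 show ?thesis by (simp add: q_def field_simps)
      next
        case 3
        have "(1 - (\<tau> n - t) / (1 - t)) *\<^sub>R ?p t + ((\<tau> n - t) / (1 - t)) *\<^sub>R w1 \<in>
            P ((1 - (\<tau> n - t) / (1 - t)) * t + ((\<tau> n - t) / (1 - t)) * 1)"
          using 3 \<tau>[of n] by (intro comb inP[OF t] w) (auto simp: field_simps)
        moreover have "(1 - (\<tau> n - t) / (1 - t)) * t + ((\<tau> n - t) / (1 - t)) * 1 = \<tau> n"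
        proof -
          have "(1 - x) * t + x * 1 = t + x * (1 - t)" for x :: real by (simp add: algebra_simps)
          with 3 show ?thesis by simp
        qed
        ultimately show ?thesis using 3 by (simp add: q_def)
      qed
    qed
    have "q \<longlonglongrightarrow> ?p t"
    proof -
      have "(\<lambda>n. (1 - (t - \<tau> n) / t) *\<^sub>R ?p t + ((t - \<tau> n) / t) *\<^sub>R w0) \<longlonglongrightarrow>
          (1 - (t - t) / t) *\<^sub>R ?p t + ((t - t) / t) *\<^sub>R w0" if "t \<noteq> 0"
        using that by (intro tendsto_intros lt)
      then have 1: "(\<lambda>n. if t = 0 then ?p t else
          (1 - (t - \<tau> n) / t) *\<^sub>R ?p t + ((t - \<tau> n) / t) *\<^sub>R w0) \<longlonglongrightarrow> ?p t"
        by (cases "t = 0") auto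
      have "(\<lambda>n. (1 - (\<tau> n - t) / (1 - t)) *\<^sub>R ?p t + ((\<tau> n - t) / (1 - t)) *\<^sub>R w1) \<longlonglongrightarrow>
          (1 - (t - t) / (1 - t)) *\<^sub>R ?p t + ((t - t) / (1 - t)) *\<^sub>R w1" if "t \<noteq> 1"
        using that by (intro tendsto_intros lt) auto
      then have 2: "(\<lambda>n. (1 - (\<tau> n - t) / (1 - t)) *\<^sub>R ?p t + ((\<tau> n - t) / (1 - t)) *\<^sub>R w1)
          \<longlonglongrightarrow> ?p t"
        by (cases "t = 1") auto
      show ?thesis
        unfolding q_def by (intro filterlim_If filterlim_mono[OF 1 order_refl inf_le1]
            filterlim_mono[OF 2 order_refl inf_le1])
    qed
    \<comment> \<open>\<open>q n\<close> competes with \<open>?p (\<tau> n)\<close>, so minimality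
      passes to the limit \<open>v\<close>, which is therefore the projection at
      \<open>t\<close>.\<close>
    then have "(\<lambda>n. norm (c - q n)) \<longlonglongrightarrow> norm (c - ?p t)" by (intro tendsto_intros)
    moreover have "(\<lambda>n. norm (c - ?p (\<tau> n))) \<longlonglongrightarrow> norm (c - v)" by (intro tendsto_intros lv)
    ultimately have "norm (c - v) \<le> norm (c - ?p t)"
      using le[OF q] by (intro LIMSEQ_le) auto
    then have "v = ?p t"
      using le by (intro closest_point_unique[OF cvx cl v]) (force simp: dist_norm)
    with t show "(t, v) \<in> (\<lambda>t. (t, ?p t)) ` {0..1}" by blast
  qed
  then show ?thesis
    by (intro continuous_from_closed_graph[of "cball c R"]) (use bd in auto)
qed

lemma closest_point_face_polyhedron_lipschitz:
  fixes S :: "'a::euclidean_space set"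
  assumes fin: "finite S"
  shows "\<exists>K\<ge>0. \<forall>b1 b2 c1 c2 r.
    face_polyhedron S b1 \<noteq> {} \<longrightarrow> face_polyhedron S b2 \<noteq> {} \<longrightarrow> (\<forall>l\<in>S. \<bar>b1 l - b2 l\<bar> \<le> r) \<longrightarrow> 0 \<le> r \<longrightarrow>
    norm (closest_point (face_polyhedron S b1) c1 - closest_point (face_polyhedron S b2) c2)
      \<le> norm (c1 - c2) + K * r"
proof -
  have "\<forall>A\<in>Pow S. \<exists>K\<ge>0. \<forall>x\<in>span A. \<forall>r. (\<forall>l\<in>A. \<bar>l \<bullet> x\<bar> \<le> r) \<longrightarrow> norm x \<le> K * r"
    using norm_le_of_inner_bound_span finite_subset[OF _ fin] by blast
  from bchoice[OF this] obtain k where k: "\<forall>A\<in>Pow S. k A \<ge> 0 \<and>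
      (\<forall>x\<in>span A. \<forall>r. (\<forall>l\<in>A. \<bar>l \<bullet> x\<bar> \<le> r) \<longrightarrow> norm x \<le> k A * r)"
    by (rule exE)
  \<comment> \<open>The sum over all subsets dominates each \<open>k A\<close>, so one constant
    serves whichever constraints are active.\<close>
  define K where "K = (\<Sum>A\<in>Pow S. k A)"
  have kK: "k A \<le> K" if "A \<in> Pow S" for A
    unfolding K_def using that k fin by (intro member_le_sum) auto
  have K0: "K \<ge> 0" unfolding K_def using k by (intro sum_nonneg) auto
  have main: "norm (closest_point (face_polyhedron S b1) c - closest_point (face_polyhedron S b2) c)
      \<le> K * r"
    if ne: "face_polyhedron S b1 \<noteq> {}" "face_polyhedron S b2 \<noteq> {}"
      and r: "\<forall>l\<in>S. \<bar>b1 l - b2 l\<bar> \<le> r" "0 \<le> r" for b1 b2 c r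
  proof -
    define b where "b t = (\<lambda>l. (1 - t) * b1 l + t * b2 l)" for t
    define p where "p t = closest_point (face_polyhedron S (b t)) c" for t
    define T where "T A = {t\<in>{0..1}. {l\<in>S. l \<bullet> p t = b t l} = A}" for A
    have cont: "continuous_on {0..1} p"
      unfolding p_def b_def by (rule continuous_on_closest_point_segment[OF ne])
    obtain w0 w1 where w: "w0 \<in> face_polyhedron S b1" "w1 \<in> face_polyhedron S b2" using ne by auto
    have bne: "face_polyhedron S (b t) \<noteq> {}" if "t \<in> {0..1}" for t
    proof -
      have "(1 - t) *\<^sub>R w0 + t *\<^sub>R w1 \<in> face_polyhedron S (b t)"
        using w that unfolding face_polyhedron_def b_def
        by (auto simp: inner_add_right intro!: add_mono mult_left_mono)
      then show ?thesis by blast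
    qed
    have lip: "(K * r)-lipschitz_on (T A) p" if A: "A \<in> Pow S" for A
    proof (rule lipschitz_onI)
      fix s t assume st: "s \<in> T A" "t \<in> T A"
      have "norm (p s - p t) \<le> k A * (r * \<bar>s - t\<bar>)"
        unfolding p_def
      proof (rule closest_point_same_active_set[OF fin])
        show "face_polyhedron S (b s) \<noteq> {}" "face_polyhedron S (b t) \<noteq> {}"
          using bne st by (auto simp: T_def)
        show "{l\<in>S. l \<bullet> closest_point (face_polyhedron S (b s)) c = b s l} = A"
          "{l\<in>S. l \<bullet> closest_point (face_polyhedron S (b t)) c = b t l} = A"
          using st by (simp_all add: T_def p_def)
        show "\<forall>x\<in>span A. \<forall>r. (\<forall>l\<in>A. \<bar>l \<bullet> x\<bar> \<le> r) \<longrightarrow> norm x \<le> k A * r"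
          using k A by blast
        fix l assume l: "l \<in> S"
        have "b s l - b t l = - ((s - t) * (b1 l - b2 l))" by (simp add: b_def algebra_simps)
        then have "\<bar>b s l - b t l\<bar> = \<bar>b1 l - b2 l\<bar> * \<bar>s - t\<bar>"
          by (simp add: abs_mult)
        also have "\<dots> \<le> r * \<bar>s - t\<bar>" using r l by (intro mult_right_mono) auto
        finally show "\<bar>b s l - b t l\<bar> \<le> r * \<bar>s - t\<bar>" .
      qed
      also have "\<dots> \<le> K * (r * \<bar>s - t\<bar>)" using kK[OF A] r by (intro mult_right_mono) auto
      finally show "dist (p s) (p t) \<le> K * r * dist s t" by (simp add: dist_norm mult.assoc)
    qed (use K0 r in simp)
    have sub: "T A \<subseteq> {0..1}" for A by (auto simp: T_def)
    \<comment> \<open>The sets \<open>T A\<close> need be neither closed nor connected. By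
      continuity of \<open>p\<close> the bound extends to their closures, and a finite closed cover
      of an interval with a common constant yields that constant on the whole interval.\<close>
    have "(K * r)-lipschitz_on {0..1} p"
    proof (rule lipschitz_on_closed_Union)
      show "(K * r)-lipschitz_on (closure (T A)) p" if "A \<in> Pow S" for A
        using closure_mono[OF sub, of A]
        by (intro lipschitz_on_closure lip that continuous_on_subset[OF cont]) simp
      show "{0..1} \<subseteq> (\<Union>A\<in>Pow S. closure (T A))"
      proof
        fix t :: real assume "t \<in> {0..1}"
        then have "t \<in> T {l\<in>S. l \<bullet> p t = b t l}" by (simp add: T_def)
        then show "t \<in> (\<Union>A\<in>Pow S. closure (T A))"
          using closure_subset by (intro UN_I[of "{l\<in>S. l \<bullet> p t = b t l}"]) auto
      qed
      show "finite (Pow S)" using fin by simp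
    qed (use K0 r in auto)
    then have "dist (p 0) (p 1) \<le> K * r * dist 0 (1::real)"
      by (rule lipschitz_onD) auto
    then show ?thesis by (simp add: p_def b_def dist_norm)
  qed
  show ?thesis
  proof (intro exI[of _ K] conjI K0 allI impI)
    fix b1 b2 :: "'a \<Rightarrow> real" and c1 c2 r
    assume ne: "face_polyhedron S b1 \<noteq> {}" "face_polyhedron S b2 \<noteq> {}"
      and r: "\<forall>l\<in>S. \<bar>b1 l - b2 l\<bar> \<le> r" "0 \<le> r"
    have "norm (closest_point (face_polyhedron S b1) c1 - closest_point (face_polyhedron S b1) c2)
        \<le> norm (c1 - c2)"
      using closest_point_lipschitz[OF convex_face_polyhedron closed_face_polyhedron ne(1)]
      by (simp add: dist_norm)
    then show "norm (closest_point (face_polyhedron S b1) c1 -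
        closest_point (face_polyhedron S b2) c2) \<le> norm (c1 - c2) + K * r"
      using main[OF ne r, of c2] by (rule norm_diff_triangle_le)
  qed
qed

section \<open>Clarke directional derivatives\<close>

lemma clarke_gradient_inner_le:
  assumes "clarke_dd f x v \<le> ereal c" "\<epsilon> \<in> clarke_gradient f x"
  shows "\<epsilon> \<bullet> v \<le> c"
proof -
  have "ereal (\<epsilon> \<bullet> v) \<le> clarke_dd f x v" using assms(2) by (simp add: clarke_gradient_def)
  also have "\<dots> \<le> ereal c" by fact
  finally show ?thesis by simp
qed

text \<open>The difference quotients of \<open>W\<close> need not converge, because the solution map
  is only Lipschitz. A convergent majorant still bounds their upper limit, and that limit bounds
  every element of the gradient.\<close>

lemma clarke_dd_leI:
  fixes x v :: "'a::euclidean_space" and g :: "'a \<times> real \<Rightarrow> real"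
  assumes g: "(g \<longlongrightarrow> c) (nhds x \<times>\<^sub>F at_right 0)"
    and le: "\<forall>\<^sub>F z in nhds x \<times>\<^sub>F at_right 0. (f (fst z + snd z *\<^sub>R v) - f (fst z)) / snd z \<le> g z"
  shows "clarke_dd f x v \<le> ereal c"
proof -
  have nt: "nhds x \<times>\<^sub>F at_right (0::real) \<noteq> bot"
    by (simp add: prod_filter_eq_bot trivial_limit_at_right_real)
  have "clarke_dd f x v \<le> Limsup (nhds x \<times>\<^sub>F at_right 0) (\<lambda>z. ereal (g z))"
    unfolding clarke_dd_def
    by (rule Limsup_mono, rule eventually_mono[OF le]) (auto simp: case_prod_beta)
  also have "\<dots> = ereal c"
    by (intro lim_imp_Limsup nt) (simp add: g)
  finally show ?thesis .
qed

lemma eventually_snd_pos: "\<forall>\<^sub>F z in F \<times>\<^sub>F at_right (0::real). 0 < snd z"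
  using eventually_prodI[of "\<lambda>_. True" F "\<lambda>t. 0 < t" "at_right (0::real)"]
  by (auto simp: eventually_at_right_less case_prod_beta elim!: eventually_mono)

lemma tendsto_fst_prod_filter: "(fst \<longlongrightarrow> x) (nhds x \<times>\<^sub>F F)"
  using filterlim_fst[of "nhds x" F] by simp

lemma tendsto_snd_at_right: "(snd \<longlongrightarrow> 0) (F \<times>\<^sub>F at_right (0::real))"
  by (rule filterlim_mono[OF filterlim_snd _ order_refl]) (simp add: at_within_le_nhds)

lemma tendsto_shifted_point:
  fixes x v :: "'a::real_normed_vector"
  shows "((\<lambda>z. fst z + snd z *\<^sub>R v) \<longlongrightarrow> x) (nhds x \<times>\<^sub>F at_right (0::real))"
  using tendsto_add[OF tendsto_fst_prod_filter[of x "at_right (0::real)"]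
      tendsto_scaleR[OF tendsto_snd_at_right tendsto_const[of v]]] by simp

text \<open>Near \<open>x\<close> only active indices attain the maximum, and if \<open>i\<close> attains it at \<open>y + t v\<close>, then
  the difference quotient of the maximum is at most that of \<open>f i\<close>.\<close>

lemma clarke_dd_Max_le:
  fixes f :: "'i \<Rightarrow> 'a::euclidean_space \<Rightarrow> real"
  assumes I: "finite I" "I \<noteq> {}" and cont: "\<And>i. i \<in> I \<Longrightarrow> isCont (f i) x"
    and le: "\<And>i. i \<in> I \<Longrightarrow> f i x = Max ((\<lambda>i. f i x) ` I) \<Longrightarrow> clarke_dd (f i) x v \<le> c"
  shows "clarke_dd (\<lambda>y. Max ((\<lambda>i. f i y) ` I)) x v \<le> c"
  unfolding clarke_dd_def Limsup_le_iff
proof (intro allI impI)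
  fix y assume y: "c < y"
  let ?F = "nhds x \<times>\<^sub>F at_right (0::real)"
  define m where "m z = Max ((\<lambda>i. f i z) ` I)" for z
  obtain j where j: "j \<in> I" "f j x = m x"
    using Max_in[of "(\<lambda>i. f i x) ` I"] I unfolding m_def by fastforce
  have lim: "((\<lambda>z. f i (fst z + snd z *\<^sub>R v)) \<longlongrightarrow> f i x) ?F" if "i \<in> I" for i
    using isCont_tendsto_compose[OF cont[OF that] tendsto_shifted_point] .
  have "\<forall>\<^sub>F z in ?F. \<forall>i\<in>I. if f i x = m x
      then ereal ((f i (fst z + snd z *\<^sub>R v) - f i (fst z)) / snd z) < y
      else f i (fst z + snd z *\<^sub>R v) < f j (fst z + snd z *\<^sub>R v)"
  proof (intro eventually_ball_finite I ballI)
    fix i assume i: "i \<in> I"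
    show "\<forall>\<^sub>F z in ?F. if f i x = m x
      then ereal ((f i (fst z + snd z *\<^sub>R v) - f i (fst z)) / snd z) < y
      else f i (fst z + snd z *\<^sub>R v) < f j (fst z + snd z *\<^sub>R v)"
    proof (cases "f i x = m x")
      case True
      with le[OF i] have "clarke_dd (f i) x v \<le> c" by (simp add: m_def)
      with y True show ?thesis
        unfolding clarke_dd_def Limsup_le_iff by (auto simp: case_prod_beta)
    next
      case False
      have "f i x \<le> m x" unfolding m_def using I i by (intro Max_ge) auto
      with False j have "0 < f j x - f i x" by simp
      moreover have "((\<lambda>z. f j (fst z + snd z *\<^sub>R v) - f i (fst z + snd z *\<^sub>R v)) \<longlongrightarrow> f j x - f i x) ?F"
        by (intro tendsto_diff lim i j)
      ultimately have "\<forall>\<^sub>F z in ?F. 0 < f j (fst z + snd z *\<^sub>R v) - f i (fst z + snd z *\<^sub>R v)"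
        by (intro order_tendstoD)
      with False show ?thesis by (auto elim: eventually_mono)
    qed
  qed
  then show "\<forall>\<^sub>F z in ?F. (case z of (z, t) \<Rightarrow>
      ereal ((Max ((\<lambda>i. f i (z + t *\<^sub>R v)) ` I) - Max ((\<lambda>i. f i z) ` I)) / t)) < y"
    using eventually_snd_pos[of "nhds x"]
  proof eventually_elim
    case (elim z)
    let ?w = "fst z + snd z *\<^sub>R v"
    obtain i where i: "i \<in> I" "f i ?w = m ?w"
      using Max_in[of "(\<lambda>i. f i ?w) ` I"] I unfolding m_def by fastforce
    have "f j ?w \<le> m ?w" unfolding m_def using I j by (intro Max_ge) auto
    with i elim(1) have "ereal ((f i ?w - f i (fst z)) / snd z) < y" by (smt (verit))
    moreover have "f i (fst z) \<le> m (fst z)" unfolding m_def using I i by (intro Max_ge) auto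
    with i elim(2) have "(m ?w - m (fst z)) / snd z \<le> (f i ?w - f i (fst z)) / snd z"
      by (intro divide_right_mono) auto
    ultimately have "ereal ((m ?w - m (fst z)) / snd z) < y"
      by (meson ereal_less_eq(3) order_le_less_trans)
    then show ?case by (simp add: case_prod_beta m_def)
  qed
qed

text \<open>Cauchy-Schwarz for \<open>x\<close> and \<open>x - t *\<^sub>R v\<close>: the
  subgradient inequality of the norm. It bounds the quotients of \<open>- obs_h\<close> by the
  obstacle direction at each base point, so that only the continuity of that direction is left to
  use.\<close>

lemma norm_diff_scaleR_ge:
  fixes x v :: "'a::real_inner"
  assumes "x \<noteq> 0"
  shows "norm x - norm (x - t *\<^sub>R v) \<le> t * ((x /\<^sub>R norm x) \<bullet> v)"
proof -
  have "norm x * norm x - t * (x \<bullet> v) = x \<bullet> (x - t *\<^sub>R v)"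
    by (simp add: inner_diff_right power2_norm_eq_inner flip: power2_eq_square)
  also have "\<dots> \<le> norm x * norm (x - t *\<^sub>R v)" by (rule norm_cauchy_schwarz)
  finally show ?thesis using assms by (simp add: field_simps)
qed

lemma clarke_dd_obs_h_le:
  assumes q: "q \<noteq> qo i"
  shows "clarke_dd (\<lambda>(q, qd, vc). - obs_h qo ds i q) (q, y) (qd, a) \<le> ereal (obs_dir qo i q \<bullet> qd)"
proof (rule clarke_dd_leI)
  let ?F = "nhds (q, y) \<times>\<^sub>F at_right (0::real)"
  have lim: "((\<lambda>z. fst (fst z)) \<longlongrightarrow> q) ?F"
    using tendsto_fst[OF tendsto_fst_prod_filter[of "(q, y)" "at_right (0::real)"]] by simp
  show "((\<lambda>z. obs_dir qo i (fst (fst z)) \<bullet> qd) \<longlongrightarrow> obs_dir qo i q \<bullet> qd) ?F"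
    unfolding obs_dir_def using q by (intro tendsto_intros lim) auto
  show "\<forall>\<^sub>F z in ?F. ((\<lambda>(q, qd, vc). - obs_h qo ds i q) (fst z + snd z *\<^sub>R (qd, a))
      - (\<lambda>(q, qd, vc). - obs_h qo ds i q) (fst z)) / snd z \<le> obs_dir qo i (fst (fst z)) \<bullet> qd"
    using eventually_snd_pos tendsto_imp_eventually_ne[OF lim q]
  proof eventually_elim
    case (elim z)
    have "norm (qo i - fst (fst z)) - norm (qo i - fst (fst z) - snd z *\<^sub>R qd)
        \<le> snd z * (obs_dir qo i (fst (fst z)) \<bullet> qd)"
      unfolding obs_dir_def by (rule norm_diff_scaleR_ge) (use elim in auto)
    with elim(1) show ?case
      by (simp add: case_prod_beta obs_h_def field_simps diff_diff_eq)
  qed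
qed

section \<open>Kinetic energy of the velocity error\<close>

lemma tendsto_matrix_vector_mult [tendsto_intros]:
  fixes A :: "'b \<Rightarrow> real^'n^'m"
  assumes "(A \<longlongrightarrow> a) F" "(x \<longlongrightarrow> b) F"
  shows "((\<lambda>z. A z *v x z) \<longlongrightarrow> a *v b) F"
  unfolding matrix_vector_mult_def by (intro tendsto_intros assms)

lemma inner_matrix_symmetric:
  fixes A :: "real^'n^'n"
  assumes "transpose A = A"
  shows "x \<bullet> (A *v y) = (A *v x) \<bullet> y"
  by (metis assms dot_lmul_matrix transpose_matrix_vector)

lemma norm_matrix_vector_mult_le:
  fixes A :: "real^'n^'n"
  assumes sym: "transpose A = A" and pos: "\<And>x. 0 \<le> x \<bullet> (A *v x)"
    and le: "\<And>x. x \<bullet> (A *v x) \<le> c * (x \<bullet> x)"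
  shows "norm (A *v x) \<le> c * norm x"
proof -
  let ?y = "A *v x"
  text \<open>The form is nonnegative at \<open>c x - A x\<close>, where it equals
    \<open>c\<^sup>2 x\<cdot>Ax - 2 c |Ax|\<^sup>2 + Ax\<cdot>A(Ax)\<close>.\<close>
  have c: "0 \<le> c"
  proof -
    obtain k :: 'n where True by simp
    have "0 \<le> c * (axis k 1 \<bullet> (axis k 1 :: real^'n))" using pos le order_trans by blast
    then show ?thesis by (simp add: inner_axis_axis)
  qed
  have "0 \<le> (c *\<^sub>R x - ?y) \<bullet> (A *v (c *\<^sub>R x - ?y))" by (rule pos)
  also have "\<dots> = c * c * (x \<bullet> ?y) - 2 * c * (?y \<bullet> ?y) + ?y \<bullet> (A *v ?y)"
    using inner_matrix_symmetric[OF sym, of x ?y]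
    by (simp add: matrix_vector_mult_diff_distrib matrix_vector_mult_scaleR inner_diff_left inner_diff_right
        inner_commute algebra_simps)
  also have "\<dots> \<le> c * c * (c * (x \<bullet> x)) - 2 * c * (?y \<bullet> ?y) + c * (?y \<bullet> ?y)"
    using c by (intro add_mono diff_mono mult_left_mono le) auto
  finally have *: "c * (?y \<bullet> ?y) \<le> c * (c * c * (x \<bullet> x))" by (simp add: algebra_simps)
  show ?thesis
  proof (cases "c = 0")
    case True
    \<comment> \<open>With \<open>c = 0\<close> the form vanishes identically. Expanding it at
      \<open>x + A *v x\<close> leaves twice \<open>?y \<bullet> ?y\<close> plus a nonnegative term,
      so \<open>?y = 0\<close>.\<close>
    then have "(x + t *\<^sub>R y) \<bullet> (A *v (x + t *\<^sub>R y)) = 0" for y t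
      using pos[of "x + t *\<^sub>R y"] le[of "x + t *\<^sub>R y"] by simp
    from this[of 1 ?y] this[of 0 ?y] have "2 * (?y \<bullet> ?y) + ?y \<bullet> (A *v ?y) = 0"
      using inner_matrix_symmetric[OF sym, of x ?y]
      by (simp add: matrix_vector_right_distrib inner_add_left inner_add_right inner_commute)
    moreover have "0 \<le> ?y \<bullet> (A *v ?y)" by (rule pos)
    ultimately have "?y \<bullet> ?y \<le> 0" by linarith
    then show ?thesis using True by (metis inner_eq_zero_iff inner_ge_zero antisym mult_zero_left norm_eq_zero order_refl)
  next
    case False
    with c * have "?y \<bullet> ?y \<le> c * c * (x \<bullet> x)" by (auto simp: mult_le_cancel_left)
    then have "(norm ?y)\<^sup>2 \<le> (c * norm x)\<^sup>2"
      by (simp add: power2_norm_eq_inner power_mult_distrib power2_eq_square[of c])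
    then show ?thesis using c by (simp add: power2_le_iff_abs_le)
  qed
qed

text \<open>The base point moves together with the step length, so differentiability at
  \<open>x\<close> alone does not give this limit. Continuity of \<open>f'\<close> makes the
  linearization error uniform on a ball, by the mean value inequality: this is strict
  differentiability.\<close>

lemma C1_difference_quotient_tendsto:
  fixes f :: "'a::euclidean_space \<Rightarrow> 'b::real_normed_vector" and f' :: "'a \<Rightarrow> 'a \<Rightarrow>\<^sub>L 'b"
  assumes f': "\<And>x. (f has_derivative blinfun_apply (f' x)) (at x)" and cont: "continuous_on UNIV f'"
  shows "((\<lambda>z. (f (fst z + snd z *\<^sub>R v) - f (fst z)) /\<^sub>R snd z) \<longlongrightarrow> f' x v) (nhds x \<times>\<^sub>F at_right (0::real))"
proof (rule tendstoI)
  fix e :: real assume e: "e > 0"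
  let ?F = "nhds x \<times>\<^sub>F at_right (0::real)"
  define e' where "e' = e / 2 / (norm v + 1)"
  have nv: "norm v + 1 > 0" by (simp add: add_nonneg_pos)
  with e have e': "e' > 0" by (simp add: e'_def)
  have "isCont f' x" using cont by (simp add: continuous_on_eq_continuous_at)
  then obtain d where d: "d > 0" "\<And>y. dist y x < d \<Longrightarrow> dist (f' y) (f' x) < e'"
    using e' unfolding continuous_at_eps_delta by blast
  have "\<forall>\<^sub>F z in ?F. dist (fst z) x < d" "\<forall>\<^sub>F z in ?F. dist (fst z + snd z *\<^sub>R v) x < d"
    using tendstoD[OF tendsto_fst_prod_filter d(1)] tendstoD[OF tendsto_shifted_point d(1)] .
  with eventually_snd_pos show "\<forall>\<^sub>F z in ?F. dist ((f (fst z + snd z *\<^sub>R v) - f (fst z)) /\<^sub>R snd z) (f' x v) < e"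
  proof eventually_elim
    case (elim z)
    let ?a = "fst z" and ?b = "fst z + snd z *\<^sub>R v" and ?t = "snd z"
    have "norm (f ?b - f ?a - blinfun_apply (f' x) (?b - ?a)) \<le> norm (?b - ?a) * e'"
    proof (rule differentiable_bound_linearization[where S = "ball x d"])
      fix s :: real assume "s \<in> {0..1}"
      then have "(1 - s) *\<^sub>R ?a + s *\<^sub>R ?b \<in> ball x d"
        using elim by (intro convexD[OF convex_ball]) (auto simp: dist_commute)
      then show "?a + s *\<^sub>R (?b - ?a) \<in> ball x d" by (simp add: algebra_simps)
    next
      fix y assume "y \<in> ball x d"
      show "(f has_derivative blinfun_apply (f' y)) (at y within ball x d)"
        by (rule has_derivative_at_withinI[OF f'])
      have "onorm (blinfun_apply (f' y) - blinfun_apply (f' x)) = norm (f' y - f' x)"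
        by (simp add: norm_blinfun.rep_eq minus_blinfun.rep_eq fun_diff_def)
      also have "\<dots> \<le> e'" using d(2)[of y] \<open>y \<in> ball x d\<close> by (simp add: dist_norm norm_minus_commute)
      finally show "onorm (blinfun_apply (f' y) - blinfun_apply (f' x)) \<le> e'" .
    qed (use d in simp)
    then have *: "norm (f ?b - f ?a - ?t *\<^sub>R f' x v) \<le> ?t * (norm v * e')"
      using elim(1) by (simp add: blinfun.scaleR_right mult.assoc)
    have "(f ?b - f ?a) /\<^sub>R ?t - f' x v = (f ?b - f ?a - ?t *\<^sub>R f' x v) /\<^sub>R ?t"
      using elim(1) by (simp add: scaleR_diff_right)
    then have "dist ((f ?b - f ?a) /\<^sub>R ?t) (f' x v) = norm (f ?b - f ?a - ?t *\<^sub>R f' x v) / ?t"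
      using elim(1) by (simp add: dist_norm divide_inverse)
    also have "\<dots> \<le> norm v * e'" using * elim(1) by (simp add: field_simps)
    also have "\<dots> \<le> (norm v + 1) * e'" using e' by (intro mult_right_mono) auto
    also have "\<dots> = e / 2" using nv by (metis e'_def less_irrefl nonzero_mult_div_cancel_left times_divide_eq_right)
    also have "\<dots> < e" using e by simp
    finally show ?case .
  qed
qed

text \<open>\<open>vp\<close> may lack a derivative, so its increment \<open>d\<close> enters the
  quotient only through its norm, at most \<open>t * (L * (norm p + norm w))\<close>, paired with a
  momentum tending to \<open>M q *v e\<close>. The open set \<open>U\<close> eventually contains
  both the base point and the shifted point of each quotient.\<close>

lemma clarke_dd_kinetic_le:
  fixes M :: "real^'n \<Rightarrow> real^'n^'n" and M' :: "real^'n \<Rightarrow> (real^'n) \<Rightarrow>\<^sub>L (real^'n^'n)"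
    and vp :: "real^'n \<Rightarrow> real^'n \<Rightarrow> real^'n"
    and q qd vc p a w :: "real^'n"
  assumes M': "\<And>q. (M has_derivative blinfun_apply (M' q)) (at q)" "continuous_on UNIV M'"
    and sym: "\<And>q. transpose (M q) = M q"
    and U: "open U" "q \<in> U" and L: "L \<ge> 0"
    and lip: "\<And>q1 q2 c1 c2. q1 \<in> U \<Longrightarrow> q2 \<in> U \<Longrightarrow>
      norm (vp q1 c1 - vp q2 c2) \<le> L * (norm (q1 - q2) + norm (c1 - c2))"
  defines "e \<equiv> qd - vp q vc"
  shows "isCont (\<lambda>(q, qd, vc). K + 1 / 2 * ((qd - vp q vc) \<bullet> (M q *v (qd - vp q vc)))) (q, qd, vc)"
    (is "isCont ?V _")
    and "clarke_dd (\<lambda>(q, qd, vc). K + 1 / 2 * ((qd - vp q vc) \<bullet> (M q *v (qd - vp q vc))))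
      (q, qd, vc) (p, a, w) \<le>
      ereal (1 / 2 * (e \<bullet> (M' q p *v e)) + (M q *v e) \<bullet> a + L * (norm p + norm w) * norm (M q *v e))"
proof -
  have ev: "\<forall>\<^sub>F z in nhds (q, qd, vc). fst z \<in> U"
    using topological_tendstoD[OF tendsto_fst[OF tendsto_ident_at[of "(q, qd, vc)" UNIV]], of U] U
    by (auto simp: eventually_nhds_conv_at)
  have vlim: "((\<lambda>z. vp (fst z) (snd (snd z))) \<longlongrightarrow> vp q vc) (nhds (q, qd, vc))"
  proof (rule Lim_null[THEN iffD2], rule Lim_null_comparison)
    show "\<forall>\<^sub>F z in nhds (q, qd, vc). norm (vp (fst z) (snd (snd z)) - vp q vc)
        \<le> L * (norm (fst z - q) + norm (snd (snd z) - vc))"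
      using ev by eventually_elim (intro lip U)
    have "((\<lambda>z. L * (norm (fst z - q) + norm (snd (snd z) - vc))) \<longlongrightarrow>
        L * (norm (fst (q, qd, vc) - q) + norm (snd (snd (q, qd, vc)) - vc))) (nhds (q, qd, vc))"
      by (intro tendsto_intros filterlim_ident)
    then show "((\<lambda>z. L * (norm (fst z - q) + norm (snd (snd z) - vc))) \<longlongrightarrow> 0) (nhds (q, qd, vc))"
      by simp
  qed
  define E where "E z = fst (snd z) - vp (fst z) (snd (snd z))" for z :: "(real^'n) \<times> (real^'n) \<times> (real^'n)"
  have Elim: "(E \<longlongrightarrow> e) (nhds (q, qd, vc))"
  proof -
    have "((\<lambda>z. fst (snd z) - vp (fst z) (snd (snd z))) \<longlongrightarrow> fst (snd (q, qd, vc)) - vp q vc)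
        (nhds (q, qd, vc))"
      by (intro tendsto_intros vlim filterlim_ident)
    then show ?thesis by (simp add: E_def[abs_def] e_def)
  qed
  have Mcont: "isCont M q" using has_derivative_continuous[OF M'(1)] .
  have Mlim: "((\<lambda>z. M (fst z)) \<longlongrightarrow> M q) (nhds (q, qd, vc))"
  proof (rule isCont_tendsto_compose[OF Mcont])
    have "((\<lambda>z. fst z) \<longlongrightarrow> fst (q, qd, vc)) (nhds (q, qd, vc))"
      by (intro tendsto_intros filterlim_ident)
    then show "(fst \<longlongrightarrow> q) (nhds (q, qd, vc))" by simp
  qed
  have V: "?V = (\<lambda>z. K + 1 / 2 * (E z \<bullet> (M (fst z) *v E z)))"
    by (auto simp: E_def fun_eq_iff)
  have "(?V \<longlongrightarrow> K + 1 / 2 * (e \<bullet> (M q *v e))) (nhds (q, qd, vc))"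
    unfolding V by (intro tendsto_intros Elim Mlim)
  then show "isCont ?V (q, qd, vc)"
    by (simp add: isCont_def tendsto_nhds_iff e_def)
  let ?F = "nhds (q, qd, vc) \<times>\<^sub>F at_right (0::real)"
  define Y where "Y z = fst z + snd z *\<^sub>R (p, a, w)" for z :: "((real^'n) \<times> (real^'n) \<times> (real^'n)) \<times> real"
  have flt: "filterlim fst (nhds (q, qd, vc)) ?F" by (rule filterlim_fst)
  have flY: "filterlim Y (nhds (q, qd, vc)) ?F" unfolding Y_def by (rule tendsto_shifted_point)
  define Q where "Q z = (M (fst (Y z)) - M (fst (fst z))) /\<^sub>R snd z" for z
  have Qlim: "(Q \<longlongrightarrow> M' q p) ?F"
  proof -
    have "filterlim (\<lambda>z. (fst (fst z), snd z)) (nhds q \<times>\<^sub>F at_right 0) ?F"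
    proof (rule filterlim_Pair)
      have "((\<lambda>z. fst (fst z)) \<longlongrightarrow> fst (q, qd, vc)) ?F" by (intro tendsto_intros flt)
      then show "filterlim (\<lambda>z. fst (fst z)) (nhds q) ?F" by simp
    qed (rule filterlim_snd)
    from filterlim_compose[OF C1_difference_quotient_tendsto[OF M', of p] this]
    show ?thesis by (simp add: Q_def[abs_def] Y_def)
  qed
  define e0 where "e0 z = E (fst z)" for z :: "((real^'n) \<times> (real^'n) \<times> (real^'n)) \<times> real"
  define e1 where "e1 z = E (Y z)" for z
  \<comment> \<open>Pairing with the mean of the two errors makes the splitting of the energy
    increment exact: by symmetry of \<open>M\<close> it is \<open>t / 2\<close> times the form of
    \<open>Q z\<close> at \<open>e1 z\<close>, plus
    \<open>m z \<bullet> (e1 z - e0 z)\<close>.\<close>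
  define m where "m z = M (fst (fst z)) *v ((e0 z + e1 z) /\<^sub>R 2)" for z
  have l0: "(e0 \<longlongrightarrow> e) ?F" unfolding e0_def by (rule filterlim_compose[OF Elim flt])
  have l1: "(e1 \<longlongrightarrow> e) ?F" unfolding e1_def by (rule filterlim_compose[OF Elim flY])
  have lM: "((\<lambda>z. M (fst (fst z))) \<longlongrightarrow> M q) ?F" by (rule filterlim_compose[OF Mlim flt])
  have lm: "(m \<longlongrightarrow> M q *v e) ?F"
  proof -
    have "(m \<longlongrightarrow> M q *v ((e + e) /\<^sub>R 2)) ?F" unfolding m_def by (intro tendsto_intros l0 l1 lM)
    moreover have "(e + e) /\<^sub>R 2 = e" by (simp flip: scaleR_2)
    ultimately show ?thesis by simp
  qed
  show "clarke_dd ?V (q, qd, vc) (p, a, w) \<le>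
      ereal (1 / 2 * (e \<bullet> (M' q p *v e)) + (M q *v e) \<bullet> a + L * (norm p + norm w) * norm (M q *v e))"
  proof (rule clarke_dd_leI)
    show "((\<lambda>z. 1 / 2 * (e1 z \<bullet> (Q z *v e1 z)) + m z \<bullet> a + L * (norm p + norm w) * norm (m z)) \<longlongrightarrow>
        1 / 2 * (e \<bullet> (M' q p *v e)) + (M q *v e) \<bullet> a + L * (norm p + norm w) * norm (M q *v e)) ?F"
      by (intro tendsto_intros l1 Qlim lm)
    have evU: "\<forall>\<^sub>F z in ?F. fst (fst z) \<in> U" "\<forall>\<^sub>F z in ?F. fst (Y z) \<in> U"
      using filterlim_iff[THEN iffD1, OF flt] filterlim_iff[THEN iffD1, OF flY] ev by auto
    then show "\<forall>\<^sub>F z in ?F. (?V (fst z + snd z *\<^sub>R (p, a, w)) - ?V (fst z)) / snd z \<le>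
        1 / 2 * (e1 z \<bullet> (Q z *v e1 z)) + m z \<bullet> a + L * (norm p + norm w) * norm (m z)"
      using eventually_snd_pos[of "nhds (q, qd, vc)"]
    proof eventually_elim
      case (elim z)
      let ?t = "snd z"
      let ?M0 = "M (fst (fst z))" and ?M1 = "M (fst (Y z))"
      define d where "d = vp (fst (Y z)) (snd (snd (Y z))) - vp (fst (fst z)) (snd (snd (fst z)))"
      have e10: "e1 z = e0 z + ?t *\<^sub>R a - d" by (simp add: e1_def e0_def E_def Y_def d_def)
      have "norm d \<le> L * (norm (fst (Y z) - fst (fst z)) + norm (snd (snd (Y z)) - snd (snd (fst z))))"
        unfolding d_def by (rule lip) (use elim in auto)
      also have "\<dots> = ?t * (L * (norm p + norm w))"
        using elim(3) by (simp add: Y_def algebra_simps)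
      finally have d: "norm d \<le> ?t * (L * (norm p + norm w))" .
      have MQ: "?M1 = ?M0 + ?t *\<^sub>R Q z" using elim(3) by (simp add: Q_def)
      have s: "e0 z \<bullet> (?M0 *v e1 z) = e1 z \<bullet> (?M0 *v e0 z)"
        using inner_matrix_symmetric[OF sym] by (metis inner_commute)
      have m2: "m z \<bullet> (e1 z - e0 z) = 1 / 2 * (e1 z \<bullet> (?M0 *v e1 z) - e0 z \<bullet> (?M0 *v e0 z))"
        using s unfolding m_def
        by (simp add: matrix_vector_right_distrib matrix_vector_mult_scaleR inner_diff_right inner_add_left inner_commute
            algebra_simps)
      have "?V (Y z) - ?V (fst z) = 1 / 2 * (e1 z \<bullet> (?M1 *v e1 z)) - 1 / 2 * (e0 z \<bullet> (?M0 *v e0 z))"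
        unfolding V by (simp add: e1_def e0_def)
      also have "\<dots> = 1 / 2 * ?t * (e1 z \<bullet> (Q z *v e1 z)) + m z \<bullet> (e1 z - e0 z)"
        unfolding m2 MQ by (simp add: matrix_vector_mult_add_rdistrib scaleR_matrix_vector_assoc[symmetric]
            inner_add_right algebra_simps)
      also have "m z \<bullet> (e1 z - e0 z) = ?t * (m z \<bullet> a) - m z \<bullet> d"
        unfolding e10 by (simp add: inner_diff_right inner_add_right)
      also have "- (m z \<bullet> d) \<le> norm (m z) * norm d"
        using norm_cauchy_schwarz[of "m z" "- d"] by simp
      then have "1 / 2 * ?t * (e1 z \<bullet> (Q z *v e1 z)) + (?t * (m z \<bullet> a) - m z \<bullet> d) \<le>
          1 / 2 * ?t * (e1 z \<bullet> (Q z *v e1 z)) + ?t * (m z \<bullet> a) + norm (m z) * (?t * (L * (norm p + norm w)))"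
        using mult_left_mono[OF d, of "norm (m z)"] by simp
      also have "\<dots> = ?t * (1 / 2 * (e1 z \<bullet> (Q z *v e1 z)) + m z \<bullet> a + L * (norm p + norm w) * norm (m z))"
        by (simp add: algebra_simps)
      finally show ?case
        using elim(3) by (simp add: Y_def pos_divide_le_eq mult.commute)
    qed
  qed
qed

lemma M_dot_eq_derivative:
  fixes M :: "real^'n \<Rightarrow> real^'n^'n" and M' :: "(real^'n) \<Rightarrow>\<^sub>L (real^'n^'n)"
  assumes "(M has_derivative blinfun_apply M') (at q)"
  shows "M_dot M q p = M' p"
proof -
  have "partial_deriv M j q = M' (axis j 1)" for j
    unfolding partial_deriv_def
  proof (rule vector_derivative_at)
    have "((\<lambda>s. q + s *\<^sub>R axis j 1) has_derivative (\<lambda>s. s *\<^sub>R axis j 1)) (at 0)"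
      by (auto intro!: derivative_eq_intros)
    from has_derivative_compose[OF this, of M "blinfun_apply M'"] assms
    show "((\<lambda>s. M (q + s *\<^sub>R axis j 1)) has_vector_derivative M' (axis j 1)) (at 0)"
      by (simp add: has_vector_derivative_def blinfun.scaleR_right)
  qed
  then have "M_dot M q p = (\<Sum>j\<in>UNIV. M' (p $ j *\<^sub>R axis j 1))"
    by (simp add: M_dot_def blinfun.scaleR_right)
  also have "\<dots> = M' (\<Sum>j\<in>UNIV. p $ j *\<^sub>R axis j 1)" by (simp add: blinfun.sum_right)
  also have "(\<Sum>j\<in>UNIV. p $ j *\<^sub>R axis j 1) = p"
    using basis_expansion[of p] by (simp add: scalar_mult_eq_scaleR)
  finally show ?thesis .
qed

text \<open>Skew symmetry is assumed along trajectories only. Every state \<open>(q, p)\<close>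
  starts one: the straight line with constant velocity \<open>p\<close>, driven by the input
  \<open>u\<close> that the dynamics then prescribe.\<close>

lemma el_assumption_M_dot_inner:
  assumes EL: "el_assumption M C Nv \<mu>1 \<mu>2"
  shows "x \<bullet> (M_dot M q p *v x) = 2 * (x \<bullet> (C q p *v x))"
proof -
  define u where "u t = C (q + t *\<^sub>R p) p *v p + Nv (q + t *\<^sub>R p) p" for t
  have traj: "el_trajectory M C Nv (\<lambda>t. q + t *\<^sub>R p) (\<lambda>_. p) (\<lambda>_. 0) u"
    unfolding el_trajectory_def el_dynamics_def u_def
    by (auto intro!: derivative_eq_intros simp: has_vector_derivative_def)
  have "\<forall>q qd qdd u. el_trajectory M C Nv q qd qdd u \<longrightarrow>
      (\<forall>t\<ge>0. let S = M_dot M (q t) (qd t) - 2 *\<^sub>R C (q t) (qd t) in S + transpose S = 0)"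
    using EL unfolding el_assumption_def by (elim conjE)
  from this[rule_format, OF traj, of 0]
  have "(M_dot M q p - 2 *\<^sub>R C q p) + transpose (M_dot M q p - 2 *\<^sub>R C q p) = 0"
    by (simp add: Let_def)
  then obtain S where S: "S = M_dot M q p - 2 *\<^sub>R C q p" "S + transpose S = 0" by blast
  have "x \<bullet> (S *v x) = x \<bullet> (transpose S *v x)"
    by (metis dot_lmul_matrix inner_commute transpose_matrix_vector)
  moreover have "x \<bullet> (S *v x) + x \<bullet> (transpose S *v x) = x \<bullet> ((S + transpose S) *v x)"
    by (simp add: matrix_vector_mult_add_rdistrib inner_add_right)
  ultimately have "x \<bullet> (S *v x) = 0" using S(2) by simp
  then show ?thesis
    by (simp add: S(1) matrix_vector_mult_diff_rdistrib inner_diff_right scaleR_matrix_vector_assoc[symmetric])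
qed

lemma pos_definite_imp_inner_le:
  assumes "pos_definite (A - B)"
  shows "x \<bullet> (B *v x) \<le> x \<bullet> (A *v x)"
proof (cases "x = 0")
  case False
  with assms have "0 < x \<bullet> ((A - B) *v x)" by (simp add: pos_definite_def)
  then show ?thesis by (simp add: matrix_vector_mult_diff_rdistrib inner_diff_right)
qed simp

lemma mat_mult_vec: "mat c *v x = c *\<^sub>R (x :: real^'n)"
  by (simp add: vec_eq_iff matrix_vector_mult_def mat_def if_distrib[of "\<lambda>a. a * _"] cong: if_cong)

lemma el_assumption_inner_bounds:
  assumes EL: "el_assumption M C Nv \<mu>1 \<mu>2"
  shows "\<mu>1 * (norm x)\<^sup>2 \<le> x \<bullet> (M q *v x)" "x \<bullet> (M q *v x) \<le> \<mu>2 * (norm x)\<^sup>2"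
    and "norm (M q *v x) \<le> \<mu>2 * norm x" "\<mu>1 \<le> \<mu>2"
proof -
  have lo: "\<mu>1 * (norm x)\<^sup>2 \<le> x \<bullet> (M q *v x)" and hi: "x \<bullet> (M q *v x) \<le> \<mu>2 * (norm x)\<^sup>2" for x
    using EL pos_definite_imp_inner_le[of "M q" "mat \<mu>1" x] pos_definite_imp_inner_le[of "mat \<mu>2" "M q" x]
    by (auto simp: el_assumption_def mat_mult_vec power2_norm_eq_inner)
  from lo hi show "\<mu>1 * (norm x)\<^sup>2 \<le> x \<bullet> (M q *v x)" "x \<bullet> (M q *v x) \<le> \<mu>2 * (norm x)\<^sup>2" .
  have pos: "\<mu>1 > 0" and sym: "transpose (M q) = M q" using EL by (auto simp: el_assumption_def)
  show "norm (M q *v x) \<le> \<mu>2 * norm x"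
  proof (rule norm_matrix_vector_mult_le[OF sym])
    show "0 \<le> x \<bullet> (M q *v x)" for x
      using order_trans[OF _ lo] pos by (simp add: mult_nonneg_nonneg)
    show "x \<bullet> (M q *v x) \<le> \<mu>2 * (x \<bullet> x)" for x using hi[of x] by (simp add: power2_norm_eq_inner)
  qed
  obtain k :: 'a where True by simp
  have "\<mu>1 * (norm (axis k 1 :: real^'a))\<^sup>2 \<le> \<mu>2 * (norm (axis k 1 :: real^'a))\<^sup>2"
    using lo hi order_trans by blast
  then show "\<mu>1 \<le> \<mu>2" by simp
qed

section \<open>Piecewise linear comparison functions\<close>

text \<open>The two half-axes carry opposite demands: \<open>\<alpha>c\<close> has to be large at
  \<open>db / 2\<close> but barely negative at \<open>- dh\<close>, and \<open>\<alpha>w\<close> has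
  to be gentle for positive and steep for negative arguments. One slope for each half-axis meets
  them independently.\<close>

definition two_slope :: "real \<Rightarrow> real \<Rightarrow> real \<Rightarrow> real" where
  "two_slope a b s = (if s \<ge> 0 then a * s else b * s)"

lemma two_slope_nonneg [simp]: "s \<ge> 0 \<Longrightarrow> two_slope a b s = a * s"
  and two_slope_nonpos [simp]: "s \<le> 0 \<Longrightarrow> two_slope a b s = b * s"
  by (auto simp: two_slope_def)

text \<open>Strict monotonicity, the Lipschitz constant and the minimal growth rate are all read off
  from here, with \<open>m\<close> either \<open>0\<close> or \<open>min a b\<close> and
  \<open>u = max a b\<close>.\<close>

lemma two_slope_increment_bounds:
  assumes "m \<le> a" "m \<le> b" "a \<le> u" "b \<le> u" "s \<le> t"
  shows "m * (t - s) \<le> two_slope a b t - two_slope a b s"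
    and "two_slope a b t - two_slope a b s \<le> u * (t - s)"
proof -
  consider "0 \<le> s" | "t \<le> 0" | "s \<le> 0" "0 \<le> t" by linarith
  then have "m * (t - s) \<le> two_slope a b t - two_slope a b s \<and>
      two_slope a b t - two_slope a b s \<le> u * (t - s)"
  proof cases
    case 1
    with assms have "m * (t - s) \<le> a * (t - s)" "a * (t - s) \<le> u * (t - s)"
      by (auto intro: mult_right_mono)
    with 1 assms show ?thesis by (simp add: algebra_simps)
  next
    case 2
    with assms have "m * (t - s) \<le> b * (t - s)" "b * (t - s) \<le> u * (t - s)"
      by (auto intro: mult_right_mono)
    with 2 assms show ?thesis by (simp add: algebra_simps)
  next
    case 3
    with assms have "m * t \<le> a * t" "a * t \<le> u * t" "m * (- s) \<le> b * (- s)" "b * (- s) \<le> u * (- s)"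
      by (auto intro: mult_right_mono mult_right_mono_neg)
    with 3 show ?thesis by (simp add: algebra_simps)
  qed
  then show "m * (t - s) \<le> two_slope a b t - two_slope a b s"
    "two_slope a b t - two_slope a b s \<le> u * (t - s)" by auto
qed

lemma two_slope_lipschitz:
  assumes "a > 0" "b > 0"
  shows "(max a b)-lipschitz_on S (two_slope a b)"
proof (rule lipschitz_on_leI)
  fix s t :: real assume "s \<le> t"
  then have "0 * (t - s) \<le> two_slope a b t - two_slope a b s"
    using assms by (intro two_slope_increment_bounds(1)[where u = "max a b"]) auto
  moreover have "two_slope a b t - two_slope a b s \<le> max a b * (t - s)"
    using assms \<open>s \<le> t\<close> by (intro two_slope_increment_bounds(2)[where m = 0]) auto
  ultimately show "dist (two_slope a b s) (two_slope a b t) \<le> max a b * dist s t"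
    using \<open>s \<le> t\<close> by (simp add: dist_real_def abs_if)
qed (use assms in auto)

lemma two_slope_strict_mono:
  assumes "a > 0" "b > 0"
  shows "strict_mono (two_slope a b)"
proof (rule strict_monoI)
  fix s t :: real assume "s < t"
  with assms have "0 < min a b * (t - s)" by simp
  also have "\<dots> \<le> two_slope a b t - two_slope a b s"
    using \<open>s < t\<close> by (intro two_slope_increment_bounds(1)[where u = "max a b"]) auto
  finally show "two_slope a b s < two_slope a b t" by simp
qed

lemma two_slope_inverse:
  assumes "a > 0" "b > 0"
  shows "two_slope a b (two_slope (1 / a) (1 / b) s) = s"
  using assms by (cases "s \<ge> 0") (auto simp: divide_nonpos_pos)

lemma two_slope_bij:
  assumes "a > 0" "b > 0"
  shows "bij (two_slope a b)" "inv (two_slope a b) = two_slope (1 / a) (1 / b)"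
proof -
  have "two_slope (1 / a) (1 / b) (two_slope a b s) = s" for s
    using two_slope_inverse[of "1 / a" "1 / b" s] assms by simp
  with two_slope_inverse[OF assms] show "bij (two_slope a b)"
    by (intro o_bij[of "two_slope (1 / a) (1 / b)"]) (auto simp: fun_eq_iff)
  show "inv (two_slope a b) = two_slope (1 / a) (1 / b)"
    by (rule inv_unique_comp) (use \<open>\<And>s. two_slope (1 / a) (1 / b) (two_slope a b s) = s\<close>
        two_slope_inverse[OF assms] in \<open>auto simp: fun_eq_iff\<close>)
qed

lemma two_slope_class_Ke:
  assumes "a > 0" "b > 0"
  shows "class_Ke (two_slope a b)" "lipschitz_fun_on UNIV (two_slope a b)"
    "lipschitz_fun_on UNIV (inv (two_slope a b))"
proof -
  show "class_Ke (two_slope a b)"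
    unfolding class_Ke_def using assms two_slope_strict_mono
    by (auto intro!: lipschitz_on_continuous_on[OF two_slope_lipschitz])
  show "lipschitz_fun_on UNIV (two_slope a b)" "lipschitz_fun_on UNIV (inv (two_slope a b))"
    unfolding lipschitz_fun_on_def two_slope_bij(2)[OF assms]
    using two_slope_lipschitz[of a b UNIV] two_slope_lipschitz[of "1 / a" "1 / b" UNIV] assms by auto
qed

section \<open>The positive basis\<close>

text \<open>Let \<open>A\<close> be the sum of the coefficients of \<open>u\<close>. Pairing the
  combination with \<open>u\<close> itself gives \<open>1\<close>, while each
  \<open>l \<bullet> u\<close> lies between \<open>c0\<close> and \<open>1\<close>; hence
  \<open>1 \<le> A \<le> 1 / c0\<close>. The two entries of the maximum are the two ends of this
  range, according to the sign of \<open>x\<close>.\<close>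

lemma positive_basis_inner_le:
  fixes S :: "(real^'n) set"
  assumes S: "positive_basis c0 S" and c0: "0 < c0" and u: "norm u = 1"
    and le: "\<And>l. l \<in> S \<Longrightarrow> c0 \<le> l \<bullet> u \<Longrightarrow> l \<bullet> v \<le> x"
  shows "u \<bullet> v \<le> max x (x / c0)"
proof -
  let ?T = "{l\<in>S. c0 \<le> l \<bullet> u}"
  obtain a where a: "\<forall>l\<in>?T. 0 \<le> a l" "u = (\<Sum>l\<in>?T. a l *\<^sub>R l)"
    using S u by (auto simp: positive_basis_def positive_combination_def)
  have fin: "finite ?T" using S by (simp add: positive_basis_def)
  define A where "A = (\<Sum>l\<in>?T. a l)"
  have dec: "u \<bullet> w = (\<Sum>l\<in>?T. a l * (l \<bullet> w))" for w
    by (subst a(2)) (simp add: inner_sum_left)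
  have "c0 * A = (\<Sum>l\<in>?T. a l * c0)" by (simp add: A_def sum_distrib_left mult.commute)
  also have "\<dots> \<le> u \<bullet> u" unfolding dec using a(1) by (intro sum_mono mult_left_mono) auto
  finally have A1: "c0 * A \<le> 1" using u by (simp add: norm_eq_1)
  have "u \<bullet> u \<le> (\<Sum>l\<in>?T. a l * 1)"
    unfolding dec
  proof (intro sum_mono mult_left_mono)
    fix l assume l: "l \<in> ?T"
    then have "l \<bullet> u \<le> norm l * norm u" by (intro norm_cauchy_schwarz)
    with l S u show "l \<bullet> u \<le> 1" by (auto simp: positive_basis_def)
  qed (use a(1) in auto)
  then have A2: "1 \<le> A" using u by (simp add: norm_eq_1 A_def)
  have "u \<bullet> v \<le> (\<Sum>l\<in>?T. a l * x)"
    unfolding dec using a(1) le by (intro sum_mono mult_left_mono) auto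
  also have "\<dots> = A * x" by (simp add: A_def sum_distrib_right)
  also have "\<dots> \<le> max x (x / c0)"
  proof (cases "x \<ge> 0")
    case True
    have "A \<le> 1 / c0" using A1 c0 by (simp add: field_simps)
    with True have "A * x \<le> 1 / c0 * x" by (intro mult_right_mono)
    then show ?thesis by simp
  next
    case False
    with A2 have "A * x \<le> 1 * x" by (intro mult_right_mono_neg) auto
    then show ?thesis by simp
  qed
  finally show ?thesis .
qed

text \<open>Tested in the direction of \<open>v\<close> itself, the loss \<open>1 / c0\<close> of
  the basis is compensated by the factor \<open>c0\<close> in the constraint. This is how the second
  family of constraints in (QP) caps the command at \<open>vbar - dr\<close>.\<close>

lemma positive_basis_norm_le:
  fixes S :: "(real^'n) set"
  assumes S: "positive_basis c0 S" and c0: "0 < c0" "c0 < 1" and \<beta>: "0 \<le> \<beta>"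
    and le: "\<And>l. l \<in> S \<Longrightarrow> l \<bullet> v \<le> c0 * \<beta>"
  shows "norm v \<le> \<beta>"
proof (cases "v = 0")
  case False
  then have "(v /\<^sub>R norm v) \<bullet> v \<le> max (c0 * \<beta>) (c0 * \<beta> / c0)"
    by (intro positive_basis_inner_le[OF S c0(1)]) (auto simp: le)
  also have "\<dots> \<le> \<beta>" using c0 \<beta> by (simp add: mult_left_le_one_le)
  finally show ?thesis using False by (simp add: power2_norm_eq_inner[symmetric] power2_eq_square mult.assoc[symmetric])
qed (use \<beta> in simp)

section \<open>The quadratic program\<close>

text \<open>The two constraints with the same normal \<open>l\<close> are merged into one offset,
  which puts the feasible set into the form \<open>face_polyhedron\<close>.\<close>

definition qp_bound ::
  "(real \<Rightarrow> real) \<Rightarrow> real \<Rightarrow> real \<Rightarrow> real \<Rightarrow> (real^'n \<Rightarrow> real) \<Rightarrow> real^'n \<Rightarrow> real" where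
  "qp_bound \<alpha>c c0 dr vbar r l = min (c0 * \<alpha>c (r l) - dr) (c0 * (vbar - dr))"

section \<open>Distances between normalised vectors\<close>

lemma norm_normalize_diff_le:
  fixes x y :: "'a::real_normed_vector"
  assumes "m > 0" "m \<le> norm x" "y \<noteq> 0"
  shows "norm (x /\<^sub>R norm x - y /\<^sub>R norm y) \<le> 2 / m * norm (x - y)"
proof -
  have x: "norm x > 0" using assms by linarith
  have "x /\<^sub>R norm x - y /\<^sub>R norm y = (x - y) /\<^sub>R norm x + (1 / norm x - 1 / norm y) *\<^sub>R y"
    by (simp add: algebra_simps divide_inverse)
  also have "norm \<dots> \<le> norm (x - y) / norm x + \<bar>1 / norm x - 1 / norm y\<bar> * norm y"
    by (rule norm_triangle_le) (simp add: divide_inverse mult.commute)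
  also have "\<bar>1 / norm x - 1 / norm y\<bar> * norm y = \<bar>(1 / norm x - 1 / norm y) * norm y\<bar>"
    by (simp add: abs_mult)
  also have "(1 / norm x - 1 / norm y) * norm y = (norm y - norm x) / norm x"
    using x assms(3) by (simp add: field_simps)
  also have "\<bar>(norm y - norm x) / norm x\<bar> = \<bar>norm x - norm y\<bar> / norm x"
    using x by (simp add: abs_divide abs_minus_commute)
  also have "\<dots> \<le> norm (x - y) / norm x"
    using norm_triangle_ineq3[of x y] by (intro divide_right_mono) auto
  also have "norm (x - y) / norm x + norm (x - y) / norm x = 2 * norm (x - y) / norm x" by simp
  also have "\<dots> \<le> 2 * norm (x - y) / m" using assms x by (intro divide_left_mono) auto
  finally show ?thesis by simp
qed

text \<open>The law of cosines gives
  \<open>2 * m\<^sup>2 - d\<^sup>2 \<le> 2 * (x \<bullet> y)\<close>. The left side is nonnegative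
  by the last hypothesis, so replacing the denominator \<open>norm x * norm y\<close> by the larger
  \<open>R\<^sup>2\<close> only weakens the bound.\<close>

lemma norm_normalize_diff_square_le:
  fixes x y :: "'a::real_inner"
  assumes m: "0 < m" "m \<le> norm x" "m \<le> norm y" and R: "norm x \<le> R" "norm y \<le> R"
    and d: "norm (x - y) \<le> d" "d\<^sup>2 \<le> 2 * m\<^sup>2"
  shows "(norm (x /\<^sub>R norm x - y /\<^sub>R norm y))\<^sup>2 \<le> 2 - (2 * m\<^sup>2 - d\<^sup>2) / R\<^sup>2"
proof -
  have nz: "norm x > 0" "norm y > 0" "x \<noteq> 0" "y \<noteq> 0" using m by auto
  have "2 * (x \<bullet> y) = (norm x)\<^sup>2 + (norm y)\<^sup>2 - (norm (x - y))\<^sup>2"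
    by (simp add: power2_norm_eq_inner inner_diff_left inner_diff_right inner_commute)
  moreover have "m\<^sup>2 \<le> (norm x)\<^sup>2" "m\<^sup>2 \<le> (norm y)\<^sup>2" "(norm (x - y))\<^sup>2 \<le> d\<^sup>2"
    using m d by (auto intro: power_mono)
  ultimately have xy: "2 * m\<^sup>2 - d\<^sup>2 \<le> 2 * (x \<bullet> y)" by linarith
  have "(2 * m\<^sup>2 - d\<^sup>2) / R\<^sup>2 \<le> (2 * m\<^sup>2 - d\<^sup>2) / (norm x * norm y)"
    using m R d nz by (intro divide_left_mono) (auto simp: power2_eq_square intro: mult_mono)
  also have "\<dots> \<le> 2 * (x \<bullet> y) / (norm x * norm y)"
    using xy nz by (intro divide_right_mono) auto
  finally have *: "(2 * m\<^sup>2 - d\<^sup>2) / R\<^sup>2 \<le> 2 * (x \<bullet> y) / (norm x * norm y)" .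
  have "(norm (x /\<^sub>R norm x - y /\<^sub>R norm y))\<^sup>2
      = (norm (x /\<^sub>R norm x))\<^sup>2 + (norm (y /\<^sub>R norm y))\<^sup>2 - 2 * ((x /\<^sub>R norm x) \<bullet> (y /\<^sub>R norm y))"
    unfolding power2_norm_eq_inner inner_diff_left inner_diff_right by (simp only: inner_commute)
  also have "\<dots> = 2 - 2 * (x \<bullet> y) / (norm x * norm y)"
    using nz by (simp add: divide_inverse)
  finally show ?thesis using * by linarith
qed

lemma abs_Min_diff_le:
  fixes f g :: "'a \<Rightarrow> real"
  assumes "finite I" "I \<noteq> {}" "\<And>i. i \<in> I \<Longrightarrow> \<bar>f i - g i\<bar> \<le> d"
  shows "\<bar>Min (f ` I) - Min (g ` I)\<bar> \<le> d"
proof -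
  have *: "Min (f ` I) \<le> Min (g ` I) + d" if "\<And>i. i \<in> I \<Longrightarrow> \<bar>f i - g i\<bar> \<le> d" for f g :: "'a \<Rightarrow> real"
  proof -
    obtain i where i: "i \<in> I" "Min (g ` I) = g i"
      using Min_in[of "g ` I"] assms by fastforce
    have "Min (f ` I) \<le> f i" using i assms by (intro Min_le) auto
    with that[of i] i show ?thesis by linarith
  qed
  from *[of f g] *[of g f] assms(3) show ?thesis by (fastforce simp: abs_minus_commute abs_le_iff)
qed

section \<open>The solution of (QP) as a projection\<close>

lemma qp_feasible_eq_face_polyhedron:
  "qp_feasible \<alpha>c c0 dr vbar S r = face_polyhedron S (qp_bound \<alpha>c c0 dr vbar r)"
  by (auto simp: qp_feasible_def face_polyhedron_def qp_bound_def)

lemma qp_solution_iff_closest_point: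
  fixes S :: "(real^'n) set"
  assumes F_def: "F = qp_feasible \<alpha>c c0 dr vbar S (r_fun N qo ds \<phi> q)" and ne: "F \<noteq> {}"
  shows "qp_solution N qo ds \<phi> \<alpha>c c0 dr vbar S q vc v \<longleftrightarrow> v = closest_point (F) vc"
proof -
  have cl: "closed (F)" and cvx: "convex (F)"
    unfolding F_def qp_feasible_eq_face_polyhedron
    by (rule closed_face_polyhedron convex_face_polyhedron)+
  have sq: "(norm (w - vc))\<^sup>2 < (norm (v - vc))\<^sup>2 \<longleftrightarrow> \<not> dist vc v \<le> dist vc w" for w
    unfolding dist_norm norm_minus_commute[of vc] not_le
    by (subst (1 2) not_le[symmetric]) (simp add: power_mono_iff)
  have "qp_solution N qo ds \<phi> \<alpha>c c0 dr vbar S q vc v \<longleftrightarrow>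
      v \<in> F \<and> (\<forall>w\<in>F. dist vc v \<le> dist vc w)"
    unfolding qp_solution_def is_arg_min_def F_def[symmetric] sq by blast
  also have "\<dots> \<longleftrightarrow> v = closest_point F vc"
  proof
    assume "v \<in> F \<and> (\<forall>w\<in>F. dist vc v \<le> dist vc w)"
    then show "v = closest_point F vc" by (intro closest_point_unique[OF cvx cl]) auto
  next
    assume "v = closest_point F vc"
    then show "v \<in> F \<and> (\<forall>w\<in>F. dist vc v \<le> dist vc w)"
      using closest_point_in_set[OF cl ne] closest_point_le[OF cl] by simp
  qed
  finally show ?thesis .
qed

lemma varphi_eq_closest_point:
  assumes "qp_feasible \<alpha>c c0 dr vbar S (r_fun N qo ds \<phi> q) \<noteq> {}"
  shows "varphi N qo ds \<phi> \<alpha>c c0 dr vbar S q vc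
      = closest_point (qp_feasible \<alpha>c c0 dr vbar S (r_fun N qo ds \<phi> q)) vc"
  by (simp add: varphi_def qp_solution_iff_closest_point[OF refl assms])

lemma varphi_defined_of_feasible:
  assumes "qp_feasible \<alpha>c c0 dr vbar S (r_fun N qo ds \<phi> q) \<noteq> {}" "\<And>i. i \<in> {1..N} \<Longrightarrow> q \<noteq> qo i"
  shows "varphi_defined N qo ds \<phi> \<alpha>c c0 dr vbar S q vc"
  unfolding varphi_defined_def qp_solution_iff_closest_point[OF refl assms(1)]
  by (intro conjI ballI assms(2)) auto

lemma varphi_in_qp_feasible:
  assumes "varphi_defined N qo ds \<phi> \<alpha>c c0 dr vbar S q vc"
  shows "varphi N qo ds \<phi> \<alpha>c c0 dr vbar S q vc \<in> qp_feasible \<alpha>c c0 dr vbar S (r_fun N qo ds \<phi> q)"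
proof -
  have "qp_solution N qo ds \<phi> \<alpha>c c0 dr vbar S q vc (varphi N qo ds \<phi> \<alpha>c c0 dr vbar S q vc)"
    unfolding varphi_def by (rule theI') (use assms in \<open>simp add: varphi_defined_def\<close>)
  then show ?thesis by (simp add: qp_solution_def is_arg_min_def)
qed

section \<open>Constraint offsets and feasibility near the obstacles\<close>

lemma norm_obs_dir: "q \<noteq> qo i \<Longrightarrow> norm (obs_dir qo i q) = 1"
  by (simp add: obs_dir_def)

lemma inner_obs_dir_bounds:
  assumes "q \<noteq> qo i" "norm l = 1"
  shows "obs_dir qo i q \<bullet> l \<in> {-1..1}"
  using Cauchy_Schwarz_ineq2[of "obs_dir qo i q" l] assms by (auto simp: norm_obs_dir)

lemma r_fun_le:
  assumes "i \<in> {1..N}"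
  shows "r_fun N qo ds \<phi> q l \<le> obs_h qo ds i q + \<phi> (obs_dir qo i q \<bullet> l)"
  unfolding r_fun_def obs_h_def using assms by (intro Min_le) auto

lemma r_fun_attained:
  assumes "N \<ge> 1"
  obtains i where "i \<in> {1..N}" "r_fun N qo ds \<phi> q l = obs_h qo ds i q + \<phi> (obs_dir qo i q \<bullet> l)"
proof -
  have "r_fun N qo ds \<phi> q l \<in> (\<lambda>i. norm (qo i - q) - ds i + \<phi> (obs_dir qo i q \<bullet> l)) ` {1..N}"
    unfolding r_fun_def by (rule Min_in) (use assms in auto)
  with that show thesis by (auto simp: obs_h_def)
qed

text \<open>A feasible velocity retreats at speed \<open>K\<close> from an arbitrary nearby obstacle; the directions
  of all nearby obstacles are so close to each other that this moves away from each of them.\<close>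

lemma qp_feasible_nonempty:
  fixes S :: "(real^'n) set"
  assumes N: "N \<ge> 1" and S: "\<And>l. l \<in> S \<Longrightarrow> norm l = 1"
    and mono: "mono \<alpha>c" and c0: "0 < c0" and K0: "0 \<le> K"
    and h: "\<And>i. i \<in> {1..N} \<Longrightarrow> q \<noteq> qo i \<and> - p \<le> obs_h qo ds i q"
    and K: "K * \<kappa> = dr - c0 * \<alpha>c (- p)" "K \<le> c0 * (vbar - dr)" "K \<le> c0 * \<alpha>c (db / 2) - dr"
    and \<phi>: "\<And>s. s \<in> {-1..1} \<Longrightarrow> 0 \<le> \<phi> s \<and> c0 * \<alpha>c (- p) + K * max 0 (c0 - s) \<le> c0 * \<alpha>c (\<phi> s - p)"
    and near: "\<And>i j. i \<in> {1..N} \<Longrightarrow> j \<in> {1..N} \<Longrightarrow> obs_h qo ds i q \<le> db / 2 \<Longrightarrow>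
      obs_h qo ds j q \<le> db / 2 \<Longrightarrow> norm (obs_dir qo i q - obs_dir qo j q) \<le> c0 - \<kappa>"
  shows "qp_feasible \<alpha>c c0 dr vbar S (r_fun N qo ds \<phi> q) \<noteq> {}"
proof -
  \<comment> \<open>\<open>u = 0\<close> covers the absence of near obstacles; the candidate
    velocity is then zero.\<close>
  have "\<exists>u. norm u \<le> 1 \<and> (\<forall>i\<in>{1..N}. obs_h qo ds i q \<le> db / 2 \<longrightarrow> norm (obs_dir qo i q - u) \<le> c0 - \<kappa>)"
  proof (cases "\<exists>j\<in>{1..N}. obs_h qo ds j q \<le> db / 2")
    case True
    then obtain j where "j \<in> {1..N}" "obs_h qo ds j q \<le> db / 2" by blast
    then show ?thesis using near h by (intro exI[of _ "obs_dir qo j q"]) (auto simp: norm_obs_dir)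
  qed (auto intro: exI[of _ 0])
  then obtain u where u: "norm u \<le> 1" and close: "\<And>i. i \<in> {1..N} \<Longrightarrow> obs_h qo ds i q \<le> db / 2 \<Longrightarrow>
      norm (obs_dir qo i q - u) \<le> c0 - \<kappa>" by blast
  have "- K *\<^sub>R u \<in> qp_feasible \<alpha>c c0 dr vbar S (r_fun N qo ds \<phi> q)"
    unfolding qp_feasible_def mem_Collect_eq
  proof (intro ballI conjI)
    fix l assume l: "l \<in> S"
    have "- (l \<bullet> u) \<le> norm l * norm u" using norm_cauchy_schwarz[of l "- u"] by simp
    also have "\<dots> \<le> 1" using S[OF l] u by simp
    finally have "K * - (l \<bullet> u) \<le> K * 1" using K0 by (intro mult_left_mono)
    then have lK: "l \<bullet> (- K *\<^sub>R u) \<le> K" by simp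
    with K show "l \<bullet> (- K *\<^sub>R u) \<le> c0 * (vbar - dr)" by linarith
    obtain i where i: "i \<in> {1..N}"
      "r_fun N qo ds \<phi> q l = obs_h qo ds i q + \<phi> (obs_dir qo i q \<bullet> l)"
      using r_fun_attained[OF N] .
    define s where "s = obs_dir qo i q \<bullet> l"
    have s: "s \<in> {-1..1}" unfolding s_def using h[OF i(1)] S[OF l] by (intro inner_obs_dir_bounds) auto
    note \<phi>s = \<phi>[OF s]
    \<comment> \<open>The obstacle attaining \<open>r_fun\<close> decides. If it is near,
      \<open>u\<close> is within \<open>c0 - \<kappa>\<close> of its direction, and
      \<open>K * \<kappa>\<close> pays for both \<open>dr\<close> and the negative value
      \<open>\<alpha>c (- p)\<close>, while \<open>\<phi>\<close> covers the rest. If it is farther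
      than \<open>db / 2\<close>, the crude bound by \<open>K\<close> is enough.\<close>
    show "l \<bullet> (- K *\<^sub>R u) \<le> c0 * \<alpha>c (r_fun N qo ds \<phi> q l) - dr"
    proof (cases "obs_h qo ds i q \<le> db / 2")
      case True
      have "s - l \<bullet> u = l \<bullet> (obs_dir qo i q - u)" by (simp add: s_def inner_diff_right inner_commute)
      also have "\<dots> \<le> norm l * norm (obs_dir qo i q - u)" by (rule norm_cauchy_schwarz)
      also have "\<dots> \<le> c0 - \<kappa>" using close[OF i(1) True] S[OF l] by simp
      finally have "K * (- (l \<bullet> u)) \<le> K * (max 0 (c0 - s) - \<kappa>)" using K0 by (intro mult_left_mono) auto
      also have "\<dots> = K * max 0 (c0 - s) - dr + c0 * \<alpha>c (- p)" using K(1) by (simp add: algebra_simps)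
      also have "\<dots> \<le> c0 * \<alpha>c (\<phi> s - p) - dr" using \<phi>s by linarith
      also have "\<dots> \<le> c0 * \<alpha>c (obs_h qo ds i q + \<phi> s) - dr"
        using c0 h[OF i(1)] by (intro diff_mono mult_left_mono monoD[OF mono]) auto
      finally show ?thesis by (simp add: i(2) s_def)
    next
      case False
      have "c0 * \<alpha>c (db / 2) \<le> c0 * \<alpha>c (obs_h qo ds i q + \<phi> s)"
        using c0 False \<phi>s by (intro mult_left_mono monoD[OF mono]) auto
      with lK K(3) show ?thesis by (simp add: i(2) s_def)
    qed
  qed
  then show ?thesis by blast
qed

lemma abs_r_fun_diff_le:
  fixes q1 q2 l :: "real^'n"
  assumes N: "N \<ge> 1" and l: "norm l = 1" and m: "m > 0"
    and far: "\<And>i. i \<in> {1..N} \<Longrightarrow> m \<le> norm (qo i - q1) \<and> m \<le> norm (qo i - q2)"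
    and B: "B-lipschitz_on {-1..1} \<phi>"
  shows "\<bar>r_fun N qo ds \<phi> q1 l - r_fun N qo ds \<phi> q2 l\<bar> \<le> (1 + B * (2 / m)) * norm (q1 - q2)"
  unfolding r_fun_def
proof (rule abs_Min_diff_le)
  fix i assume i: "i \<in> {1..N}"
  have ne: "q1 \<noteq> qo i" "q2 \<noteq> qo i" using far[OF i] m by auto
  have "\<bar>norm (qo i - q1) - norm (qo i - q2)\<bar> \<le> norm (q1 - q2)"
    using norm_triangle_ineq3[of "qo i - q1" "qo i - q2"] by (simp add: norm_minus_commute)
  moreover have "\<bar>\<phi> (obs_dir qo i q1 \<bullet> l) - \<phi> (obs_dir qo i q2 \<bullet> l)\<bar> \<le> B * (2 / m * norm (q1 - q2))"
  proof -
    have "\<bar>\<phi> (obs_dir qo i q1 \<bullet> l) - \<phi> (obs_dir qo i q2 \<bullet> l)\<bar>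
        \<le> B * \<bar>obs_dir qo i q1 \<bullet> l - obs_dir qo i q2 \<bullet> l\<bar>"
      using lipschitz_onD[OF B] inner_obs_dir_bounds ne l by (metis dist_real_def)
    also have "\<bar>obs_dir qo i q1 \<bullet> l - obs_dir qo i q2 \<bullet> l\<bar> \<le> norm (obs_dir qo i q1 - obs_dir qo i q2) * norm l"
      unfolding inner_diff_left[symmetric] by (rule Cauchy_Schwarz_ineq2)
    also have "\<dots> \<le> 2 / m * norm (q1 - q2)"
      using norm_normalize_diff_le[OF m, of "qo i - q1" "qo i - q2"] far[OF i] ne l
      by (simp add: obs_dir_def norm_minus_commute)
    finally show ?thesis using lipschitz_on_nonneg[OF B] by (simp add: mult_left_mono)
  qed
  ultimately show "\<bar>(norm (qo i - q1) - ds i + \<phi> (obs_dir qo i q1 \<bullet> l)) -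
      (norm (qo i - q2) - ds i + \<phi> (obs_dir qo i q2 \<bullet> l))\<bar> \<le> (1 + B * (2 / m)) * norm (q1 - q2)"
    by (simp add: algebra_simps)
qed (use N in auto)

text \<open>A violation of at most \<open>\<Delta>\<close> lowers the distance to each centre to no
  less than \<open>ds_min N ds - \<Delta>\<close>, nearness bounds it by
  \<open>ds_max N ds + db / 2\<close>, and \<open>\<Delta> \<le> dh\<close> admits the distance
  assumption, which puts the centres at most \<open>da\<close> apart.\<close>

lemma obs_dir_diff_square_le:
  assumes dist: "obs_distance_assumption N qo ds da db dh"
    and \<Delta>: "\<Delta> \<le> dh" and da: "da\<^sup>2 \<le> 2 * (ds_min N ds - \<Delta>)\<^sup>2"
    and h: "\<And>i. i \<in> {1..N} \<Longrightarrow> - \<Delta> \<le> obs_h qo ds i q"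
    and ij: "i \<in> {1..N}" "j \<in> {1..N}" "obs_h qo ds i q \<le> db / 2" "obs_h qo ds j q \<le> db / 2"
  shows "(norm (obs_dir qo i q - obs_dir qo j q))\<^sup>2
    \<le> 2 - (2 * (ds_min N ds - \<Delta>)\<^sup>2 - da\<^sup>2) / (ds_max N ds + db / 2)\<^sup>2"
  unfolding obs_dir_def
proof (rule norm_normalize_diff_square_le)
  have ds: "ds_min N ds \<le> ds k" "ds k \<le> ds_max N ds" if "k \<in> {1..N}" for k
    using that by (auto simp: ds_min_def ds_max_def)
  show "0 < ds_min N ds - \<Delta>" using dist \<Delta> by (auto simp: obs_distance_assumption_def)
  show "ds_min N ds - \<Delta> \<le> norm (qo i - q)" "ds_min N ds - \<Delta> \<le> norm (qo j - q)"
    using h[OF ij(1)] h[OF ij(2)] ds[OF ij(1)] ds[OF ij(2)] by (auto simp: obs_h_def)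
  show "norm (qo i - q) \<le> ds_max N ds + db / 2" "norm (qo j - q) \<le> ds_max N ds + db / 2"
    using ij(3,4) ds[OF ij(1)] ds[OF ij(2)] by (auto simp: obs_h_def)
  have "\<forall>k\<in>{1..N}. - dh \<le> obs_h qo ds k q" using h \<Delta> by force
  with dist ij have "norm (qo i - qo j) \<le> da" unfolding obs_distance_assumption_def by blast
  then show "norm (qo i - q - (qo j - q)) \<le> da" by simp
qed (rule da)

text \<open>Both candidates \<open>k\<close> for \<open>K\<close> satisfy
  \<open>k \<le> c0 * (vbar - dr)\<close> and
  \<open>dr - c0 * \<alpha>c (- p) \<le> k * \<kappa>\<close>. Under these the argument of the
  inverse is at most \<open>\<alpha>c (- p) + (vbar - dr) * (c0 - s)\<close>; the growth of
  \<open>\<alpha>c\<close> moves the second summand inside, and the resulting \<open>- p\<close>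
  cancels the \<open>p\<close> added in the supremum.\<close>

lemma phi_lower_bound_le:
  assumes mono: "strict_mono \<alpha>c" and bij: "bij \<alpha>c" and \<alpha>0: "\<alpha>c 0 = 0"
    and grow: "\<And>x y. 0 \<le> y \<Longrightarrow> \<alpha>c x + y \<le> \<alpha>c (x + \<Lambda> * y)"
    and c0: "0 < c0" and \<kappa>: "0 < \<kappa>" and dr: "0 < dr" and dh: "0 \<le> dh" and s: "s \<le> c0"
    and K: "(dr - c0 * \<alpha>c (- dh)) / \<kappa> \<le> c0 * (vbar - dr)"
  shows "phi_lower_bound \<alpha>c c0 \<kappa> vbar dr dh s \<le> \<Lambda> * ((vbar - dr) * (c0 - s))"
  unfolding phi_lower_bound_def
proof (rule cSUP_least)
  fix p assume p: "p \<in> {0..dh}"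
  let ?Km = "c0 * (vbar - dr)"
  have ap: "\<alpha>c (- dh) \<le> \<alpha>c (- p)" "\<alpha>c (- p) \<le> 0"
    using p strict_mono_less_eq[OF mono, of "- dh" "- p"] strict_mono_less_eq[OF mono, of "- p" 0] \<alpha>0
    by auto
  have bound: "inv \<alpha>c (- k * (s - c0) / c0 + (- k * \<kappa> + dr) / c0) \<le> \<Lambda> * ((vbar - dr) * (c0 - s)) - p"
    if k: "k \<le> ?Km" "dr - c0 * \<alpha>c (- p) \<le> k * \<kappa>" for k
  proof -
    have "c0 * \<alpha>c (- dh) \<le> 0" using ap c0 by (intro mult_nonneg_nonpos) auto
    with dr have "0 \<le> dr - c0 * \<alpha>c (- dh)" by simp
    with K \<kappa> have "0 \<le> ?Km" using order_trans[OF divide_nonneg_pos] by blast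
    then have Km: "0 \<le> vbar - dr" using c0 by (simp add: zero_le_mult_iff)
    have "- k * (s - c0) / c0 + (- k * \<kappa> + dr) / c0 = (k * (c0 - s) + (dr - k * \<kappa>)) / c0"
      by (simp add: add_divide_distrib[symmetric] algebra_simps)
    also have "\<dots> \<le> (?Km * (c0 - s) + c0 * \<alpha>c (- p)) / c0"
      using k s c0 by (intro divide_right_mono add_mono mult_right_mono) auto
    also have "\<dots> = \<alpha>c (- p) + (vbar - dr) * (c0 - s)" using c0 by (simp add: field_simps)
    also have "\<dots> \<le> \<alpha>c (- p + \<Lambda> * ((vbar - dr) * (c0 - s)))"
      using Km s by (intro grow mult_nonneg_nonneg) auto
    finally have "\<alpha>c (inv \<alpha>c (- k * (s - c0) / c0 + (- k * \<kappa> + dr) / c0))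
        \<le> \<alpha>c (- p + \<Lambda> * ((vbar - dr) * (c0 - s)))"
      using surj_f_inv_f[OF bij_is_surj[OF bij]] by simp
    then show ?thesis using strict_mono_less_eq[OF mono] by simp
  qed
  have "dr - c0 * \<alpha>c (- p) \<le> dr - c0 * \<alpha>c (- dh)" using ap c0 by simp
  with K \<kappa> have 1: "dr - c0 * \<alpha>c (- p) \<le> ?Km * \<kappa>" by (simp add: pos_divide_le_eq)
  with \<kappa> have 2: "(dr - c0 * \<alpha>c (- p)) / \<kappa> \<le> ?Km" by (simp add: pos_divide_le_eq)
  show "Max ((\<lambda>K. inv \<alpha>c (- K * (s - c0) / c0 + (- K * \<kappa> + dr) / c0)) `
      {c0 * (vbar - dr), (dr - c0 * \<alpha>c (- p)) / \<kappa>}) + p \<le> \<Lambda> * ((vbar - dr) * (c0 - s))"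
    using bound[OF order_refl 1] bound[OF 2] \<kappa> by simp
qed (use dh in auto)

lemma two_slope_grow:
  assumes "a > 0" "b > 0" "0 \<le> y"
  shows "two_slope a b x + y \<le> two_slope a b (x + 1 / min a b * y)"
proof -
  have "min a b * (x + 1 / min a b * y - x) \<le> two_slope a b (x + 1 / min a b * y) - two_slope a b x"
    using assms by (intro two_slope_increment_bounds(1)[where u = "max a b"]) auto
  moreover have "min a b * (x + 1 / min a b * y - x) = y" using assms by simp
  ultimately show ?thesis by linarith
qed

text \<open>The strict inequalities are the case \<open>\<Delta> = 0\<close> of the conclusions and
  persist for small positive \<open>\<Delta>\<close> by continuity.\<close>

lemma obstacle_margin_exists:
  fixes m R da dh g :: real
  assumes "0 < dh" and "da\<^sup>2 < 2 * m\<^sup>2" and "R > 0" and "2 - (2 * m\<^sup>2 - da\<^sup>2) / R\<^sup>2 < g"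
  obtains \<Delta> where "0 < \<Delta>" "\<Delta> \<le> dh" "da\<^sup>2 \<le> 2 * (m - \<Delta>)\<^sup>2" "2 - (2 * (m - \<Delta>)\<^sup>2 - da\<^sup>2) / R\<^sup>2 \<le> g"
proof -
  have l1: "((\<lambda>\<Delta>. 2 * (m - \<Delta>)\<^sup>2) \<longlongrightarrow> 2 * (m - 0)\<^sup>2) (at_right 0)"
    and l2: "((\<lambda>\<Delta>. 2 - (2 * (m - \<Delta>)\<^sup>2 - da\<^sup>2) / R\<^sup>2) \<longlongrightarrow> 2 - (2 * (m - 0)\<^sup>2 - da\<^sup>2) / R\<^sup>2) (at_right 0)"
    using assms(3) by (intro tendsto_intros; simp)+
  have "\<forall>\<^sub>F \<Delta> in at_right 0. da\<^sup>2 < 2 * (m - \<Delta>)\<^sup>2"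
    "\<forall>\<^sub>F \<Delta> in at_right 0. 2 - (2 * (m - \<Delta>)\<^sup>2 - da\<^sup>2) / R\<^sup>2 < g"
    "\<forall>\<^sub>F \<Delta> in at_right 0. \<Delta> \<in> {0<..<dh}"
    using order_tendstoD(1)[OF l1, of "da\<^sup>2"] order_tendstoD(2)[OF l2, of g] assms
      eventually_at_right_real[OF assms(1)] by auto
  then have "\<forall>\<^sub>F \<Delta> in at_right 0. 0 < \<Delta> \<and> \<Delta> \<le> dh \<and> da\<^sup>2 \<le> 2 * (m - \<Delta>)\<^sup>2 \<and>
      2 - (2 * (m - \<Delta>)\<^sup>2 - da\<^sup>2) / R\<^sup>2 \<le> g"
    by eventually_elim auto
  from eventually_happens'[OF trivial_limit_at_right_real this] that show thesis by blast
qed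

lemma abs_min_diff_le: "\<bar>min x c - min y c\<bar> \<le> \<bar>x - y\<bar>" for x y c :: real
  by (auto simp: min_def abs_if)

lemma varphi_lipschitz:
  fixes S :: "(real^'n) set"
  assumes N: "N \<ge> 1" and fin: "finite S" and S: "\<And>l. l \<in> S \<Longrightarrow> norm l = 1"
    and c0: "0 \<le> c0" and A: "A-lipschitz_on UNIV \<alpha>c" and B: "B-lipschitz_on {-1..1} \<phi>" and m: "m > 0"
    and D: "\<And>q. q \<in> D \<Longrightarrow> qp_feasible \<alpha>c c0 dr vbar S (r_fun N qo ds \<phi> q) \<noteq> {}"
      "\<And>q i. q \<in> D \<Longrightarrow> i \<in> {1..N} \<Longrightarrow> m \<le> norm (qo i - q)"
  shows "\<exists>L>0. \<forall>q1\<in>D. \<forall>q2\<in>D. \<forall>vc1 vc2.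
    norm (varphi N qo ds \<phi> \<alpha>c c0 dr vbar S q1 vc1 - varphi N qo ds \<phi> \<alpha>c c0 dr vbar S q2 vc2)
      \<le> L * (norm (q1 - q2) + norm (vc1 - vc2))"
proof -
  define b where "b q = qp_bound \<alpha>c c0 dr vbar (r_fun N qo ds \<phi> q)" for q
  obtain K where K: "K \<ge> 0" "\<And>b1 b2 c1 c2 r. face_polyhedron S b1 \<noteq> {} \<Longrightarrow> face_polyhedron S b2 \<noteq> {} \<Longrightarrow>
      \<forall>l\<in>S. \<bar>b1 l - b2 l\<bar> \<le> r \<Longrightarrow> 0 \<le> r \<Longrightarrow>
      norm (closest_point (face_polyhedron S b1) c1 - closest_point (face_polyhedron S b2) c2)
        \<le> norm (c1 - c2) + K * r"
    using closest_point_face_polyhedron_lipschitz[OF fin] by blast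
  define R where "R = c0 * (A * (1 + B * (2 / m)))"
  have A0: "A \<ge> 0" and B0: "B \<ge> 0" using A B lipschitz_on_nonneg by auto
  have R0: "R \<ge> 0" unfolding R_def using A0 B0 c0 m by simp
  have bdiff: "\<bar>b q1 l - b q2 l\<bar> \<le> R * norm (q1 - q2)" if q: "q1 \<in> D" "q2 \<in> D" and l: "l \<in> S" for q1 q2 l
  proof -
    let ?r = "\<lambda>q. r_fun N qo ds \<phi> q l"
    have "\<bar>b q1 l - b q2 l\<bar> \<le> \<bar>(c0 * \<alpha>c (?r q1) - dr) - (c0 * \<alpha>c (?r q2) - dr)\<bar>"
      unfolding b_def qp_bound_def by (rule abs_min_diff_le)
    also have "\<dots> = c0 * \<bar>\<alpha>c (?r q1) - \<alpha>c (?r q2)\<bar>"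
      using c0 by (simp add: right_diff_distrib[symmetric] abs_mult)
    also have "\<dots> \<le> c0 * (A * \<bar>?r q1 - ?r q2\<bar>)"
      using lipschitz_onD[OF A UNIV_I UNIV_I] c0 by (intro mult_left_mono) (auto simp: dist_real_def)
    also have "\<dots> \<le> c0 * (A * ((1 + B * (2 / m)) * norm (q1 - q2)))"
      using c0 A0 D(2) q S[OF l] by (intro mult_left_mono abs_r_fun_diff_le[OF N _ m _ B]) auto
    finally show ?thesis by (simp add: R_def mult.assoc)
  qed
  show ?thesis
  \<comment> \<open>The \<open>1\<close> is the nonexpansive dependence on \<open>vc\<close>; it
    also keeps the constant positive when \<open>K * R\<close> vanishes.\<close>
  proof (intro exI[of _ "1 + K * R"] conjI ballI allI)
    show "0 < 1 + K * R" using K(1) R0 by (simp add: add_pos_nonneg)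
    fix q1 q2 vc1 vc2 assume q: "q1 \<in> D" "q2 \<in> D"
    have "norm (closest_point (face_polyhedron S (b q1)) vc1 - closest_point (face_polyhedron S (b q2)) vc2)
        \<le> norm (vc1 - vc2) + K * (R * norm (q1 - q2))"
      using D(1)[OF q(1)] D(1)[OF q(2)] bdiff[OF q] R0
      by (intro K(2)) (auto simp: b_def qp_feasible_eq_face_polyhedron)
    also have "\<dots> \<le> (1 + K * R) * (norm (q1 - q2) + norm (vc1 - vc2))"
      using K(1) R0 by (simp add: algebra_simps)
    finally show "norm (varphi N qo ds \<phi> \<alpha>c c0 dr vbar S q1 vc1 - varphi N qo ds \<phi> \<alpha>c c0 dr vbar S q2 vc2)
        \<le> (1 + K * R) * (norm (q1 - q2) + norm (vc1 - vc2))"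
      by (simp add: varphi_eq_closest_point[OF D(1)[OF q(1)]] varphi_eq_closest_point[OF D(1)[OF q(2)]]
          b_def qp_feasible_eq_face_polyhedron)
  qed
qed

lemma ramp_lipschitz:
  fixes B c :: real
  assumes "B \<ge> 0"
  shows "B-lipschitz_on S (\<lambda>s. B * max 0 (c - s))"
proof (rule lipschitz_onI)
  fix s t :: real
  have "\<bar>max 0 (c - s) - max 0 (c - t)\<bar> \<le> \<bar>s - t\<bar>" by (auto simp: max_def abs_if)
  with assms show "dist (B * max 0 (c - s)) (B * max 0 (c - t)) \<le> B * dist s t"
    by (simp add: dist_real_def right_diff_distrib[symmetric] abs_mult mult_left_mono)
qed (use assms in simp)

lemma qp_feasible_nonempty_ramp:
  fixes S :: "(real^'n) set"
  assumes N: "N \<ge> 1" and S: "\<And>l. l \<in> S \<Longrightarrow> norm l = 1" and ab: "a > 0" "b > 0" and c0: "0 < c0"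
    and \<kappa>: "0 < \<kappa>" "\<kappa> \<le> c0" and dr: "0 < dr" "dr \<le> vbar"
    and dist: "obs_distance_assumption N qo ds da db dh"
    and \<Delta>: "0 \<le> \<Delta>" "\<Delta> \<le> dh" "da\<^sup>2 \<le> 2 * (ds_min N ds - \<Delta>)\<^sup>2"
      "2 - (2 * (ds_min N ds - \<Delta>)\<^sup>2 - da\<^sup>2) / (ds_max N ds + db / 2)\<^sup>2 \<le> (c0 - \<kappa>)\<^sup>2"
    and B: "1 / min a b * (vbar - dr) \<le> B"
    and K: "(dr - c0 * two_slope a b (- dh)) / \<kappa> \<le> c0 * two_slope a b (db / 2) - dr"
      "c0 * two_slope a b (db / 2) - dr \<le> c0 * (vbar - dr)"
    and h: "\<And>i. i \<in> {1..N} \<Longrightarrow> - \<Delta> \<le> obs_h qo ds i q"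
  shows "qp_feasible (two_slope a b) c0 dr vbar S (r_fun N qo ds (\<lambda>s. B * max 0 (c0 - s)) q) \<noteq> {}"
proof -
  \<comment> \<open>The speed whose gain \<open>K * \<kappa>\<close> exactly pays for the margin
    \<open>dr\<close> and for a violation \<open>\<Delta>\<close>; as
    \<open>\<Delta> \<le> dh\<close>, it stays below the speed required at
    \<open>dh\<close>.\<close>
  define K where "K = (dr - c0 * two_slope a b (- \<Delta>)) / \<kappa>"
  have neg: "two_slope a b (- \<Delta>) = - b * \<Delta>" "two_slope a b (- dh) = - b * dh"
    using \<Delta> by auto
  have "0 \<le> c0 * (b * \<Delta>)" using \<Delta> ab c0 by simp
  with \<kappa> dr have K0: "0 \<le> K" unfolding K_def neg by simp
  have "c0 * (b * \<Delta>) \<le> c0 * (b * dh)" using \<Delta> ab c0 by (intro mult_left_mono) auto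
  then have "K \<le> (dr - c0 * two_slope a b (- dh)) / \<kappa>"
    unfolding K_def neg using \<kappa> by (intro divide_right_mono) auto
  with K have K1: "K \<le> c0 * two_slope a b (db / 2) - dr" and K2: "K \<le> c0 * (vbar - dr)" by linarith+
  have mono: "mono (two_slope a b)" using two_slope_strict_mono[OF ab] by (rule strict_mono_mono)
  show ?thesis
  proof (rule qp_feasible_nonempty[OF N S mono c0 K0 _ _ K2 K1])
    fix i assume i: "i \<in> {1..N}"
    have "ds_min N ds \<le> ds i" using i by (auto simp: ds_min_def)
    with h[OF i] \<Delta>(2) dist show "q \<noteq> qo i \<and> - \<Delta> \<le> obs_h qo ds i q"
      by (auto simp: obs_h_def obs_distance_assumption_def)
  next
    show "K * \<kappa> = dr - c0 * two_slope a b (- \<Delta>)" using \<kappa> by (simp add: K_def)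
  next
    fix s :: real
    \<comment> \<open>Since \<open>K \<le> c0 * (vbar - dr)\<close>, a rise of
      \<open>\<alpha>c\<close> by \<open>?y\<close> is all that speed \<open>K\<close> can demand;
      the steepness \<open>B\<close> of the ramp produces that rise.\<close>
    let ?y = "(vbar - dr) * max 0 (c0 - s)"
    have y: "0 \<le> ?y" using dr by simp
    have "two_slope a b (- \<Delta>) + ?y \<le> two_slope a b (- \<Delta> + 1 / min a b * ?y)"
      by (rule two_slope_grow[OF ab y])
    also have "\<dots> \<le> two_slope a b (B * max 0 (c0 - s) - \<Delta>)"
      using mult_right_mono[OF B, of "max 0 (c0 - s)"] by (intro monoD[OF mono]) (simp add: mult.assoc)
    finally have "c0 * (two_slope a b (- \<Delta>) + ?y) \<le> c0 * two_slope a b (B * max 0 (c0 - s) - \<Delta>)"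
      using c0 by (intro mult_left_mono) auto
    moreover have "K * max 0 (c0 - s) \<le> c0 * ?y"
      using mult_right_mono[OF K2, of "max 0 (c0 - s)"] by (simp add: mult.assoc)
    moreover have "0 \<le> 1 / min a b * (vbar - dr)" using ab dr by simp
    with B have "0 \<le> B" by linarith
    ultimately show "0 \<le> B * max 0 (c0 - s) \<and>
        c0 * two_slope a b (- \<Delta>) + K * max 0 (c0 - s) \<le> c0 * two_slope a b (B * max 0 (c0 - s) - \<Delta>)"
      by (simp add: distrib_left)
  next
    fix i j assume "i \<in> {1..N}" "j \<in> {1..N}" "obs_h qo ds i q \<le> db / 2" "obs_h qo ds j q \<le> db / 2"
    from obs_dir_diff_square_le[OF dist \<Delta>(2,3) h this]
    have "(norm (obs_dir qo i q - obs_dir qo j q))\<^sup>2 \<le> (c0 - \<kappa>)\<^sup>2" using \<Delta>(4) by linarith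
    then show "norm (obs_dir qo i q - obs_dir qo j q) \<le> c0 - \<kappa>"
      by (rule power2_le_imp_le) (use \<kappa> in simp)
  qed
qed

text \<open>On the basis vectors within the cone \<open>c0 \<le> l \<bullet> u\<close> around the
  obstacle direction \<open>\<phi>\<close> vanishes, so their constraints see the true distance
  \<open>obs_h\<close>. These vectors positively generate the direction, hence the velocity towards
  the obstacle inherits the bound.\<close>

lemma obs_dir_inner_feasible_le:
  fixes S :: "(real^'n) set"
  assumes S: "positive_basis c0 S" and c0: "0 < c0" "c0 < 1" and ab: "a > 0" "b > 0" and dr: "0 < dr"
    and \<phi>: "\<And>s. s \<in> {c0..1} \<Longrightarrow> \<phi> s = 0" and i: "i \<in> {1..N}" and q: "q \<noteq> qo i"
    and v: "v \<in> qp_feasible (two_slope a b) c0 dr vbar S (r_fun N qo ds \<phi> q)"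
  shows "obs_dir qo i q \<bullet> v \<le> a * max 0 (obs_h qo ds i q) - dr"
proof -
  let ?u = "obs_dir qo i q" and ?h = "obs_h qo ds i q"
  define x where "x = c0 * two_slope a b ?h - dr"
  have "?u \<bullet> v \<le> max x (x / c0)"
  proof (rule positive_basis_inner_le[OF S c0(1) norm_obs_dir[of q qo i, OF q]])
    fix l assume l: "l \<in> S" "c0 \<le> l \<bullet> ?u"
    have "norm l = 1" using S l by (simp add: positive_basis_def)
    with inner_obs_dir_bounds[of q qo i l, OF q] l have "\<phi> (?u \<bullet> l) = 0" by (intro \<phi>) (auto simp: inner_commute)
    with r_fun_le[OF i, of qo ds \<phi> q l] have "r_fun N qo ds \<phi> q l \<le> ?h" by simp
    then have "two_slope a b (r_fun N qo ds \<phi> q l) \<le> two_slope a b ?h"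
      using strict_mono_less_eq[OF two_slope_strict_mono[OF ab]] by simp
    with c0 have "c0 * two_slope a b (r_fun N qo ds \<phi> q l) \<le> c0 * two_slope a b ?h" by simp
    moreover have "l \<bullet> v \<le> c0 * two_slope a b (r_fun N qo ds \<phi> q l) - dr"
      using v l by (simp add: qp_feasible_def)
    ultimately show "l \<bullet> v \<le> x" by (simp add: x_def)
  qed
  \<comment> \<open>Both entries are at most \<open>a * max 0 ?h - dr\<close>: dividing by
    \<open>c0 < 1\<close> enlarges the margin \<open>dr\<close>, and multiplying by
    \<open>c0\<close> lowers the nonnegative part.\<close>
  also have "max x (x / c0) \<le> a * max 0 ?h - dr"
  proof -
    define y where "y = a * max 0 ?h"
    have y: "0 \<le> y" "two_slope a b ?h \<le> y"
      using ab by (cases "?h \<ge> 0"; simp add: y_def mult_nonneg_nonpos)+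
    then have "c0 * two_slope a b ?h \<le> c0 * y" using c0 by simp
    moreover have "c0 * y \<le> y" using y c0 by (simp add: mult_left_le_one_le)
    ultimately have "x \<le> y - dr" unfolding x_def by linarith
    moreover have "x / c0 = two_slope a b ?h - dr / c0" using c0 by (simp add: x_def diff_divide_distrib)
    moreover have "dr \<le> dr / c0" using dr c0 by (simp add: field_simps)
    ultimately show ?thesis using y(2) by (simp add: y_def[symmetric])
  qed
  finally show ?thesis .
qed

section \<open>Decrease of the Lyapunov function\<close>

text \<open>\<open>c\<close> is the offset subtracted in the energy component, and
  \<open>\<epsilon>\<close> is the error at which damping and drift balance. At \<open>W = 0\<close>
  the bound \<open>\<mu>1\<close> on \<open>M\<close> then gives an error below \<open>dr\<close>,
  and the bound \<open>\<mu>2\<close> gives an error above \<open>\<epsilon>\<close> if the energy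
  is active.\<close>

lemma gain_margins:
  fixes \<mu>1 \<mu>2 L D dr kD n :: real
  assumes \<mu>: "0 < \<mu>1" "\<mu>1 \<le> \<mu>2" and L: "0 < L" and D: "0 < D" and dr: "0 < dr" and n: "1 \<le> n"
    and kD: "2 * n * L * (\<mu>2 ^ 3 * (D + dr) / (\<mu>1\<^sup>2 * dr)) < kD"
  defines "c \<equiv> n * L * \<mu>1 * \<mu>2\<^sup>2 * D * dr / (\<mu>1 * kD - 2 * n * L * \<mu>2\<^sup>2)"
    and "\<epsilon> \<equiv> \<mu>2 * L * D / (kD - \<mu>2 * L)"
  shows "0 < c" "2 * c < \<mu>1 * dr\<^sup>2" "\<mu>2 * L < kD" "\<mu>2 * \<epsilon>\<^sup>2 < 2 * c"
proof -
  define G where "G = \<mu>1 * kD - 2 * n * L * \<mu>2\<^sup>2"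
  have pos: "0 < \<mu>2" "0 < n" using \<mu> n by auto
  have "2 * n * L * (\<mu>2 ^ 3 * (D + dr)) < kD * (\<mu>1\<^sup>2 * dr)"
    using kD \<mu> dr by (simp add: pos_divide_less_eq)
  \<comment> \<open>Trading one factor \<open>\<mu>2\<close> for \<open>\<mu>1\<close> lets the
    condition on \<open>kD\<close> be stated through the denominator \<open>G\<close> of
    \<open>c\<close>, as \<open>2 * n * L * \<mu>2\<^sup>2 * D < G * dr\<close>.\<close>
  moreover have "2 * n * L * (\<mu>2\<^sup>2 * \<mu>1 * (D + dr)) \<le> 2 * n * L * (\<mu>2 ^ 3 * (D + dr))"
    using \<mu> pos L D dr by (intro mult_left_mono mult_right_mono) (auto simp: power3_eq_cube power2_eq_square)
  ultimately have "\<mu>1 * (2 * n * L * \<mu>2\<^sup>2 * (D + dr)) < \<mu>1 * (kD * \<mu>1 * dr)"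
    by (simp add: power2_eq_square mult_ac)
  then have "2 * n * L * \<mu>2\<^sup>2 * (D + dr) < kD * \<mu>1 * dr" using \<mu>(1) by simp
  then have G: "2 * n * L * \<mu>2\<^sup>2 * D < G * dr" by (simp add: G_def algebra_simps)
  have "0 < 2 * n * L * \<mu>2\<^sup>2 * D" using pos L D by simp
  with G have "0 < G * dr" by linarith
  with dr have G0: "0 < G" by (simp add: zero_less_mult_iff)
  have cG: "c = n * L * \<mu>1 * \<mu>2\<^sup>2 * D * dr / G" by (simp add: c_def G_def)
  show "0 < c" unfolding cG using pos \<mu> L D dr G0 by simp
  have "2 * (n * L * \<mu>1 * \<mu>2\<^sup>2 * D * dr) = \<mu>1 * dr * (2 * n * L * \<mu>2\<^sup>2 * D)" by simp
  also have "\<dots> < \<mu>1 * dr * (G * dr)" using G \<mu> dr by (intro mult_strict_left_mono) auto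
  finally show "2 * c < \<mu>1 * dr\<^sup>2" unfolding cG using G0
    by (simp add: pos_divide_less_eq power2_eq_square mult_ac)
  have "\<mu>1 * (\<mu>2 * L) \<le> \<mu>2 * (\<mu>2 * L)" using \<mu> L pos by (intro mult_right_mono) auto
  also have "\<dots> = 1 * (L * \<mu>2\<^sup>2)" by (simp add: power2_eq_square)
  also have "\<dots> \<le> (2 * n) * (L * \<mu>2\<^sup>2)" using n L by (intro mult_right_mono) auto
  finally have Gk: "G \<le> \<mu>1 * (kD - \<mu>2 * L)" by (simp add: G_def algebra_simps)
  with G0 have "0 < \<mu>1 * (kD - \<mu>2 * L)" by linarith
  with \<mu> show k: "\<mu>2 * L < kD" by (simp add: zero_less_mult_iff)
  \<comment> \<open>\<open>Gk\<close> brings \<open>\<epsilon>\<close> onto the denominator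
    \<open>G\<close> of \<open>c\<close>, which makes the two comparable.\<close>
  have "\<epsilon> = \<mu>1 * (\<mu>2 * L * D) / (\<mu>1 * (kD - \<mu>2 * L))" using \<mu> by (simp add: \<epsilon>_def)
  also have "\<dots> \<le> \<mu>1 * (\<mu>2 * L * D) / G"
    using Gk G0 \<mu> pos L D by (intro divide_left_mono) auto
  finally have \<epsilon>: "\<epsilon> \<le> \<mu>1 * \<mu>2 * L * D / G" by simp
  moreover have "0 \<le> \<epsilon>" using k pos L D by (simp add: \<epsilon>_def)
  ultimately have "\<epsilon>\<^sup>2 \<le> (\<mu>1 * \<mu>2 * L * D / G)\<^sup>2" by (intro power_mono)
  then have "\<mu>2 * \<epsilon>\<^sup>2 \<le> \<mu>2 * (\<mu>1 * \<mu>2 * L * D / G)\<^sup>2" using pos by simp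
  also have "\<dots> = (\<mu>1 * L * \<mu>2\<^sup>2 * D / G) * (\<mu>1 * \<mu>2 * L * D / G)"
    by (simp add: power2_eq_square)
  also have "\<dots> < (\<mu>1 * L * \<mu>2\<^sup>2 * D / G) * (2 * n * dr)"
  proof (rule mult_strict_left_mono)
    have "\<mu>1 * (\<mu>2 * L * D) \<le> \<mu>2 * (\<mu>2 * L * D)" using \<mu> pos L D by (intro mult_right_mono) auto
    also have "\<dots> = 1 * (L * \<mu>2\<^sup>2 * D)" by (simp add: power2_eq_square)
    also have "\<dots> \<le> (2 * n) * (L * \<mu>2\<^sup>2 * D)" using n L D by (intro mult_right_mono) auto
    also have "\<dots> < G * dr" using G by (simp add: mult_ac)
    also have "\<dots> \<le> (2 * n) * (G * dr)" using n G0 dr by simp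
    finally show "\<mu>1 * \<mu>2 * L * D / G < 2 * n * dr" using G0 by (simp add: pos_divide_less_eq mult_ac)
  qed (use \<mu> pos L D G0 in simp)
  also have "\<dots> = 2 * c" by (simp add: cG)
  finally show "\<mu>2 * \<epsilon>\<^sup>2 < 2 * c" .
qed

text \<open>The two implications are the decrease conditions for an active obstacle function and for the
  active energy, with \<open>w\<close> the value of \<open>W\<close> and \<open>x\<close> the norm of the velocity error.\<close>

lemma decay_rate_exists:
  fixes \<mu>1 \<mu>2 L D dr kD n a \<Delta> :: real
  assumes \<mu>: "0 < \<mu>1" "\<mu>1 \<le> \<mu>2" and L: "0 < L" and D: "0 < D" and dr: "0 < dr" and n: "1 \<le> n"
    and kD: "2 * n * L * (\<mu>2 ^ 3 * (D + dr) / (\<mu>1\<^sup>2 * dr)) < kD" and a: "0 < a" and \<Delta>: "0 < \<Delta>"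
  defines "c \<equiv> n * L * \<mu>1 * \<mu>2\<^sup>2 * D * dr / (\<mu>1 * kD - 2 * n * L * \<mu>2\<^sup>2)"
  obtains p s dw where "0 < p" "0 < s" "0 < dw" "dw < \<Delta>"
    "\<And>w x. w \<le> dw \<Longrightarrow> 0 \<le> x \<Longrightarrow> \<mu>1 * x\<^sup>2 \<le> 2 * (w + c) \<Longrightarrow> a * max 0 (- w) - dr + x \<le> - two_slope p s w"
    "\<And>w x. w \<le> dw \<Longrightarrow> 0 \<le> x \<Longrightarrow> 2 * (w + c) \<le> \<mu>2 * x\<^sup>2 \<Longrightarrow>
      - kD * x\<^sup>2 + L * (x + D) * (\<mu>2 * x) \<le> - two_slope p s w"
proof -
  define \<epsilon> where "\<epsilon> = \<mu>2 * L * D / (kD - \<mu>2 * L)"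
  note G = gain_margins[OF \<mu> L D dr n kD, folded c_def, folded \<epsilon>_def]
  have pos: "0 < \<mu>2" using \<mu> by simp
  define k where "k = kD - \<mu>2 * L"
  have k: "0 < k" using G(3) by (simp add: k_def)
  have k\<epsilon>: "k * \<epsilon> = \<mu>2 * L * D" using k by (simp add: \<epsilon>_def k_def)
  have \<epsilon>: "0 < \<epsilon>" using k pos L D by (simp add: \<epsilon>_def k_def)
  \<comment> \<open>The energy rate is a quadratic in \<open>x\<close> with roots \<open>0\<close>
    and \<open>\<epsilon>\<close>: beyond \<open>\<epsilon>\<close> damping wins.\<close>
  have quad: "- kD * x\<^sup>2 + L * (x + D) * (\<mu>2 * x) = - (k * x * (x - \<epsilon>))" for x
  proof -
    have "k * x * (x - \<epsilon>) = k * x * x - (k * \<epsilon>) * x" by (simp add: algebra_simps)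
    then show ?thesis unfolding k\<epsilon> by (simp add: k_def power2_eq_square algebra_simps)
  qed
  \<comment> \<open>\<open>r0\<close> is the largest error that the first implication admits at
    \<open>w = 0\<close>; an \<open>r\<close> strictly between \<open>r0\<close> and
    \<open>dr\<close> also bounds the error at small positive levels.\<close>
  define r0 where "r0 = sqrt (2 * c / \<mu>1)"
  have "2 * c / \<mu>1 < dr\<^sup>2" using G(2) \<mu> by (simp add: pos_divide_less_eq mult.commute)
  then have "r0 < dr" unfolding r0_def using dr by (intro real_less_lsqrt) auto
  then obtain r where r: "r0 < r" "r < dr" using dense by blast
  have r00: "0 \<le> r0" unfolding r0_def using G(1) \<mu> by simp
  have "r0\<^sup>2 < r\<^sup>2" using r r00 by (intro power_strict_mono) auto
  then have rc: "2 * c < \<mu>1 * r\<^sup>2" using G(1) \<mu> by (simp add: r0_def pos_divide_less_eq mult.commute)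
  \<comment> \<open>\<open>x1\<close> is the smallest error that the second implication admits at
    \<open>w = 0\<close>.\<close>
  define x1 where "x1 = sqrt (2 * c / \<mu>2)"
  have "\<epsilon>\<^sup>2 < 2 * c / \<mu>2" using G(4) pos by (simp add: pos_less_divide_eq mult.commute)
  then have x1: "\<epsilon> < x1" unfolding x1_def by (rule real_less_rsqrt)
  define m where "m = min (dr - r) (k * x1 * (x1 - \<epsilon>))"
  have m: "0 < m" unfolding m_def using r k \<epsilon> x1 by simp
  \<comment> \<open>Above the level \<open>- w0\<close> an active energy already forces
    \<open>x \<ge> \<epsilon>\<close>, so a positive energy rate can occur only for
    \<open>- w \<ge> w0\<close>.\<close>
  define w0 where "w0 = c - \<mu>2 * \<epsilon>\<^sup>2 / 2"
  have w0: "0 < w0" using G(4) by (simp add: w0_def)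
  define dw where "dw = min (\<mu>1 * r\<^sup>2 / 2 - c) (\<Delta> / 2)"
  have dw: "0 < dw" using rc \<Delta> by (simp add: dw_def)
  \<comment> \<open>The margin \<open>m\<close>, common to both implications for
    \<open>w \<ge> 0\<close>, is spread over \<open>[0, dw]\<close>. For \<open>w < 0\<close> the
    slope \<open>a\<close> pays for the approach speed that an obstacle constraint permits at
    distance \<open>- w\<close>, and \<open>k * \<epsilon> * \<epsilon> / w0\<close> pays for the
    bound \<open>k * \<epsilon> * \<epsilon>\<close> on the positive energy rate.\<close>
  define p where "p = m / dw"
  define s where "s = max a (k * \<epsilon> * \<epsilon> / w0)"
  have p: "0 < p" and s: "0 < s" using m dw a by (auto simp: p_def s_def)
  have pw: "- m \<le> - two_slope p s w" if "0 \<le> w" "w \<le> dw" for w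
  proof -
    have "p * w \<le> p * dw" using that p by simp
    then show ?thesis using that dw by (simp add: p_def)
  qed
  show thesis
  proof (rule that[OF p s dw])
    show "dw < \<Delta>" using \<Delta> by (simp add: dw_def min_def)
  next
    fix w x :: real assume w: "w \<le> dw" and x: "0 \<le> x" and le: "\<mu>1 * x\<^sup>2 \<le> 2 * (w + c)"
    have "\<mu>1 * x\<^sup>2 \<le> \<mu>1 * r\<^sup>2" using le w by (simp add: dw_def)
    then have "x\<^sup>2 \<le> r\<^sup>2" using \<mu> by simp
    then have "x \<le> r" by (rule power2_le_imp_le) (use r r00 in simp)
    show "a * max 0 (- w) - dr + x \<le> - two_slope p s w"
    proof (cases "0 \<le> w")
      case True
      with \<open>x \<le> r\<close> have "a * max 0 (- w) - dr + x \<le> - m" by (simp add: m_def)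
      also have "\<dots> \<le> - two_slope p s w" using True w by (rule pw)
      finally show ?thesis .
    next
      case False
      then have le: "a * (- w) \<le> s * (- w)" by (intro mult_right_mono) (auto simp: s_def)
      have eq: "two_slope p s w = s * w" "max 0 (- w) = - w" using False by auto
      show ?thesis unfolding eq using le \<open>x \<le> r\<close> r by linarith
    qed
  next
    fix w x :: real assume w: "w \<le> dw" and x: "0 \<le> x" and le: "2 * (w + c) \<le> \<mu>2 * x\<^sup>2"
    show "- kD * x\<^sup>2 + L * (x + D) * (\<mu>2 * x) \<le> - two_slope p s w"
    proof (cases "0 \<le> w")
      case True
      with le have "2 * c / \<mu>2 \<le> x\<^sup>2" using pos by (simp add: pos_divide_le_eq mult.commute)
      then have "x1 \<le> x" unfolding x1_def using x by (intro real_le_lsqrt) auto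
      then have "k * x1 * (x1 - \<epsilon>) \<le> k * x * (x - \<epsilon>)"
        using k \<epsilon> x1 by (intro mult_mono mult_left_mono) auto
      then have "- (k * x * (x - \<epsilon>)) \<le> - m" by (simp add: m_def)
      also have "\<dots> \<le> - two_slope p s w" using True w by (rule pw)
      finally show ?thesis unfolding quad .
    next
      case False
      have "- (k * x * (x - \<epsilon>)) \<le> s * (- w)"
      proof (cases "\<epsilon> \<le> x")
        case True
        then have "0 \<le> k * x * (x - \<epsilon>)" using k x by simp
        moreover have "0 \<le> s * (- w)" using s False by (intro mult_nonneg_nonneg) auto
        ultimately show ?thesis by linarith
      next
        case x\<epsilon>: False
        have "\<mu>2 * x\<^sup>2 \<le> \<mu>2 * \<epsilon>\<^sup>2" using x x\<epsilon> pos by (intro mult_left_mono power_mono) auto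
        with le have "w0 \<le> - w" by (simp add: w0_def)
        have "- (k * x * (x - \<epsilon>)) = k * x * (\<epsilon> - x)" by (simp add: algebra_simps)
        also have "\<dots> \<le> k * \<epsilon> * \<epsilon>" using k x x\<epsilon> \<epsilon> by (intro mult_mono mult_left_mono) auto
        also have "\<dots> = k * \<epsilon> * \<epsilon> / w0 * w0" using w0 by simp
        also have "\<dots> \<le> s * (- w)"
          using \<open>w0 \<le> - w\<close> w0 s by (intro mult_mono) (auto simp: s_def)
        finally show ?thesis .
      qed
      with False show ?thesis unfolding quad by simp
    qed
  qed
qed

text \<open>Separates the nonsmooth and matrix analysis from the scalar estimates: only
  \<open>norm e\<close> and the value of \<open>W\<close> enter \<open>obs\<close> and
  \<open>energy\<close>, and \<open>y\<close> stands for the later \<open>- \<alpha>w\<close>. The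
  error can be bounded in \<open>obs\<close> because the energy component lies below
  \<open>W\<close> even when an obstacle is active.\<close>

lemma W_fun_decrease:
  fixes M :: "real^'n \<Rightarrow> real^'n^'n" and q qd vc qdd vc' :: "real^'n"
  assumes EL: "el_assumption M C Nv \<mu>1 \<mu>2"
    and \<Delta>: "\<And>i. i \<in> {1..N} \<Longrightarrow> \<Delta> < ds i" and L: "0 \<le> L"
    and lip: "\<And>q1 q2 vc1 vc2. \<forall>i\<in>{1..N}. - \<Delta> \<le> min (obs_h qo ds i q1) (obs_h qo ds i q2) \<Longrightarrow>
      norm (vp q1 vc1 - vp q2 vc2) \<le> L * (norm (q1 - q2) + norm (vc1 - vc2))"
    and c: "c = real CARD('n) * L * \<mu>1 * \<mu>2\<^sup>2 * (vcd + vbar - dr) * dr / (\<mu>1 * kD - 2 * real CARD('n) * L * \<mu>2\<^sup>2)"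
    and vp: "norm (vp q vc) \<le> vbar - dr"
      "\<And>i. i \<in> {1..N} \<Longrightarrow> obs_dir qo i q \<bullet> vp q vc \<le> a * max 0 (obs_h qo ds i q) - dr"
    and vc': "norm vc' \<le> vcd"
    and dyn: "el_dynamics M C Nv q qd qdd (inner_loop C Nv kD q qd (vp q vc))"
  defines "W \<equiv> W_fun N qo ds M \<mu>1 \<mu>2 vcd vbar dr kD L vp"
  assumes W\<Delta>: "W (q, qd, vc) < \<Delta>"
    and obs: "\<And>x. 0 \<le> x \<Longrightarrow> \<mu>1 * x\<^sup>2 \<le> 2 * (W (q, qd, vc) + c) \<Longrightarrow>
      a * max 0 (- W (q, qd, vc)) - dr + x \<le> y"
    and energy: "\<And>x. 0 \<le> x \<Longrightarrow> 2 * (W (q, qd, vc) + c) \<le> \<mu>2 * x\<^sup>2 \<Longrightarrow>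
      - kD * x\<^sup>2 + L * (x + (vcd + vbar - dr)) * (\<mu>2 * x) \<le> y"
    and \<delta>: "\<delta> \<in> clarke_gradient W (q, qd, vc)"
  shows "\<delta> \<bullet> (qd, qdd, vc') \<le> y"
proof -
  define Wi where "Wi = W_comp N qo ds M \<mu>1 \<mu>2 vcd vbar dr kD L vp"
  define e where "e = qd - vp q vc"
  have W: "W = (\<lambda>x. Max ((\<lambda>i. Wi i x) ` {1..N + 1}))" by (simp add: W_def W_fun_def[abs_def] Wi_def)
  have Wi_obs: "Wi i = (\<lambda>(q, qd, vc). - obs_h qo ds i q)" if "i \<in> {1..N}" for i
    using that by (auto simp: Wi_def W_comp_def)
  have Wi_en: "Wi (N + 1) = (\<lambda>(q, qd, vc). - c + 1 / 2 * ((qd - vp q vc) \<bullet> (M q *v (qd - vp q vc))))"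
    by (auto simp: Wi_def W_comp_def c)
  have Wi_le: "Wi i (q, qd, vc) \<le> W (q, qd, vc)" if "i \<in> {1..N + 1}" for i
    unfolding W using that by (intro Max_ge) auto
  \<comment> \<open>\<open>W < \<Delta>\<close> bounds every \<open>- obs_h\<close>, so
    \<open>q\<close> lies in this open set and the Lipschitz bound holds at all nearby points that
    the Clarke derivative compares.\<close>
  define U where "U = {q. \<forall>i\<in>{1..N}. - \<Delta> < obs_h qo ds i q}"
  have "U = (\<Inter>i\<in>{1..N}. {q. - \<Delta> < obs_h qo ds i q})" by (auto simp: U_def)
  then have U: "open U"
    unfolding obs_h_def by (auto intro!: open_INT open_Collect_less continuous_intros)
  have qU: "q \<in> U"
    unfolding U_def
  proof safe
    fix i assume i: "i \<in> {1..N}"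
    with Wi_le[of i] W\<Delta> show "- \<Delta> < obs_h qo ds i q" by (simp add: Wi_obs)
  qed
  have qne: "q \<noteq> qo i" if "i \<in> {1..N}" for i
  proof -
    have "- \<Delta> < obs_h qo ds i q" using qU that by (auto simp: U_def)
    with \<Delta>[OF that] show ?thesis by (auto simp: obs_h_def)
  qed
  obtain M' where M': "\<And>q. (M has_derivative blinfun_apply (M' q)) (at q)" "continuous_on UNIV M'"
    using EL by (auto simp: el_assumption_def continuously_differentiable_def)
  have sym: "\<And>q. transpose (M q) = M q" and \<mu>1: "\<mu>1 > 0" using EL by (auto simp: el_assumption_def)
  have lipU: "norm (vp q1 c1 - vp q2 c2) \<le> L * (norm (q1 - q2) + norm (c1 - c2))"
    if "q1 \<in> U" "q2 \<in> U" for q1 q2 c1 c2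
    using that by (intro lip) (auto simp: U_def less_imp_le)
  have kin: "clarke_dd (\<lambda>(q, qd, vc). - c + 1 / 2 * ((qd - vp q vc) \<bullet> (M q *v (qd - vp q vc))))
      (q, qd, vc) (qd, qdd, vc') \<le>
      ereal (1 / 2 * (e \<bullet> (M' q qd *v e)) + (M q *v e) \<bullet> qdd + L * (norm qd + norm vc') * norm (M q *v e))"
    unfolding e_def by (rule clarke_dd_kinetic_le(2)[OF M' sym U qU L]) (rule lipU)
  have en: "- c + 1 / 2 * (e \<bullet> (M q *v e)) = Wi (N + 1) (q, qd, vc)" unfolding Wi_en e_def by simp
  have "clarke_dd W (q, qd, vc) (qd, qdd, vc') \<le> ereal y"
    unfolding W
  proof (rule clarke_dd_Max_le)
    fix i assume i: "i \<in> {1..N + 1}"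
    show "isCont (Wi i) (q, qd, vc)"
    proof (cases "i = N + 1")
      case True
      show ?thesis unfolding True Wi_en
        by (rule clarke_dd_kinetic_le(1)[OF M' sym U qU L]) (rule lipU)
    next
      case False
      with i have "Wi i = (\<lambda>x. - (norm (qo i - fst x) - ds i))" by (auto simp: Wi_obs obs_h_def)
      then show ?thesis by (auto intro!: continuous_intros)
    qed
    assume "Wi i (q, qd, vc) = Max ((\<lambda>i. Wi i (q, qd, vc)) ` {1..N + 1})"
    then have act: "W (q, qd, vc) = Wi i (q, qd, vc)" by (simp add: W)
    show "clarke_dd (Wi i) (q, qd, vc) (qd, qdd, vc') \<le> ereal y"
    proof (cases "i = N + 1")
      case False
      with i have i: "i \<in> {1..N}" by auto
      have "obs_dir qo i q \<bullet> qd = obs_dir qo i q \<bullet> vp q vc + obs_dir qo i q \<bullet> e"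
        by (simp add: e_def inner_diff_right)
      also have "\<dots> \<le> a * max 0 (obs_h qo ds i q) - dr + norm e"
        using norm_cauchy_schwarz[of "obs_dir qo i q" e] norm_obs_dir[of q qo i, OF qne[OF i]] vp(2)[OF i]
        by simp
      also have "obs_h qo ds i q = - W (q, qd, vc)" by (simp add: act Wi_obs[OF i])
      also have "a * max 0 (- W (q, qd, vc)) - dr + norm e \<le> y"
      proof (rule obs)
        have "- c + 1 / 2 * (e \<bullet> (M q *v e)) \<le> W (q, qd, vc)" unfolding en by (rule Wi_le) simp
        then have "e \<bullet> (M q *v e) \<le> 2 * (W (q, qd, vc) + c)" by simp
        with el_assumption_inner_bounds(1)[OF EL, of e q] show "\<mu>1 * (norm e)\<^sup>2 \<le> 2 * (W (q, qd, vc) + c)"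
          by (rule order_trans)
      qed simp
      finally have "ereal (obs_dir qo i q \<bullet> qd) \<le> ereal y" by simp
      with clarke_dd_obs_h_le[of q qo i ds "(qd, vc)" qd "(qdd, vc')", OF qne[OF i]] show ?thesis
        unfolding Wi_obs[OF i] by (rule order_trans)
    next
      case True
      \<comment> \<open>The inner loop cancels \<open>Nv\<close> and turns \<open>C\<close> into a
        term in the error. Its form cancels half the form of \<open>M_dot\<close>, leaving
        \<open>- kD * (norm e)\<^sup>2\<close> and the drift.\<close>
      have "M q *v qdd = - (C q qd *v e) - kD *\<^sub>R e"
        using dyn by (simp add: el_dynamics_def inner_loop_def e_def matrix_vector_mult_diff_distrib algebra_simps)
      then have "(M q *v e) \<bullet> qdd = - (e \<bullet> (C q qd *v e)) - kD * (norm e)\<^sup>2"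
        using inner_matrix_symmetric[OF sym, of e q qdd]
        by (simp add: inner_diff_right power2_norm_eq_inner)
      moreover have "1 / 2 * (e \<bullet> (M' q qd *v e)) = e \<bullet> (C q qd *v e)"
        using el_assumption_M_dot_inner[OF EL, of e q qd] by (simp add: M_dot_eq_derivative[OF M'(1)])
      moreover have "L * (norm qd + norm vc') * norm (M q *v e) \<le>
          L * (norm e + (vcd + vbar - dr)) * (\<mu>2 * norm e)"
      proof (intro mult_mono mult_left_mono L)
        have "norm qd \<le> norm e + norm (vp q vc)" using norm_triangle_ineq[of e "vp q vc"] by (simp add: e_def)
        with vp vc' show "norm qd + norm vc' \<le> norm e + (vcd + vbar - dr)" by linarith
        show "norm (M q *v e) \<le> \<mu>2 * norm e" by (rule el_assumption_inner_bounds(3)[OF EL])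
        have "0 \<le> norm (vp q vc)" "0 \<le> norm vc'" by auto
        with vp vc' have "0 \<le> vcd + vbar - dr" by linarith
        then show "0 \<le> L * (norm e + (vcd + vbar - dr))" using L by simp
      qed auto
      moreover have "- kD * (norm e)\<^sup>2 + L * (norm e + (vcd + vbar - dr)) * (\<mu>2 * norm e) \<le> y"
      proof (rule energy)
        show "2 * (W (q, qd, vc) + c) \<le> \<mu>2 * (norm e)\<^sup>2"
          using el_assumption_inner_bounds(2)[OF EL, of e q] en act True by simp
      qed simp
      ultimately have "1 / 2 * (e \<bullet> (M' q qd *v e)) + (M q *v e) \<bullet> qdd + L * (norm qd + norm vc') * norm (M q *v e) \<le> y"
        by linarith
      then have "ereal (1 / 2 * (e \<bullet> (M' q qd *v e)) + (M q *v e) \<bullet> qdd +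
          L * (norm qd + norm vc') * norm (M q *v e)) \<le> ereal y"
        by (simp only: ereal_less_eq)
      with kin show ?thesis unfolding True Wi_en by (rule order_trans)
    qed
  qed auto
  then show ?thesis using \<delta> by (rule clarke_gradient_inner_le)
qed

section \<open>Choice of the constants\<close>

text \<open>Isolating \<open>sqrt (c + e)\<close> and squaring turns the claim into
  \<open>2 * sqrt c < 1 - e\<close>, the root of the last hypothesis. It leaves room for
  \<open>c0\<close> below \<open>1\<close>.\<close>

lemma sqrt_add_sqrt_less_one:
  fixes c e :: real
  assumes "0 \<le> c" "0 < e" "e < 1" "4 * c < (1 - e)\<^sup>2"
  shows "sqrt c + sqrt (c + e) < 1"
proof -
  have "c < ((1 - e) / 2)\<^sup>2" using assms by (simp add: power_divide)
  then have s: "sqrt c < (1 - e) / 2" using assms by (intro real_less_lsqrt) auto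
  have "c + e < (1 - sqrt c)\<^sup>2" using s assms by (simp add: power2_diff)
  moreover have "(1 - e)\<^sup>2 \<le> 1" using assms by (intro power_le_one) auto
  then have "4 * c < 1" by (rule less_le_trans[OF assms(4)])
  ultimately have "sqrt (c + e) < 1 - sqrt c" using assms by (intro real_less_lsqrt) auto
  then show ?thesis by simp
qed

text \<open>Reveals \<open>c_star\<close> as a quarter of the bound in
  \<open>obs_dir_diff_square_le\<close> at \<open>\<Delta> = 0\<close>, so that
  \<open>2 * sqrt cs\<close> bounds the chord between near directions.\<close>

lemma four_c_star:
  assumes "0 < dsmax + db / 2"
  shows "4 * c_star dsmin dsmax da db = 2 - (2 * dsmin\<^sup>2 - da\<^sup>2) / (dsmax + db / 2)\<^sup>2"
proof -
  define R where "R = dsmax + db / 2"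
  have R: "R > 0" using assms by (simp add: R_def)
  have "2 * dsmax + db = 2 * R" by (simp add: R_def)
  then show ?thesis unfolding c_star_def R_def[symmetric] using R
    by (simp add: field_simps power_mult_distrib)
qed

theorem theorem1:
  fixes M :: "real^'n \<Rightarrow> real^'n^'n"
    and C :: "real^'n \<Rightarrow> real^'n \<Rightarrow> real^'n^'n"
    and Nv :: "real^'n \<Rightarrow> real^'n \<Rightarrow> real^'n"
    and \<mu>1 \<mu>2 :: real
    and vcom :: "real \<Rightarrow> real^'n" and vcbar vcd :: real
    and N :: nat and qo :: "nat \<Rightarrow> real^'n" and ds :: "nat \<Rightarrow> real"
    and da db dh vbar dr dsmin dsmax cs \<kappa> :: real
  assumes EL: "el_assumption M C Nv \<mu>1 \<mu>2"
    and vc_bounds: "vcbar > 0" "vcd > 0"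
    and vcom: "\<forall>t\<ge>0. norm (vcom t) \<le> vcbar \<and>
                 vcom differentiable (at t within {0..}) \<and>
                 norm (vector_derivative vcom (at t within {0..})) \<le> vcd"
    and obstacles: "N \<ge> 1" "\<forall>i\<in>{1..N}. ds i > 0"
    and dist: "obs_distance_assumption N qo ds da db dh"
    and v_pos: "vbar > 0" "dr > 0"
    and dsmin: "dsmin = ds_min N ds"
    and dsmax: "dsmax = ds_max N ds"
    and cond1: "sqrt 2 * dsmin > da"
    and cond2: "vbar > 2 * dr"
    and cond3: "(2 * dsmin\<^sup>2 - da\<^sup>2) / (2 * (dsmax + db / 2)\<^sup>2)
                  > 1 - (vbar - 2 * dr)\<^sup>2 / (2 * (vbar - dr)\<^sup>2)"
    and cs: "cs = c_star dsmin dsmax da db"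
    and \<kappa>: "\<kappa> = kappa cs dr vbar"
  shows "\<exists>(\<phi> :: real \<Rightarrow> real) (c0 :: real) (\<alpha>c :: real \<Rightarrow> real).
     lipschitz_fun_on {-1..1} \<phi> \<and> (\<forall>s\<in>{-1..1}. \<phi> s \<ge> 0) \<and> antimono_on {-1..1} \<phi> \<and>
     0 < c0 \<and> c0 < 1 \<and>
     class_Ke \<alpha>c \<and> lipschitz_fun_on UNIV \<alpha>c \<and> bij \<alpha>c \<and> lipschitz_fun_on UNIV (inv \<alpha>c) \<and>
     c0 > sqrt cs + sqrt (cs + dr / (vbar - dr)) \<and>
     c0 * (vbar - dr) \<ge> c0 * \<alpha>c (db / 2) - dr \<and>
     c0 * \<alpha>c (db / 2) - dr > (dr - c0 * \<alpha>c (- dh)) / \<kappa> \<and>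
     (\<forall>s\<in>{-1..<c0}. \<phi> s > phi_lower_bound \<alpha>c c0 \<kappa> vbar dr dh s) \<and>
     (\<forall>s\<in>{c0..1}. \<phi> s = 0) \<and>
     (\<forall>\<L> :: (real^'n) set. positive_basis c0 \<L> \<longrightarrow>
       (let vp = varphi N qo ds \<phi> \<alpha>c c0 dr vbar \<L>;
            vp_defined = varphi_defined N qo ds \<phi> \<alpha>c c0 dr vbar \<L>
        in \<exists>\<Delta>h L :: real. \<Delta>h > 0 \<and> L > 0 \<and>
          (\<forall>q vc. (\<forall>i\<in>{1..N}. obs_h qo ds i q \<ge> - \<Delta>h) \<longrightarrow> vp_defined q vc) \<and>
          (\<forall>q1 q2 vc1 vc2.
             (\<forall>i\<in>{1..N}. min (obs_h qo ds i q1) (obs_h qo ds i q2) \<ge> - \<Delta>h) \<longrightarrow>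
             norm (vp q1 vc1 - vp q2 vc2) \<le> L * (norm (q1 - q2) + norm (vc1 - vc2))) \<and>
          (\<forall>kD. kD > 0 \<and>
                kD > 2 * real CARD('n) * L * (\<mu>2 ^ 3 * (vcd + vbar) / (\<mu>1\<^sup>2 * dr)) \<longrightarrow>
             (let W = W_fun N qo ds M \<mu>1 \<mu>2 vcd vbar dr kD L vp
              in \<exists>(\<alpha>w :: real \<Rightarrow> real) dw.
                class_Ke \<alpha>w \<and> lipschitz_fun_on UNIV \<alpha>w \<and> dw > 0 \<and>
                (\<forall>q qd vc qdd vc'.
                   norm vc \<le> vcbar \<and> norm vc' \<le> vcd \<and> vp_defined q vc \<and>
                   el_dynamics M C Nv q qd qdd (inner_loop C Nv kD q qd (vp q vc)) \<and>
                   W (q, qd, vc) \<le> dw \<longrightarrow>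
                   (\<forall>\<delta>\<in>clarke_gradient W (q, qd, vc).
                      \<delta> \<bullet> (qd, qdd, vc') \<le> - \<alpha>w (W (q, qd, vc))))))))"
proof -
  define e where "e = dr / (vbar - dr)"
  define R where "R = dsmax + db / 2"
  have dist': "da > 0" "db > 0" "dh > 0" "da < dsmin" "dh < dsmin"
    using dist by (auto simp: obs_distance_assumption_def dsmin)
  have "dsmin \<le> ds 1" "ds 1 \<le> dsmax" using obstacles(1) by (auto simp: dsmin dsmax ds_min_def ds_max_def)
  then have R: "dsmin < R" "0 < R" using dist' by (auto simp: R_def)
  have d: "vbar - dr > dr" "vbar - dr > 0" using cond2 v_pos by auto
  have e: "0 < e" "e < 1" using d v_pos by (auto simp: e_def)
  have da: "da\<^sup>2 < 2 * dsmin\<^sup>2"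
  proof -
    have "da\<^sup>2 < (sqrt 2 * dsmin)\<^sup>2" using cond1 dist' by (intro power_strict_mono) auto
    then show ?thesis by (simp add: power_mult_distrib)
  qed
  have cs4: "4 * cs = 2 - (2 * dsmin\<^sup>2 - da\<^sup>2) / R\<^sup>2"
    unfolding cs R_def by (rule four_c_star) (use R in \<open>simp add: R_def\<close>)
  have cs0: "0 < cs"
  proof -
    have "dsmin\<^sup>2 < R\<^sup>2" using R dist' by (intro power_strict_mono) auto
    then have "2 * dsmin\<^sup>2 - da\<^sup>2 < 2 * R\<^sup>2" using dist' by (smt (verit) zero_le_power2)
    then have "(2 * dsmin\<^sup>2 - da\<^sup>2) / R\<^sup>2 < 2" using R by (simp add: pos_divide_less_eq)
    with cs4 show ?thesis by linarith
  qed
  \<comment> \<open>This is \<open>cond3\<close> rewritten: its left side is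
    \<open>1 - 2 * cs\<close>, and \<open>(vbar - 2 * dr) / (vbar - dr)\<close> is
    \<open>1 - e\<close>.\<close>
  have cs1: "4 * cs < (1 - e)\<^sup>2"
  proof -
    have "1 - e = (vbar - 2 * dr) / (vbar - dr)" using d by (simp add: e_def field_simps)
    then have "(1 - e)\<^sup>2 = (vbar - 2 * dr)\<^sup>2 / (vbar - dr)\<^sup>2" by (simp add: power_divide)
    with cond3 have "(2 * dsmin\<^sup>2 - da\<^sup>2) / (2 * R\<^sup>2) > 1 - (1 - e)\<^sup>2 / 2"
      unfolding R_def by simp
    then have "(2 * dsmin\<^sup>2 - da\<^sup>2) / R\<^sup>2 / 2 > 1 - (1 - e)\<^sup>2 / 2" by (simp add: mult.commute)
    moreover have "4 * cs < y" if "4 * cs = 2 - x" "x / 2 > 1 - y / 2" for x y using that by linarith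
    ultimately show ?thesis using cs4 by blast
  qed
  have "sqrt cs + sqrt (cs + e) < 1" using cs0 cs1 e by (intro sqrt_add_sqrt_less_one) auto
  then obtain c0 where c0: "sqrt cs + sqrt (cs + e) < c0" "c0 < 1" using dense by blast
  have \<kappa>e: "\<kappa> = sqrt (cs + e) - sqrt cs" by (simp add: \<kappa> kappa_def e_def)
  have sq: "0 < sqrt cs" "sqrt cs < sqrt (cs + e)" using cs0 e by auto
  have \<kappa>0: "0 < \<kappa>" and \<kappa>c: "2 * sqrt cs < c0 - \<kappa>" and c00: "0 < c0" using sq c0 unfolding \<kappa>e by linarith+
  have \<kappa>le: "\<kappa> \<le> c0" using \<kappa>c sq by linarith
  have "\<kappa> * (sqrt cs + sqrt (cs + e)) = (sqrt (cs + e))\<^sup>2 - (sqrt cs)\<^sup>2"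
    by (simp add: \<kappa>e power2_eq_square algebra_simps)
  also have "\<dots> = e" using cs0 e by simp
  finally have "e < \<kappa> * c0" using c0(1) \<kappa>0 by (metis mult_strict_left_mono)
  then have \<kappa>dr: "dr < c0 * (vbar - dr) * \<kappa>" using d by (simp add: e_def pos_divide_less_eq mult_ac)

  \<comment> \<open>\<open>a\<close> makes the bound at distance \<open>db / 2\<close> equal to the
    cap \<open>c0 * (vbar - dr)\<close>. \<open>b\<close> places
    \<open>dr - c0 * \<alpha>c (- dh)\<close> midway between \<open>dr\<close> and
    \<open>c0 * (vbar - dr) * \<kappa>\<close>.\<close>
  define a where "a = (vbar - dr + dr / c0) * (2 / db)"
  define b where "b = (c0 * (vbar - dr) * \<kappa> - dr) / (2 * (c0 * dh))"
  have ab: "a > 0" "b > 0" using d v_pos c00 dist' \<kappa>dr by (auto simp: a_def b_def add_pos_pos)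
  have \<alpha>db: "c0 * two_slope a b (db / 2) - dr = c0 * (vbar - dr)"
    using dist' c00 by (simp add: a_def field_simps)
  have \<alpha>dh: "(dr - c0 * two_slope a b (- dh)) / \<kappa> < c0 * two_slope a b (db / 2) - dr"
  proof -
    have "c0 * two_slope a b (- dh) = - ((c0 * (vbar - dr) * \<kappa> - dr) / 2)"
      using dist' c00 by (simp add: b_def)
    moreover have "dr - z < y" if "z = - ((y - dr) / 2)" "dr < y" for y z using that by (simp add: field_simps)
    ultimately have "dr - c0 * two_slope a b (- dh) < c0 * (vbar - dr) * \<kappa>" using \<kappa>dr by blast
    then show ?thesis unfolding \<alpha>db using \<kappa>0 by (simp add: pos_divide_less_eq)
  qed
  \<comment> \<open>\<open>1 / min a b\<close> converts a rise of \<open>\<alpha>c\<close> into a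
    rise of its argument; the extra \<open>1\<close> makes the lower bound on \<open>\<phi>\<close>
    strict.\<close>
  define B where "B = 1 / min a b * (vbar - dr) + 1"
  have "0 < 1 / min a b * (vbar - dr)" using ab d by (intro mult_pos_pos) auto
  then have B0: "0 < B" by (simp add: B_def)
  define \<phi> where "\<phi> s = B * max 0 (c0 - s)" for s
  have \<phi>0: "\<phi> s = 0" if "s \<in> {c0..1}" for s using that by (simp add: \<phi>_def)
  have \<phi>lip: "B-lipschitz_on T \<phi>" for T unfolding \<phi>_def[abs_def] using B0 by (intro ramp_lipschitz) simp
  have \<phi>lb: "phi_lower_bound (two_slope a b) c0 \<kappa> vbar dr dh s < \<phi> s" if s: "s \<in> {-1..<c0}" for s
  proof -
    have "phi_lower_bound (two_slope a b) c0 \<kappa> vbar dr dh s \<le> 1 / min a b * ((vbar - dr) * (c0 - s))"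
      using \<alpha>dh s dist' unfolding \<alpha>db
      by (intro phi_lower_bound_le two_slope_strict_mono two_slope_bij(1) two_slope_grow ab c00 \<kappa>0 v_pos) auto
    also have "\<dots> < \<phi> s" using s by (simp add: \<phi>_def B_def distrib_right)
    finally show ?thesis .
  qed

  have "(2 * sqrt cs)\<^sup>2 < (c0 - \<kappa>)\<^sup>2" using \<kappa>c sq by (intro power_strict_mono) auto
  then have "2 - (2 * dsmin\<^sup>2 - da\<^sup>2) / R\<^sup>2 < (c0 - \<kappa>)\<^sup>2" using cs0 by (simp add: power_mult_distrib cs4[symmetric])
  then obtain \<Delta> where \<Delta>: "0 < \<Delta>" "\<Delta> \<le> dh" "da\<^sup>2 \<le> 2 * (dsmin - \<Delta>)\<^sup>2"
      "2 - (2 * (dsmin - \<Delta>)\<^sup>2 - da\<^sup>2) / R\<^sup>2 \<le> (c0 - \<kappa>)\<^sup>2"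
    using obstacle_margin_exists[OF dist'(3) da R(2)] by metis
  have \<Delta>ds: "\<Delta> < ds i" "dsmin \<le> ds i" if "i \<in> {1..N}" for i
  proof -
    show "dsmin \<le> ds i" using that by (auto simp: dsmin ds_min_def)
    with \<Delta> dist' show "\<Delta> < ds i" by linarith
  qed

  \<comment> \<open>The solution map for a given basis\<close>
  have part: "\<exists>L>0.
      (\<forall>q vc. (\<forall>i\<in>{1..N}. - \<Delta> \<le> obs_h qo ds i q) \<longrightarrow>
        varphi_defined N qo ds \<phi> (two_slope a b) c0 dr vbar S q vc) \<and>
      (\<forall>q1 q2 vc1 vc2. (\<forall>i\<in>{1..N}. - \<Delta> \<le> min (obs_h qo ds i q1) (obs_h qo ds i q2)) \<longrightarrow>
        norm (varphi N qo ds \<phi> (two_slope a b) c0 dr vbar S q1 vc1 -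
          varphi N qo ds \<phi> (two_slope a b) c0 dr vbar S q2 vc2) \<le> L * (norm (q1 - q2) + norm (vc1 - vc2)))"
    if S: "positive_basis c0 S" for S :: "(real^'n) set"
  proof -
    define D where "D = {q. \<forall>i\<in>{1..N}. - \<Delta> \<le> obs_h qo ds i q}"
    have unit: "norm l = 1" if "l \<in> S" for l using S that by (simp add: positive_basis_def)
    have far: "dsmin - \<Delta> \<le> norm (qo i - q)" if "q \<in> D" "i \<in> {1..N}" for q i
    proof -
      have "- \<Delta> \<le> obs_h qo ds i q" using that by (simp add: D_def)
      with \<Delta>ds(2)[OF that(2)] show ?thesis by (simp add: obs_h_def)
    qed
    have m: "0 < dsmin - \<Delta>" using \<Delta> dist' by linarith
    have ne: "qp_feasible (two_slope a b) c0 dr vbar S (r_fun N qo ds \<phi> q) \<noteq> {}" if "q \<in> D" for q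
      unfolding \<phi>_def[abs_def]
    proof (rule qp_feasible_nonempty_ramp[OF obstacles(1) unit ab c00 \<kappa>0 \<kappa>le v_pos(2) _ dist _ \<Delta>(2)])
      show "da\<^sup>2 \<le> 2 * (ds_min N ds - \<Delta>)\<^sup>2" using \<Delta>(3) by (simp add: dsmin)
      show "2 - (2 * (ds_min N ds - \<Delta>)\<^sup>2 - da\<^sup>2) / (ds_max N ds + db / 2)\<^sup>2 \<le> (c0 - \<kappa>)\<^sup>2"
        using \<Delta>(4) by (simp add: dsmin dsmax R_def)
      show "- \<Delta> \<le> obs_h qo ds i q" if "i \<in> {1..N}" for i using \<open>q \<in> D\<close> that by (simp add: D_def)
      show "(dr - c0 * two_slope a b (- dh)) / \<kappa> \<le> c0 * two_slope a b (db / 2) - dr" using \<alpha>dh by simp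
    qed (use d v_pos \<Delta> \<alpha>db in \<open>auto simp: B_def\<close>)
    have def: "varphi_defined N qo ds \<phi> (two_slope a b) c0 dr vbar S q vc" if q: "q \<in> D" for q vc
    proof (rule varphi_defined_of_feasible[OF ne[OF q]])
      fix i assume "i \<in> {1..N}"
      from far[OF q this] m show "q \<noteq> qo i" by auto
    qed
    have fin: "finite S" using S by (simp add: positive_basis_def)
    have "\<exists>L>0. \<forall>q1\<in>D. \<forall>q2\<in>D. \<forall>vc1 vc2.
        norm (varphi N qo ds \<phi> (two_slope a b) c0 dr vbar S q1 vc1 -
          varphi N qo ds \<phi> (two_slope a b) c0 dr vbar S q2 vc2) \<le> L * (norm (q1 - q2) + norm (vc1 - vc2))"
      by (rule varphi_lipschitz[OF obstacles(1) fin unit less_imp_le[OF c00] two_slope_lipschitz[OF ab] \<phi>lip m ne far])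
    then obtain L where L: "L > 0" "\<forall>q1\<in>D. \<forall>q2\<in>D. \<forall>vc1 vc2.
        norm (varphi N qo ds \<phi> (two_slope a b) c0 dr vbar S q1 vc1 -
          varphi N qo ds \<phi> (two_slope a b) c0 dr vbar S q2 vc2) \<le> L * (norm (q1 - q2) + norm (vc1 - vc2))"
      by (elim exE conjE)
    show ?thesis
    proof (intro exI[of _ L] conjI allI impI L(1))
      fix q vc assume "\<forall>i\<in>{1..N}. - \<Delta> \<le> obs_h qo ds i q"
      then show "varphi_defined N qo ds \<phi> (two_slope a b) c0 dr vbar S q vc"
        by (intro def) (simp add: D_def)
    next
      fix q1 q2 vc1 vc2 assume "\<forall>i\<in>{1..N}. - \<Delta> \<le> min (obs_h qo ds i q1) (obs_h qo ds i q2)"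
      then have "q1 \<in> D" "q2 \<in> D" by (simp_all add: D_def)
      then show "norm (varphi N qo ds \<phi> (two_slope a b) c0 dr vbar S q1 vc1 -
          varphi N qo ds \<phi> (two_slope a b) c0 dr vbar S q2 vc2) \<le> L * (norm (q1 - q2) + norm (vc1 - vc2))"
        using L(2) by blast
    qed
  qed

  \<comment> \<open>Decrease of \<open>W\<close> for a given basis and gain\<close>
  have decrease: "\<exists>\<alpha>w dw. class_Ke \<alpha>w \<and> lipschitz_fun_on UNIV \<alpha>w \<and> dw > 0 \<and>
      (\<forall>q qd vc qdd vc'. norm vc \<le> vcbar \<and> norm vc' \<le> vcd \<and>
         varphi_defined N qo ds \<phi> (two_slope a b) c0 dr vbar S q vc \<and>
         el_dynamics M C Nv q qd qdd (inner_loop C Nv kD q qd (vp q vc)) \<and>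
         W_fun N qo ds M \<mu>1 \<mu>2 vcd vbar dr kD L vp (q, qd, vc) \<le> dw \<longrightarrow>
         (\<forall>\<delta>\<in>clarke_gradient (W_fun N qo ds M \<mu>1 \<mu>2 vcd vbar dr kD L vp) (q, qd, vc).
            \<delta> \<bullet> (qd, qdd, vc') \<le> - \<alpha>w (W_fun N qo ds M \<mu>1 \<mu>2 vcd vbar dr kD L vp (q, qd, vc))))"
    if S: "positive_basis c0 S" and vp: "vp = varphi N qo ds \<phi> (two_slope a b) c0 dr vbar S" and L: "0 < L"
      and lip: "\<And>q1 q2 vc1 vc2. \<forall>i\<in>{1..N}. - \<Delta> \<le> min (obs_h qo ds i q1) (obs_h qo ds i q2) \<Longrightarrow>
        norm (vp q1 vc1 - vp q2 vc2) \<le> L * (norm (q1 - q2) + norm (vc1 - vc2))"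
      and kD: "kD > 2 * real CARD('n) * L * (\<mu>2 ^ 3 * (vcd + vbar) / (\<mu>1\<^sup>2 * dr))"
    for S :: "(real^'n) set" and vp L kD
  proof -
    have \<mu>: "0 < \<mu>1" "\<mu>1 \<le> \<mu>2" using EL el_assumption_inner_bounds(4)[OF EL] by (auto simp: el_assumption_def)
    have n: "1 \<le> real CARD('n)" using one_le_card_finite[where 'a = 'n] by simp
    \<comment> \<open>\<open>vcd\<close> bounds the rate of the velocity command and
      \<open>vbar - dr\<close> the norm of the (QP) solution; adding \<open>dr\<close> recovers the
      factor \<open>vcd + vbar\<close> in the condition on \<open>kD\<close>.\<close>
    have D: "0 < vcd + vbar - dr" using vc_bounds d by simp
    have kD': "2 * real CARD('n) * L * (\<mu>2 ^ 3 * ((vcd + vbar - dr) + dr) / (\<mu>1\<^sup>2 * dr)) < kD"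
      using kD by simp
    obtain p s dw where ps: "0 < p" "0 < s" "0 < dw" "dw < \<Delta>"
      and obs: "\<And>w x. w \<le> dw \<Longrightarrow> 0 \<le> x \<Longrightarrow> \<mu>1 * x\<^sup>2 \<le> 2 * (w + real CARD('n) * L * \<mu>1 * \<mu>2\<^sup>2 *
          (vcd + vbar - dr) * dr / (\<mu>1 * kD - 2 * real CARD('n) * L * \<mu>2\<^sup>2)) \<Longrightarrow>
        a * max 0 (- w) - dr + x \<le> - two_slope p s w"
      and energy: "\<And>w x. w \<le> dw \<Longrightarrow> 0 \<le> x \<Longrightarrow> 2 * (w + real CARD('n) * L * \<mu>1 * \<mu>2\<^sup>2 *
          (vcd + vbar - dr) * dr / (\<mu>1 * kD - 2 * real CARD('n) * L * \<mu>2\<^sup>2)) \<le> \<mu>2 * x\<^sup>2 \<Longrightarrow>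
        - kD * x\<^sup>2 + L * (x + (vcd + vbar - dr)) * (\<mu>2 * x) \<le> - two_slope p s w"
      by (rule decay_rate_exists[OF \<mu> L D v_pos(2) n kD' ab(1) \<Delta>(1)]) blast
    show ?thesis
    proof (intro exI[of _ "two_slope p s"] exI[of _ dw] conjI allI impI ballI)
      show "class_Ke (two_slope p s)" "lipschitz_fun_on UNIV (two_slope p s)" "dw > 0"
        using ps two_slope_class_Ke by auto
      fix q qd vc qdd vc' :: "real^'n" and \<delta>
      let ?W = "W_fun N qo ds M \<mu>1 \<mu>2 vcd vbar dr kD L vp"
      assume H: "norm vc \<le> vcbar \<and> norm vc' \<le> vcd \<and>
         varphi_defined N qo ds \<phi> (two_slope a b) c0 dr vbar S q vc \<and>
         el_dynamics M C Nv q qd qdd (inner_loop C Nv kD q qd (vp q vc)) \<and> ?W (q, qd, vc) \<le> dw"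
        and \<delta>: "\<delta> \<in> clarke_gradient ?W (q, qd, vc)"
      have feas: "vp q vc \<in> qp_feasible (two_slope a b) c0 dr vbar S (r_fun N qo ds \<phi> q)"
        unfolding vp using H by (intro varphi_in_qp_feasible) simp
      have qne: "q \<noteq> qo i" if "i \<in> {1..N}" for i using H that by (simp add: varphi_defined_def)
      have le: "?W (q, qd, vc) \<le> dw" using H by simp
      show "\<delta> \<bullet> (qd, qdd, vc') \<le> - two_slope p s (?W (q, qd, vc))"
      proof (rule W_fun_decrease[OF EL \<Delta>ds(1) less_imp_le[OF L] lip refl])
        show "norm (vp q vc) \<le> vbar - dr"
          using feas d by (intro positive_basis_norm_le[OF S c00 c0(2)]) (auto simp: qp_feasible_def)
        show "obs_dir qo i q \<bullet> vp q vc \<le> a * max 0 (obs_h qo ds i q) - dr" if "i \<in> {1..N}" for i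
          by (rule obs_dir_inner_feasible_le[OF S c00 c0(2) ab v_pos(2) \<phi>0 that qne[OF that] feas])
        show "norm vc' \<le> vcd" "el_dynamics M C Nv q qd qdd (inner_loop C Nv kD q qd (vp q vc))"
          using H by auto
        show "?W (q, qd, vc) < \<Delta>" using le ps(4) by simp
      qed (assumption | rule \<delta> | erule (1) obs[OF le] | erule (1) energy[OF le])+
    qed
  qed

  show ?thesis
  proof (rule exI[of _ \<phi>], rule exI[of _ c0], rule exI[of _ "two_slope a b"], intro conjI allI impI)
    show "lipschitz_fun_on {-1..1} \<phi>" using \<phi>lip unfolding lipschitz_fun_on_def by blast
    show "\<forall>s\<in>{-1..1}. 0 \<le> \<phi> s" using B0 by (simp add: \<phi>_def)
    show "antimono_on {-1..1} \<phi>" using B0 by (auto simp: \<phi>_def monotone_on_def intro!: mult_left_mono)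
    show "class_Ke (two_slope a b)" "lipschitz_fun_on UNIV (two_slope a b)" "bij (two_slope a b)"
      "lipschitz_fun_on UNIV (inv (two_slope a b))"
      by (rule two_slope_class_Ke[OF ab] two_slope_bij(1)[OF ab])+
    show "sqrt cs + sqrt (cs + dr / (vbar - dr)) < c0" using c0 by (simp add: e_def)
    show "c0 * two_slope a b (db / 2) - dr \<le> c0 * (vbar - dr)" using \<alpha>db by simp
    show "\<forall>s\<in>{-1..<c0}. phi_lower_bound (two_slope a b) c0 \<kappa> vbar dr dh s < \<phi> s" using \<phi>lb by blast
    show "\<forall>s\<in>{c0..1}. \<phi> s = 0" using \<phi>0 by blast
    fix S :: "(real^'n) set" assume S: "positive_basis c0 S"
    from part[OF S] obtain L where L: "L > 0"
      and def: "\<forall>q vc. (\<forall>i\<in>{1..N}. - \<Delta> \<le> obs_h qo ds i q) \<longrightarrow>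
        varphi_defined N qo ds \<phi> (two_slope a b) c0 dr vbar S q vc"
      and lip: "\<forall>q1 q2 vc1 vc2. (\<forall>i\<in>{1..N}. - \<Delta> \<le> min (obs_h qo ds i q1) (obs_h qo ds i q2)) \<longrightarrow>
        norm (varphi N qo ds \<phi> (two_slope a b) c0 dr vbar S q1 vc1 -
          varphi N qo ds \<phi> (two_slope a b) c0 dr vbar S q2 vc2) \<le> L * (norm (q1 - q2) + norm (vc1 - vc2))"
      by (elim exE conjE)
    show "let vp = varphi N qo ds \<phi> (two_slope a b) c0 dr vbar S;
            vp_defined = varphi_defined N qo ds \<phi> (two_slope a b) c0 dr vbar S
        in \<exists>\<Delta>h L :: real. \<Delta>h > 0 \<and> L > 0 \<and>
          (\<forall>q vc. (\<forall>i\<in>{1..N}. obs_h qo ds i q \<ge> - \<Delta>h) \<longrightarrow> vp_defined q vc) \<and>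
          (\<forall>q1 q2 vc1 vc2.
             (\<forall>i\<in>{1..N}. min (obs_h qo ds i q1) (obs_h qo ds i q2) \<ge> - \<Delta>h) \<longrightarrow>
             norm (vp q1 vc1 - vp q2 vc2) \<le> L * (norm (q1 - q2) + norm (vc1 - vc2))) \<and>
          (\<forall>kD. kD > 0 \<and>
                kD > 2 * real CARD('n) * L * (\<mu>2 ^ 3 * (vcd + vbar) / (\<mu>1\<^sup>2 * dr)) \<longrightarrow>
             (let W = W_fun N qo ds M \<mu>1 \<mu>2 vcd vbar dr kD L vp
              in \<exists>(\<alpha>w :: real \<Rightarrow> real) dw.
                class_Ke \<alpha>w \<and> lipschitz_fun_on UNIV \<alpha>w \<and> dw > 0 \<and>
                (\<forall>q qd vc qdd vc'.
                   norm vc \<le> vcbar \<and> norm vc' \<le> vcd \<and> vp_defined q vc \<and>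
                   el_dynamics M C Nv q qd qdd (inner_loop C Nv kD q qd (vp q vc)) \<and>
                   W (q, qd, vc) \<le> dw \<longrightarrow>
                   (\<forall>\<delta>\<in>clarke_gradient W (q, qd, vc).
                      \<delta> \<bullet> (qd, qdd, vc') \<le> - \<alpha>w (W (q, qd, vc))))))"
      unfolding Let_def
    proof (rule exI[of _ \<Delta>], rule exI[of _ L], intro conjI \<Delta>(1) L def lip, intro allI impI)
      fix kD assume kD: "kD > 0 \<and> kD > 2 * real CARD('n) * L * (\<mu>2 ^ 3 * (vcd + vbar) / (\<mu>1\<^sup>2 * dr))"
      show "\<exists>\<alpha>w dw. class_Ke \<alpha>w \<and> lipschitz_fun_on UNIV \<alpha>w \<and> dw > 0 \<and>
        (\<forall>q qd vc qdd vc'. norm vc \<le> vcbar \<and> norm vc' \<le> vcd \<and>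
          varphi_defined N qo ds \<phi> (two_slope a b) c0 dr vbar S q vc \<and>
          el_dynamics M C Nv q qd qdd (inner_loop C Nv kD q qd
            (varphi N qo ds \<phi> (two_slope a b) c0 dr vbar S q vc)) \<and>
          W_fun N qo ds M \<mu>1 \<mu>2 vcd vbar dr kD L (varphi N qo ds \<phi> (two_slope a b) c0 dr vbar S)
            (q, qd, vc) \<le> dw \<longrightarrow>
          (\<forall>\<delta>\<in>clarke_gradient (W_fun N qo ds M \<mu>1 \<mu>2 vcd vbar dr kD L
              (varphi N qo ds \<phi> (two_slope a b) c0 dr vbar S)) (q, qd, vc).
            \<delta> \<bullet> (qd, qdd, vc') \<le> - \<alpha>w (W_fun N qo ds M \<mu>1 \<mu>2 vcd vbar dr kD L
              (varphi N qo ds \<phi> (two_slope a b) c0 dr vbar S) (q, qd, vc))))"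
        by (rule decrease[OF S refl L _ conjunct2[OF kD]]) (use lip in blast)
    qed
  qed (use c0 c00 \<alpha>dh in auto)
qed

end
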